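(* Let $W:\mathbb{R}^{3\times3}\to[0,\infty)$ be continuous and satisfy hypotheses $(H_1)$–$(H_3)$ listed in the context, with $A'=B'$ (so $A'=B'=0$ and $A_3=-B_3$). Let $h_n\to0^+$ and $\varepsilon_n\to0^+$ be arbitrary sequences such that $\sup_n\varepsilon_n/h_n^p<\infty$. Then, for any $\{u_n\}\subset H^2(\Omega;\mathbb{R}^3)$ such that $\sup_nF_{\varepsilon_n}^{h_n}(u_n)<\infty$, there exist a subsequence (not relabeled) and $\xi_0\in\{A,B\}$ such that $\nabla_{h_n}u_n\to\xi_0$ in $L^p(\Omega;\mathbb{R}^{3\times3})$.
   Context: $I:=(-\frac12,\frac12)$, $\omega\subset\mathbb{R}^2$ is a bounded convex open set, $\Omega:=\omega\times I$. For $\xi\in\mathbb{R}^{3\times3}$ write $\xi=(\xi_1,\xi_2,\xi_3)$ (columns), $\xi'=(\xi_1,\xi_2)\in\mathbb{R}^{3\times2}$; $|\cdot|$ is the Euclidean norm. Hypotheses: $(H_1)$ $\{W=0\}=\{A,B\}$ with $A=(A',A_3)\ne B=(B',B_3)$ in $\mathbb{R}^{3\times2}\times\mathbb{R}^3$, normalized so that, for some $a\in\mathbb{R}^3$, $A'=-B'=a\otimes e_1'$ with $e_1'=(1,0)$ and $A_3=-B_3$. $(H_2)$ $\frac1{C_1}|\xi|^p-C_1\le W(\xi)\le C_1|\xi|^p+C_1$ for some $p\ge2$, $C_1>0$. $(H_3)$ There are $\varrho>0$, $C_2>0$ with $\frac1{C_2}\mathrm{dist}(\xi,\{A,B\})^p\le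 W(\xi)\le C_2\,\mathrm{dist}(\xi,\{A,B\})^p$ whenever $\mathrm{dist}(\xi,\{A,B\})\le\varrho$. For $h,\varepsilon>0$ and $u\in H^2(\Omega;\mathbb{R}^3)$: $\nabla_hu:=(\partial_1u,\partial_2u,\frac1h\partial_3u)$, $|\nabla^2_hu|^2:=\sum_{i,j\in\{1,2\}}|\partial^2_{ij}u|^2+\frac{2}{h^2}\sum_{i\in\{1,2\}}|\partial^2_{i3}u|^2+\frac1{h^4}|\partial^2_{33}u|^2$, and $F_\varepsilon^h(u):=\int_\Omega\frac1\varepsilon W(\nabla_hu)+\varepsilon|\nabla_h^2u|^2\,dx$. *)

theory Defs
  imports "HOL-Analysis.Analysis"
begin

section \<open>Lebesgue and Sobolev spaces\<close>

text \<open>Functions are defined on the whole space; only their restriction to \<open>\<Omega>\<close> matters, and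
  elements of \<open>L\<^sup>p\<close> and \<open>H\<^sup>2\<close> are represented by functions rather than by classes modulo null sets.
  The exponent is a finite real \<open>p \<ge> 1\<close>.\<close>

definition Lp_on :: "real \<Rightarrow> 'a::euclidean_space set \<Rightarrow> ('a \<Rightarrow> 'b::euclidean_space) set" where
  "Lp_on p \<Omega> = {f. f \<in> borel_measurable (lebesgue_on \<Omega>) \<and>
                   integrable (lebesgue_on \<Omega>) (\<lambda>x. norm (f x) powr p)}"

definition Lp_norm :: "real \<Rightarrow> 'a::euclidean_space set \<Rightarrow> ('a \<Rightarrow> 'b::euclidean_space) \<Rightarrow> real" where
  "Lp_norm p \<Omega> f = (LINT x|lebesgue_on \<Omega>. norm (f x) powr p) powr (1 / p)"

definition Lp_converges ::
  "real \<Rightarrow> 'a::euclidean_space set \<Rightarrow> (nat \<Rightarrow> 'a \<Rightarrow> 'b::euclidean_space) \<Rightarrow> ('a \<Rightarrow> 'b) \<Rightarrow> bool" where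
  "Lp_converges p \<Omega> f g \<longleftrightarrow>
     (\<forall>n. f n \<in> Lp_on p \<Omega>) \<and> g \<in> Lp_on p \<Omega> \<and>
     (\<lambda>n. Lp_norm p \<Omega> (\<lambda>x. f n x - g x)) \<longlonglongrightarrow> 0"

definition locally_integrable :: "'a::euclidean_space set \<Rightarrow> ('a \<Rightarrow> 'b::euclidean_space) \<Rightarrow> bool" where
  "locally_integrable \<Omega> f \<longleftrightarrow> (\<forall>K. compact K \<and> K \<subseteq> \<Omega> \<longrightarrow> integrable (lebesgue_on K) f)"

definition partial_deriv :: "'n::finite \<Rightarrow> (real ^ 'n \<Rightarrow> real) \<Rightarrow> real ^ 'n \<Rightarrow> real" where
  "partial_deriv i \<phi> x = frechet_derivative \<phi> (at x) (axis i 1)"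

primrec C_k :: "nat \<Rightarrow> (real ^ 'n::finite \<Rightarrow> real) \<Rightarrow> bool" where
  "C_k 0 \<phi> \<longleftrightarrow> continuous_on UNIV \<phi>"
| "C_k (Suc k) \<phi> \<longleftrightarrow> \<phi> differentiable_on UNIV \<and> (\<forall>i. C_k k (partial_deriv i \<phi>))"

text \<open>The space \<open>C\<^sub>c\<^sup>\<infinity>(\<Omega>)\<close>, each element being extended by zero to the whole space.\<close>

definition test_functions :: "(real ^ 'n::finite) set \<Rightarrow> (real ^ 'n \<Rightarrow> real) set" where
  "test_functions \<Omega> = {\<phi>. (\<forall>k. C_k k \<phi>) \<and> compact (closure {x. \<phi> x \<noteq> 0}) \<and>
                          closure {x. \<phi> x \<noteq> 0} \<subseteq> \<Omega>}"

definition has_weak_deriv ::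
  "(real ^ 'n::finite) set \<Rightarrow> 'n \<Rightarrow> (real ^ 'n \<Rightarrow> 'b::euclidean_space) \<Rightarrow> (real ^ 'n \<Rightarrow> 'b) \<Rightarrow> bool" where
  "has_weak_deriv \<Omega> i u v \<longleftrightarrow>
     locally_integrable \<Omega> u \<and> locally_integrable \<Omega> v \<and>
     (\<forall>\<phi> \<in> test_functions \<Omega>.
        (LINT x|lebesgue_on \<Omega>. partial_deriv i \<phi> x *\<^sub>R u x) =
        - (LINT x|lebesgue_on \<Omega>. \<phi> x *\<^sub>R v x))"

text \<open>For open \<open>\<Omega>\<close> a weak derivative is unique up to null sets, so the choice of representative
  below is immaterial for integrals over \<open>\<Omega>\<close>. If there is no weak derivative the value is
  unspecified.\<close>

definition weak_deriv ::
  "(real ^ 'n::finite) set \<Rightarrow> 'n \<Rightarrow> (real ^ 'n \<Rightarrow> 'b::euclidean_space) \<Rightarrow> real ^ 'n \<Rightarrow> 'b" where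
  "weak_deriv \<Omega> i u = (SOME v. has_weak_deriv \<Omega> i u v)"

abbreviation weak_deriv2 ::
  "(real ^ 'n::finite) set \<Rightarrow> 'n \<Rightarrow> 'n \<Rightarrow> (real ^ 'n \<Rightarrow> 'b::euclidean_space) \<Rightarrow> real ^ 'n \<Rightarrow> 'b" where
  "weak_deriv2 \<Omega> i j u \<equiv> weak_deriv \<Omega> i (weak_deriv \<Omega> j u)"

definition H2 :: "(real ^ 'n::finite) set \<Rightarrow> (real ^ 'n \<Rightarrow> 'b::euclidean_space) set" where
  "H2 \<Omega> = {u. u \<in> Lp_on 2 \<Omega> \<and>
     (\<forall>j. (\<exists>v. has_weak_deriv \<Omega> j u v) \<and> weak_deriv \<Omega> j u \<in> Lp_on 2 \<Omega>) \<and>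
     (\<forall>i j. (\<exists>v. has_weak_deriv \<Omega> i (weak_deriv \<Omega> j u) v) \<and> weak_deriv2 \<Omega> i j u \<in> Lp_on 2 \<Omega>)}"

section \<open>The thin domain and the rescaled functional\<close>

definition cylinder :: "(real ^ 2) set \<Rightarrow> (real ^ 3) set" where
  "cylinder \<omega> = {x. vector [x $ 1, x $ 2] \<in> \<omega> \<and> x $ 3 \<in> {- 1/2 <..< 1/2}}"

text \<open>Matrices are indexed row first, so \<open>\<xi> $ i $ j\<close> is the \<open>i\<close>-th component of the column \<open>\<xi>\<^sub>j\<close>;
  the norm of \<open>real ^ 3 ^ 3\<close> is the Euclidean (Frobenius) norm. The column \<open>\<xi>\<^sub>3\<close> is
  \<open>column 3 \<xi>\<close>, and the following is \<open>\<xi>' = (\<xi>\<^sub>1, \<xi>\<^sub>2)\<close>.\<close>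

definition planar_part :: "real ^ 3 ^ 3 \<Rightarrow> real ^ 2 ^ 3" where
  "planar_part \<xi> = (\<chi> i. vector [\<xi> $ i $ 1, \<xi> $ i $ 2])"

definition tensor :: "real ^ 'm \<Rightarrow> real ^ 'n \<Rightarrow> real ^ 'n ^ 'm" where
  "tensor a b = (\<chi> i j. a $ i * b $ j)"

definition scaled_grad ::
  "(real ^ 3) set \<Rightarrow> real \<Rightarrow> (real ^ 3 \<Rightarrow> real ^ 3) \<Rightarrow> real ^ 3 \<Rightarrow> real ^ 3 ^ 3" where
  "scaled_grad \<Omega> h u x =
     (\<chi> i j. (if j = 3 then 1 / h else 1) * weak_deriv \<Omega> j u x $ i)"

definition scaled_hess_sq ::
  "(real ^ 3) set \<Rightarrow> real \<Rightarrow> (real ^ 3 \<Rightarrow> real ^ 3) \<Rightarrow> real ^ 3 \<Rightarrow> real" where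
  "scaled_hess_sq \<Omega> h u x =
     (\<Sum>i\<in>{1, 2}. \<Sum>j\<in>{1, 2}. (norm (weak_deriv2 \<Omega> i j u x))\<^sup>2)
     + 2 / h\<^sup>2 * (\<Sum>i\<in>{1, 2}. (norm (weak_deriv2 \<Omega> i 3 u x))\<^sup>2)
     + 1 / h ^ 4 * (norm (weak_deriv2 \<Omega> 3 3 u x))\<^sup>2"

text \<open>The integrand is nonnegative for \<open>W \<ge> 0\<close> and \<open>\<epsilon> > 0\<close>, and the functional may be infinite.\<close>

definition energy ::
  "(real ^ 3 ^ 3 \<Rightarrow> real) \<Rightarrow> (real ^ 3) set \<Rightarrow> real \<Rightarrow> real \<Rightarrow> (real ^ 3 \<Rightarrow> real ^ 3) \<Rightarrow> ennreal" where
  "energy W \<Omega> h \<epsilon> u =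
     (\<integral>\<^sup>+ x. ennreal (1 / \<epsilon> * W (scaled_grad \<Omega> h u x) + \<epsilon> * scaled_hess_sq \<Omega> h u x) \<partial>lebesgue_on \<Omega>)"

section \<open>Hypotheses on the double-well potential\<close>

definition hyp_wells :: "(real ^ 3 ^ 3 \<Rightarrow> real) \<Rightarrow> real ^ 3 ^ 3 \<Rightarrow> real ^ 3 ^ 3 \<Rightarrow> bool" where
  "hyp_wells W A B \<longleftrightarrow>
     {\<xi>. W \<xi> = 0} = {A, B} \<and> A \<noteq> B \<and>
     (\<exists>a. planar_part A = tensor a (axis 1 1) \<and> - planar_part B = tensor a (axis 1 1)) \<and>
     column 3 A = - column 3 B"

definition hyp_growth :: "(real ^ 3 ^ 3 \<Rightarrow> real) \<Rightarrow> real \<Rightarrow> bool" where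
  "hyp_growth W p \<longleftrightarrow> p \<ge> 2 \<and>
     (\<exists>C>0. \<forall>\<xi>. 1 / C * norm \<xi> powr p - C \<le> W \<xi> \<and> W \<xi> \<le> C * norm \<xi> powr p + C)"

definition hyp_near_wells ::
  "(real ^ 3 ^ 3 \<Rightarrow> real) \<Rightarrow> real ^ 3 ^ 3 \<Rightarrow> real ^ 3 ^ 3 \<Rightarrow> real \<Rightarrow> bool" where
  "hyp_near_wells W A B p \<longleftrightarrow>
     (\<exists>\<rho>>0. \<exists>C>0. \<forall>\<xi>. infdist \<xi> {A, B} \<le> \<rho> \<longrightarrow>
        1 / C * infdist \<xi> {A, B} powr p \<le> W \<xi> \<and> W \<xi> \<le> C * infdist \<xi> {A, B} powr p)"

end

theory Submission
  imports Defs
begin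

text \<open>Since \<open>A = - B\<close> has only the third column \<open>b\<close>, the phase of \<open>u\<close> is the sign of
  \<open>y = \<partial>\<^sub>3 v\<close>, where \<open>v = (u \<bullet> b) / (h \<bar>b\<bar>\<^sup>2)\<close>. It suffices to show that for every fixed small
  vector \<open>c\<close> the set of points \<open>x\<close> at which the phases at \<open>x\<close> and \<open>x + c\<close> differ has vanishing
  measure: by Fubini one of the phases then disappears on each small ball, by connectedness it is the
  same phase on all balls, and the coercivity of \<open>W\<close> turns this into convergence in \<open>L\<^sup>p\<close>.

  Along \<open>e\<^sub>3\<close> this is a discrete Modica--Mortola estimate: a jump of the phase over a short step \<open>\<tau>\<close>
  forces \<open>y\<close> to change by at least \<open>1\<close> (or to lie in a set of measure \<open>O(\<epsilon>)\<close>), which by Chebyshev's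
  inequality happens on a set of measure at most \<open>\<tau>\<^sup>2 \<integral>\<bar>\<partial>\<^sub>3 y\<bar>\<^sup>2 = O(\<tau>\<^sup>2 h\<^sup>2 / \<epsilon>)\<close>; then \<open>h / \<epsilon>\<close> steps
  are chained. Along \<open>e\<^sub>1\<close> and \<open>e\<^sub>2\<close> the same chaining is applied to \<open>v (x + t e\<^sub>3) - v x\<close>, which is
  close to \<open>\<plusminus> t\<close>; here \<open>\<epsilon> \<le> K h\<^sup>p\<close> bounds \<open>\<partial>\<^sub>1 v\<close> and \<open>\<partial>\<^sub>2 v\<close> in \<open>L\<^sup>2\<close>.\<close>

section \<open>Smooth cutoffs as test functions\<close>

text \<open>The two families of directions need different arguments because the second-order energy
  alone does not exclude interfaces with an in-plane normal. For \<open>i\<close> in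
  \<open>{1, 2}\<close> it bounds the integral of
  \<open>\<bar>\<partial>\<^sub>i y\<bar>\<^sup>2\<close> only by O(\<open>1 / \<epsilon>\<close>),
  and chaining steps of length \<open>\<epsilon>\<close> then gives a jump measure of order 1, which
  is just a finite interface area. Along the third axis the thin-film scaling supplies the extra
  factor \<open>h\<^sup>2\<close>, and the same count tends to 0. What rules out the in-plane
  normals is incompatibility: \<open>A - B\<close> has only a third column, so across such an
  interface the increment of \<open>v\<close> over a vertical segment of length \<open>t\<close>
  would switch between about \<open>t\<close> and \<open>- t\<close>, at a cost that an L2 bound on
  \<open>\<partial>\<^sub>i v\<close> does not allow. This gives no rate, only smallness after
  \<open>N\<close> steps with \<open>N\<close> chosen before \<open>n\<close>.

  Working with translations by fixed vectors keeps the argument at the level of measures of sets.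
  Weak derivatives enter through increments along segments, and no BV compactness is
  invoked.\<close>

text \<open>Coinduction makes every member of a family closed under differentiation smooth at once,
  without formulas for the higher derivatives.\<close>

coinductive smooth1 :: "(real \<Rightarrow> real) \<Rightarrow> bool" where
  "(\<And>s. (\<alpha> has_real_derivative \<alpha>' s) (at s)) \<Longrightarrow> smooth1 \<alpha>' \<Longrightarrow> smooth1 \<alpha>"

lemma smooth1_coinduct_set:
  assumes "\<alpha> \<in> S"
    and step: "\<And>\<beta>. \<beta> \<in> S \<Longrightarrow> \<exists>\<beta>'\<in>S. \<forall>s. (\<beta> has_real_derivative \<beta>' s) (at s)"
  shows "smooth1 \<alpha>"
proof (rule smooth1.coinduct[where X = "\<lambda>\<beta>. \<beta> \<in> S"])
  fix \<beta> assume "\<beta> \<in> S"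
  then obtain \<beta>' where "\<beta>' \<in> S" "\<forall>s. (\<beta> has_real_derivative \<beta>' s) (at s)" using step by blast
  then have "\<beta> = \<beta> \<and> (\<forall>s. (\<beta> has_real_derivative \<beta>' s) (at s)) \<and> (\<beta>' \<in> S \<or> smooth1 \<beta>')" by simp
  then show "\<exists>\<gamma> \<gamma>'. \<beta> = \<gamma> \<and> (\<forall>s. (\<gamma> has_real_derivative \<gamma>' s) (at s)) \<and> (\<gamma>' \<in> S \<or> smooth1 \<gamma>')"
    by (intro exI[of _ \<beta>] exI[of _ \<beta>'])
qed fact

lemma smooth1_deriv:
  assumes "smooth1 \<alpha>"
  shows "\<exists>\<alpha>'. (\<forall>s. (\<alpha> has_real_derivative \<alpha>' s) (at s)) \<and> smooth1 \<alpha>'"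
  using assms
proof (cases rule: smooth1.cases)
  case (1 \<alpha>')
  then have "(\<forall>s. (\<alpha> has_real_derivative \<alpha>' s) (at s)) \<and> smooth1 \<alpha>'" by simp
  then show ?thesis by (rule exI[of _ \<alpha>'])
qed

lemma smooth1_continuous:
  assumes "smooth1 \<alpha>"
  shows "continuous_on S \<alpha>"
proof -
  obtain \<alpha>' where "\<forall>s. (\<alpha> has_real_derivative \<alpha>' s) (at s)"
    using smooth1_deriv[OF assms] by (elim exE conjE)
  then show ?thesis
    by (intro continuous_at_imp_continuous_on ballI) (rule DERIV_isCont, erule spec)
qed

text \<open>The derivative of the averaged cutoff in \<open>smooth1_shift_integral\<close> has
  exactly this form.\<close>

lemma smooth1_diff_shift:
  assumes "smooth1 \<alpha>"
  shows "smooth1 (\<lambda>s. \<alpha> s - \<alpha> (s - t))"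
proof (rule smooth1_coinduct_set[where S = "(\<lambda>\<beta> s. \<beta> s - \<beta> (s - t)) ` Collect smooth1"])
  fix \<gamma> assume "\<gamma> \<in> (\<lambda>\<beta> s. \<beta> s - \<beta> (s - t)) ` Collect smooth1"
  then obtain \<beta> where \<beta>: "smooth1 \<beta>" "\<gamma> = (\<lambda>s. \<beta> s - \<beta> (s - t))" by (elim imageE CollectE)
  obtain \<beta>' where \<beta>': "\<forall>s. (\<beta> has_real_derivative \<beta>' s) (at s)" "smooth1 \<beta>'"
    using smooth1_deriv[OF \<beta>(1)] by (elim exE conjE)
  have "(\<gamma> has_real_derivative (\<beta>' s - \<beta>' (s - t))) (at s)" for s
  proof -
    have "((\<lambda>s. \<beta> (s - t)) has_real_derivative \<beta>' (s - t) * 1) (at s)"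
      by (rule DERIV_chain2[OF \<beta>'(1)[THEN spec]]) (auto intro!: derivative_eq_intros)
    then show ?thesis unfolding \<beta>(2) by (auto intro!: DERIV_diff \<beta>'(1)[THEN spec])
  qed
  then show "\<exists>\<beta>'\<in>(\<lambda>\<beta> s. \<beta> s - \<beta> (s - t)) ` Collect smooth1. \<forall>s. (\<gamma> has_real_derivative \<beta>' s) (at s)"
    using \<beta>'(2) by (intro bexI[of _ "\<lambda>s. \<beta>' s - \<beta>' (s - t)"] allI imageI CollectI)
qed (use assms in \<open>intro imageI CollectI\<close>)

section \<open>Products of one-variable functions as test functions\<close>

lemma has_derivative_prod_coords:
  fixes \<alpha> :: "'n::finite \<Rightarrow> real \<Rightarrow> real"
  assumes "\<And>j s. (\<alpha> j has_real_derivative \<alpha>' j s) (at s)"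
  shows "((\<lambda>x::real^'n. \<Prod>j\<in>UNIV. \<alpha> j (x $ j)) has_derivative
          (\<lambda>y. \<Sum>i\<in>UNIV. (\<alpha>' i (x $ i) * y $ i) * (\<Prod>j\<in>UNIV - {i}. \<alpha> j (x $ j)))) (at x)"
proof (rule has_derivative_prod)
  fix i :: 'n
  have "((\<lambda>x::real^'n. x $ i) has_derivative (\<lambda>y. y $ i)) (at x)"
    by (intro bounded_linear.has_derivative[OF bounded_linear_vec_nth] has_derivative_ident)
  from has_derivative_compose[OF this] assms[of i "x $ i"]
  show "((\<lambda>x. \<alpha> i (x $ i)) has_derivative (\<lambda>y. \<alpha>' i (x $ i) * y $ i)) (at x)"
    by (simp add: has_field_derivative_def)
qed

lemma partial_deriv_prod_coords:
  fixes \<alpha> :: "'n::finite \<Rightarrow> real \<Rightarrow> real"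
  assumes "\<And>j. smooth1 (\<alpha> j)" and d: "\<And>s. (\<alpha> i has_real_derivative \<beta> s) (at s)"
  shows "partial_deriv i (\<lambda>x::real^'n. \<Prod>j\<in>UNIV. \<alpha> j (x $ j)) =
         (\<lambda>x. \<Prod>j\<in>UNIV. (\<alpha>(i := \<beta>)) j (x $ j))"
proof
  fix x :: "real^'n"
  define \<alpha>' where "\<alpha>' j = (SOME \<alpha>'. \<forall>s. (\<alpha> j has_real_derivative \<alpha>' s) (at s))" for j
  have \<alpha>': "(\<alpha> j has_real_derivative \<alpha>' j s) (at s)" for j s
  proof -
    have "\<exists>\<alpha>'. \<forall>s. (\<alpha> j has_real_derivative \<alpha>' s) (at s)"
      using smooth1_deriv[OF assms(1)[of j]] by (elim exE conjE exI)
    from someI_ex[OF this] show ?thesis unfolding \<alpha>'_def by (rule spec)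
  qed
  have eq: "\<alpha>' i (x $ i) = \<beta> (x $ i)" using \<alpha>' d DERIV_unique by blast
  have "partial_deriv i (\<lambda>x::real^'n. \<Prod>j\<in>UNIV. \<alpha> j (x $ j)) x =
      (\<Sum>k\<in>UNIV. (\<alpha>' k (x $ k) * (axis i 1 :: real^'n) $ k) * (\<Prod>j\<in>UNIV - {k}. \<alpha> j (x $ j)))"
    unfolding partial_deriv_def
    using frechet_derivative_at[OF has_derivative_prod_coords[OF \<alpha>', where x=x], symmetric] by simp
  also have "\<dots> = (\<Sum>k\<in>{i}. (\<alpha>' k (x $ k) * (axis i 1 :: real^'n) $ k) * (\<Prod>j\<in>UNIV - {k}. \<alpha> j (x $ j)))"
    by (rule sum.mono_neutral_right) (auto simp: axis_def)
  also have "\<dots> = \<beta> (x $ i) * (\<Prod>j\<in>UNIV - {i}. \<alpha> j (x $ j))" by (simp add: eq)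
  also have "\<dots> = (\<Prod>j\<in>UNIV. (\<alpha>(i := \<beta>)) j (x $ j))"
    by (subst prod.remove[of UNIV i]) (auto intro!: prod.cong)
  finally show "partial_deriv i (\<lambda>x::real^'n. \<Prod>j\<in>UNIV. \<alpha> j (x $ j)) x =
      (\<Prod>j\<in>UNIV. (\<alpha>(i := \<beta>)) j (x $ j))" .
qed

text \<open>A partial derivative of such a product is again such a product, with one factor replaced
  by its derivative. The induction on \<open>k\<close> therefore lets the factors vary.\<close>

lemma C_k_prod_coords:
  fixes \<alpha> :: "'n::finite \<Rightarrow> real \<Rightarrow> real"
  assumes "\<And>j. smooth1 (\<alpha> j)"
  shows "C_k k (\<lambda>x::real^'n. \<Prod>j\<in>UNIV. \<alpha> j (x $ j))"
  using assms
proof (induction k arbitrary: \<alpha>)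
  case 0
  have "continuous_on UNIV (\<lambda>x::real^'n. \<alpha> j (x $ j))" for j
    by (rule continuous_on_compose2[OF smooth1_continuous[OF 0]])
       (auto intro: continuous_on_component continuous_on_id)
  then show ?case by (auto intro!: continuous_on_prod)
next
  case (Suc k)
  define \<alpha>' where "\<alpha>' j = (SOME \<alpha>'. (\<forall>s. (\<alpha> j has_real_derivative \<alpha>' s) (at s)) \<and> smooth1 \<alpha>')" for j
  have d: "(\<forall>s. (\<alpha> j has_real_derivative \<alpha>' j s) (at s)) \<and> smooth1 (\<alpha>' j)" for j
    using someI_ex[OF smooth1_deriv[OF Suc.prems[of j]]] unfolding \<alpha>'_def .
  have \<alpha>': "(\<alpha> j has_real_derivative \<alpha>' j s) (at s)" "smooth1 (\<alpha>' j)" for j s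
    using d by simp_all
  have "(\<lambda>x::real^'n. \<Prod>j\<in>UNIV. \<alpha> j (x $ j)) differentiable_on UNIV"
    unfolding differentiable_on_def differentiable_def
    by (intro ballI exI, rule has_derivative_prod_coords[OF \<alpha>'(1)])
  moreover have "C_k k (partial_deriv i (\<lambda>x::real^'n. \<Prod>j\<in>UNIV. \<alpha> j (x $ j)))" for i
    unfolding partial_deriv_prod_coords[OF Suc.prems \<alpha>'(1)]
    by (rule Suc.IH) (use Suc.prems \<alpha>'(2) in auto)
  ultimately show ?case by simp
qed

lemma prod_coords_test_function:
  fixes \<alpha> :: "'n::finite \<Rightarrow> real \<Rightarrow> real"
  assumes "\<And>j. smooth1 (\<alpha> j)" and "\<And>j s. s \<notin> {a $ j .. b $ j} \<Longrightarrow> \<alpha> j s = 0"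
    and "cbox a b \<subseteq> \<Omega>"
  shows "(\<lambda>x. \<Prod>j\<in>UNIV. \<alpha> j (x $ j)) \<in> test_functions \<Omega>"
proof -
  have sub: "{x. (\<Prod>j\<in>UNIV. \<alpha> j (x $ j)) \<noteq> 0} \<subseteq> cbox a b"
    using assms(2) by (force simp: mem_box_cart)
  then have "closure {x. (\<Prod>j\<in>UNIV. \<alpha> j (x $ j)) \<noteq> 0} \<subseteq> cbox a b"
    by (simp add: closed_cbox closure_minimal)
  moreover from this have "compact (closure {x. (\<Prod>j\<in>UNIV. \<alpha> j (x $ j)) \<noteq> 0})"
    unfolding compact_closure using bounded_subset[OF bounded_cbox sub] by blast
  moreover have "C_k k (\<lambda>x. \<Prod>j\<in>UNIV. \<alpha> j (x $ j))" for k
    using assms(1) by (rule C_k_prod_coords)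
  ultimately show ?thesis
    using assms(3) by (simp add: test_functions_def)
qed

text \<open>Smoothness holds because the family is closed under differentiation: with
  \<open>q = (s - a) (b - s)\<close>, the derivative has the numerator \<open>P' q\<^sup>2 - m P q' q + c P q'\<close> over
  \<open>q ^ (m + 2)\<close>.\<close>

definition bump :: "real poly \<Rightarrow> nat \<Rightarrow> real \<Rightarrow> real \<Rightarrow> real \<Rightarrow> real \<Rightarrow> real" where
  "bump P m c a b s = (if s \<in> {a<..<b}
     then poly P s / ((s - a) * (b - s)) ^ m * exp (- c / ((s - a) * (b - s))) else 0)"

text \<open>Keeps a single term of the exponential series at \<open>c / q\<close>. With
  \<open>N\<close> larger than the order of a pole in \<open>q\<close>, the exponential beats that
  pole.\<close>

lemma exp_neg_inverse_le:
  fixes c q :: real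
  assumes "c > 0" "q > 0"
  shows "exp (- c / q) \<le> fact N * (q / c) ^ N"
proof -
  have "(c / q) ^ N / fact N \<le> exp (c / q)"
  proof -
    have "(\<Sum>n\<in>{N}. (c / q) ^ n /\<^sub>R fact n) \<le> (\<Sum>n. (c / q) ^ n /\<^sub>R fact n)"
      using assms by (intro sum_le_suminf summable_exp_generic) auto
    then show ?thesis by (simp add: exp_def divide_inverse mult.commute)
  qed
  then have "inverse (exp (c / q)) \<le> inverse ((c / q) ^ N / fact N)"
    using assms by (intro le_imp_inverse_le) auto
  also have "\<dots> = fact N * (q / c) ^ N" by (simp add: power_divide)
  finally show ?thesis by (simp add: exp_minus)
qed

text \<open>The term of order \<open>m + 2\<close> of the exponential series cancels the pole of
  order \<open>m\<close> and leaves two powers of \<open>(s - a) * (b - s)\<close>. Vanishing to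
  second order is what makes the derivative at both end points equal to 0.\<close>

lemma bump_quadratic_bound:
  assumes "c > 0"
  obtains K where "\<And>s. \<bar>bump P m c a b s\<bar> \<le> K * ((s - a) * (b - s))\<^sup>2" 
proof -
  have "compact (poly P ` {a..b})"
    by (intro compact_continuous_image continuous_intros) auto
  then obtain M where M: "\<And>s. s \<in> {a..b} \<Longrightarrow> \<bar>poly P s\<bar> \<le> M"
    by (metis (no_types, lifting) bounded_real compact_imp_bounded imageI)
  define K where "K = \<bar>M\<bar> * fact (m + 2) / c ^ (m + 2)"
  have "\<bar>bump P m c a b s\<bar> \<le> K * ((s - a) * (b - s))\<^sup>2" for s
  proof (cases "s \<in> {a<..<b}")
    case True
    define q where "q = (s - a) * (b - s)"
    have q: "q > 0" using True by (auto simp: q_def)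
    have "\<bar>bump P m c a b s\<bar> = \<bar>poly P s\<bar> / q ^ m * exp (- c / q)"
      using True q by (simp add: bump_def q_def[symmetric] abs_mult power_abs)
    also have "\<dots> \<le> \<bar>M\<bar> / q ^ m * (fact (m + 2) * (q / c) ^ (m + 2))"
      using True q M[of s] exp_neg_inverse_le[OF assms q, of "m + 2"]
      by (intro mult_mono divide_right_mono) auto
    also have "\<dots> = K * q\<^sup>2"
      unfolding K_def power_divide power_add[of q] using q assms by simp
    finally show ?thesis by (simp add: q_def)
  qed (use assms in \<open>auto simp: bump_def K_def\<close>)
  then show ?thesis using that by blast
qed

lemma DERIV_zero_if_quadratic:
  fixes f :: "real \<Rightarrow> real"
  assumes "\<And>s. \<bar>s - x\<bar> < 1 \<Longrightarrow> \<bar>f s\<bar> \<le> K * (s - x)\<^sup>2"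
  shows "(f has_real_derivative 0) (at x)"
proof -
  have f0: "f x = 0" using assms[of x] by simp
  have "((\<lambda>y. (f y - f x) / (y - x)) \<longlongrightarrow> 0) (at x)"
  proof (rule Lim_null_comparison)
    show "\<forall>\<^sub>F y in at x. norm ((f y - f x) / (y - x)) \<le> \<bar>K\<bar> * \<bar>y - x\<bar>"
    proof -
      have "\<forall>\<^sub>F y in at x. y \<noteq> x \<and> \<bar>y - x\<bar> < 1"
        by (auto simp: eventually_at dist_real_def intro!: exI[of _ 1])
      then show ?thesis
      proof eventually_elim
        case (elim y)
        have "\<bar>f y\<bar> \<le> \<bar>K\<bar> * (y - x)\<^sup>2"
          using assms[of y] elim by (meson abs_ge_self mult_right_mono order_trans zero_le_power2)
        then have "\<bar>f y\<bar> / \<bar>y - x\<bar> \<le> \<bar>K\<bar> * \<bar>y - x\<bar>^2 / \<bar>y - x\<bar>"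
          by (intro divide_right_mono) auto
        also have "\<bar>K\<bar> * \<bar>y - x\<bar>^2 / \<bar>y - x\<bar> = \<bar>K\<bar> * \<bar>y - x\<bar>"
          using elim by (metis nonzero_mult_div_cancel_right power2_eq_square times_divide_eq_right right_minus_eq abs_eq_0)
        finally show ?case using f0 by simp
      qed
    qed
    show "((\<lambda>y. \<bar>K\<bar> * \<bar>y - x\<bar>) \<longlongrightarrow> 0) (at x)"
      by (auto intro!: tendsto_eq_intros)
  qed
  then show ?thesis by (simp add: has_field_derivative_iff)
qed

lemma bump_has_derivative:
  assumes "c > 0" "a < b"
  defines "Q \<equiv> [:-a, 1:] * [:b, -1:]"
  shows "(bump P m c a b has_real_derivative
     bump (pderiv P * Q^2 - smult (of_nat m) (P * pderiv Q * Q) + smult c (P * pderiv Q)) (m + 2) c a b s) (at s)"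
proof -
  consider "s \<in> {a<..<b}" | "s = a" | "s = b" | "s < a \<or> s > b" by fastforce
  then show ?thesis
  proof cases
    case 1
    define q where "q = (\<lambda>s. poly Q s)"
    define dq where "dq = (\<lambda>s. poly (pderiv Q) s)"
    have q: "q s = (s - a) * (b - s)" for s by (simp add: q_def Q_def algebra_simps)
    have qpos: "q s > 0" using 1 by (simp add: q)
    have q': "(q has_real_derivative dq s) (at s)"
      unfolding q_def dq_def by (rule poly_DERIV)
    have "((\<lambda>s. poly P s / q s ^ m * exp (- c / q s)) has_real_derivative
      ((poly (pderiv P) s * q s ^ m - poly P s * (of_nat m * q s ^ (m - 1) * dq s)) / (q s ^ m * q s ^ m)) * exp (- c / q s)
       + poly P s / q s ^ m * (exp (- c / q s) * (c * dq s / (q s * q s)))) (at s)"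
      using qpos by (auto intro!: derivative_eq_intros poly_DERIV q') (simp add: field_simps)
    \<comment> \<open>For \<open>m = 0\<close> the exponent \<open>m - 1\<close> is truncated to 0,
      but its term carries the factor \<open>of_nat m\<close>; hence the case split on
      \<open>m\<close>.\<close>
    also have "((poly (pderiv P) s * q s ^ m - poly P s * (of_nat m * q s ^ (m - 1) * dq s)) / (q s ^ m * q s ^ m)) * exp (- c / q s)
       + poly P s / q s ^ m * (exp (- c / q s) * (c * dq s / (q s * q s))) =
       (poly (pderiv P) s * q s^2 - of_nat m * (poly P s * dq s * q s) + c * (poly P s * dq s)) / q s ^ (m + 2) * exp (- c / q s)"
      using qpos by (cases m) (auto simp: field_simps power2_eq_square power_add)
    finally have D: "((\<lambda>s. poly P s / q s ^ m * exp (- c / q s)) has_real_derivative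
       (poly (pderiv P) s * q s^2 - of_nat m * (poly P s * dq s * q s) + c * (poly P s * dq s)) / q s ^ (m + 2) * exp (- c / q s)) (at s)" .
    have "(bump P m c a b has_real_derivative
       (poly (pderiv P) s * q s^2 - of_nat m * (poly P s * dq s * q s) + c * (poly P s * dq s)) / q s ^ (m + 2) * exp (- c / q s)) (at s)"
      by (rule has_field_derivative_transform_within_open[OF D, of "{a<..<b}"])
         (use 1 in \<open>auto simp: bump_def q\<close>)
    then show ?thesis using 1
      by (simp add: bump_def q[symmetric]) (simp add: q_def dq_def)
  next
    case 4
    have "((\<lambda>_. 0) has_real_derivative 0) (at s)" by simp
    then have "(bump P m c a b has_real_derivative 0) (at s)"
      by (rule has_field_derivative_transform_within_open[where S = "- {a..b}"])
         (use 4 in \<open>auto simp: bump_def intro: open_Compl\<close>)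
    then show ?thesis using 4 by (auto simp: bump_def)
  next
    case 2
    obtain K where K: "\<And>s. \<bar>bump P m c a b s\<bar> \<le> K * ((s - a) * (b - s))\<^sup>2"
      using bump_quadratic_bound[OF assms(1)] by blast
    \<comment> \<open>Within distance 1 of one end point the distance to the other is at most
      \<open>b - a + 1\<close>; this is the constant multiplying the quadratic bound.\<close>
    have "(bump P m c a b has_real_derivative 0) (at a)"
    proof (rule DERIV_zero_if_quadratic[where K = "\<bar>K\<bar> * (b - a + 1)\<^sup>2"])
      fix s assume s: "\<bar>s - a\<bar> < 1"
      have "(b - s)\<^sup>2 \<le> (b - a + 1)\<^sup>2"
        using s assms(2) by (intro power2_le_iff_abs_le[THEN iffD2]) auto
      then have "\<bar>K\<bar> * ((s - a)\<^sup>2 * (b - s)\<^sup>2) \<le> \<bar>K\<bar> * ((s - a)\<^sup>2 * (b - a + 1)\<^sup>2)"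
        by (intro mult_left_mono) auto
      moreover have "K * ((s - a) * (b - s))\<^sup>2 \<le> \<bar>K\<bar> * ((s - a)\<^sup>2 * (b - s)\<^sup>2)"
        unfolding power_mult_distrib by (intro mult_right_mono) auto
      ultimately show "\<bar>bump P m c a b s\<bar> \<le> \<bar>K\<bar> * (b - a + 1)\<^sup>2 * (s - a)\<^sup>2"
        using K[of s] by (simp add: mult_ac)
    qed
    then show ?thesis using 2 by (simp add: bump_def)
  next
    case 3
    obtain K where K: "\<And>s. \<bar>bump P m c a b s\<bar> \<le> K * ((s - a) * (b - s))\<^sup>2"
      using bump_quadratic_bound[OF assms(1)] by blast
    have "(bump P m c a b has_real_derivative 0) (at b)"
    proof (rule DERIV_zero_if_quadratic[where K = "\<bar>K\<bar> * (b - a + 1)\<^sup>2"])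
      fix s assume s: "\<bar>s - b\<bar> < 1"
      have "(s - a)\<^sup>2 \<le> (b - a + 1)\<^sup>2"
        using s assms(2) by (intro power2_le_iff_abs_le[THEN iffD2]) auto
      then have "\<bar>K\<bar> * ((s - a)\<^sup>2 * (b - s)\<^sup>2) \<le> \<bar>K\<bar> * ((b - a + 1)\<^sup>2 * (b - s)\<^sup>2)"
        by (intro mult_left_mono mult_right_mono) auto
      moreover have "K * ((s - a) * (b - s))\<^sup>2 \<le> \<bar>K\<bar> * ((s - a)\<^sup>2 * (b - s)\<^sup>2)"
        unfolding power_mult_distrib by (intro mult_right_mono) auto
      ultimately show "\<bar>bump P m c a b s\<bar> \<le> \<bar>K\<bar> * (b - a + 1)\<^sup>2 * (s - b)\<^sup>2"
        using K[of s] by (simp add: mult_ac power2_commute)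
    qed
    then show ?thesis using 3 by (simp add: bump_def)
  qed
qed

lemma smooth1_bump:
  assumes "c > 0" "a < b"
  shows "smooth1 (bump P m c a b)"
proof (rule smooth1_coinduct_set[where S = "{bump P m c a b |P m. True}"])
  fix \<beta> assume "\<beta> \<in> {bump P m c a b |P m. True}"
  then obtain P m where \<beta>: "\<beta> = bump P m c a b" by blast
  show "\<exists>\<beta>'\<in>{bump P m c a b |P m. True}. \<forall>s. (\<beta> has_real_derivative \<beta>' s) (at s)"
    unfolding \<beta>
    by (rule bexI, rule allI, rule bump_has_derivative[OF assms]) blast
qed blast

text \<open>As \<open>c = 1 / Suc k\<close> tends to 0, the exponential tends to 1 inside the
  interval, while smoothness and support do not change with \<open>k\<close>. The result is a smooth
  approximation of the indicator from below.\<close>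

definition cutoff :: "nat \<Rightarrow> real \<Rightarrow> real \<Rightarrow> real \<Rightarrow> real" where
  "cutoff k a b = bump 1 0 (1 / Suc k) a b"

lemma cutoff_props:
  assumes "a < b"
  shows "smooth1 (cutoff k a b)" "0 \<le> cutoff k a b s" "cutoff k a b s \<le> 1"
    "s \<notin> {a<..<b} \<Longrightarrow> cutoff k a b s = 0"
    "(\<lambda>k. cutoff k a b s) \<longlonglongrightarrow> indicator {a<..<b} s"
proof -
  show "smooth1 (cutoff k a b)" unfolding cutoff_def by (rule smooth1_bump) (use assms in auto)
  show "0 \<le> cutoff k a b s" "cutoff k a b s \<le> 1" "s \<notin> {a<..<b} \<Longrightarrow> cutoff k a b s = 0"
    by (auto simp: cutoff_def bump_def)
  have "(\<lambda>k. exp (- (1 / real (Suc k)) / ((s - a) * (b - s)))) \<longlonglongrightarrow> exp (- 0 / ((s - a) * (b - s)))"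
    if "s \<in> {a<..<b}"
    unfolding divide_inverse using that LIMSEQ_inverse_real_of_nat
    by (intro tendsto_exp tendsto_mult tendsto_minus tendsto_const) simp
  then have "(\<lambda>k. exp (- (1 / real (Suc k)) / ((s - a) * (b - s)))) \<longlonglongrightarrow> 1" if "s \<in> {a<..<b}"
    using that by simp
  then show "(\<lambda>k. cutoff k a b s) \<longlonglongrightarrow> indicator {a<..<b} s"
    by (cases "s \<in> {a<..<b}") (auto simp: cutoff_def bump_def)
qed

section \<open>Weak derivatives and difference quotients\<close>

lemma emeasure_lborel_translation:
  fixes c :: "'a::euclidean_space"
  assumes [measurable]: "S \<in> sets borel"
  shows "emeasure lborel {x. x + c \<in> S} = emeasure lborel S"
proof -
  have "emeasure lborel S = emeasure (distr lborel borel ((+) c)) S"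
    by (simp add: lborel_distr_plus)
  also have "\<dots> = emeasure lborel {x. x + c \<in> S}"
    by (subst emeasure_distr) (auto simp: vimage_def add.commute)
  finally show ?thesis by simp
qed

lemma nn_integral_lborel_translation:
  fixes c :: "'a::euclidean_space"
  assumes [measurable]: "f \<in> borel_measurable borel"
  shows "(\<integral>\<^sup>+x. f (x + c) \<partial>lborel) = (\<integral>\<^sup>+x. f x \<partial>lborel)"
proof -
  have "(\<integral>\<^sup>+x. f x \<partial>lborel) = (\<integral>\<^sup>+x. f x \<partial>distr lborel borel ((+) c))"
    by (simp add: lborel_distr_plus)
  also have "\<dots> = (\<integral>\<^sup>+x. f (x + c) \<partial>lborel)"
    by (subst nn_integral_distr) (auto simp: add.commute)
  finally show ?thesis by simp
qed

lemma integral_lborel_translation: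
  fixes c :: "'a::euclidean_space" and f :: "'a \<Rightarrow> real"
  assumes [measurable]: "f \<in> borel_measurable borel"
  shows "(\<integral>x. f (x + c) \<partial>lborel) = (\<integral>x. f x \<partial>lborel)"
proof -
  have "(\<integral>x. f x \<partial>lborel) = (\<integral>x. f x \<partial>distr lborel borel ((+) c))"
    by (simp add: lborel_distr_plus)
  also have "\<dots> = (\<integral>x. f (x + c) \<partial>lborel)"
    by (subst integral_distr) (auto simp: add.commute)
  finally show ?thesis by simp
qed

lemma integrable_lborel_translation:
  fixes c :: "'a::euclidean_space" and f :: "'a \<Rightarrow> real"
  assumes f: "integrable lborel f"
  shows "integrable lborel (\<lambda>x. f (x + c))"
proof -
  have "integrable (distr lborel borel ((+) c)) f"
    by (simp add: lborel_distr_plus f)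
  then show ?thesis
    using f by (subst (asm) integrable_distr_eq) (auto simp: add.commute)
qed

text \<open>Boxes are stable under intersection and generate the Borel sets, so by Dynkin's argument
  the signed measure with density \<open>H\<close> vanishes on every Borel subset of
  \<open>box c d\<close>.\<close>

lemma AE_zero_if_box_integrals_zero:
  fixes H :: "real^'n::finite \<Rightarrow> real"
  assumes H: "integrable lborel H"
    and zero: "\<And>a b. (\<forall>j. a $ j < b $ j) \<Longrightarrow> cbox a b \<subseteq> U \<Longrightarrow>
       (\<integral>x. indicator (box a b) x * H x \<partial>lborel) = 0"
    and cd: "cbox c d \<subseteq> U"
  shows "AE x in lborel. x \<in> box c d \<longrightarrow> H x = 0"
proof -
  have [measurable]: "H \<in> borel_measurable borel" using H by auto
  have box0: "(\<integral>x. indicator (box a b) x * H x \<partial>lborel) = 0" if "cbox a b \<subseteq> U" for a b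
  proof (cases "\<forall>j. a $ j < b $ j")
    case False
    then obtain j where "b $ j \<le> a $ j" by (auto simp: not_less)
    then have "box a b = {}" by (auto simp: interval_eq_empty_cart)
    then show ?thesis by simp
  qed (use that zero in blast)
  \<comment> \<open>The cutoff replaces an arbitrary box by its intersection with
    \<open>box c d\<close>, whose closed version still lies in \<open>U\<close>, where integrals are
    known to vanish.\<close>
  define H' where "H' x = indicator (box c d) x * H x" for x
  have H': "integrable lborel H'"
    unfolding H'_def using integrable_mult_indicator[OF _ H, of "box c d"] by simp
  have stable: "Int_stable (range (\<lambda>(a, b). box a b :: (real^'n) set))"
    by (auto simp: Int_stable_def box_Int_box)
  have pow: "range (\<lambda>(a, b). box a b) \<subseteq> Pow (UNIV :: (real^'n) set)" by simp
  have "AE x in lborel. H' x = 0"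
  proof (rule sigma_finite_measure.density_zero[OF sigma_finite_lborel H'])
    fix A :: "(real^'n) set" assume "A \<in> sets lborel"
    then have "A \<in> sigma_sets UNIV (range (\<lambda>(a, b). box a b :: (real^'n) set))"
      by (simp add: borel_eq_box)
    then show "set_lebesgue_integral lborel A H' = 0"
      unfolding set_lebesgue_integral_def
    proof (induction rule: sigma_sets_induct_disjoint[OF stable pow, consumes 1])
      fix A :: "(real^'n) set" assume "A \<in> range (\<lambda>(a, b). box a b)"
      then obtain a b where A: "A = box a b" by auto
      define a' where "a' = (\<Sum>i\<in>Basis. max (a \<bullet> i) (c \<bullet> i) *\<^sub>R i)"
      define b' where "b' = (\<Sum>i\<in>Basis. min (b \<bullet> i) (d \<bullet> i) *\<^sub>R i)"
      have "box a b \<inter> box c d = box a' b'" by (simp add: box_Int_box a'_def b'_def)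
      moreover have "cbox a' b' \<subseteq> cbox c d"
        by (auto simp: mem_box a'_def b'_def)
      ultimately have "(\<integral>x. indicator (box a b \<inter> box c d) x * H x \<partial>lborel) = 0"
        using box0[of a' b'] cd by auto
      then show "(LINT x|lborel. indicat_real A x *\<^sub>R H' x) = 0"
        by (simp add: A H'_def indicator_inter_arith mult_ac)
    next
      show "(LINT x|lborel. indicat_real {} x *\<^sub>R H' x) = 0" by simp
    next
      fix A :: "(real^'n) set"
      assume A: "A \<in> sigma_sets UNIV (range (\<lambda>(a, b). box a b))"
        and IH: "(LINT x|lborel. indicat_real A x *\<^sub>R H' x) = 0"
      have [measurable]: "A \<in> sets borel" using A by (simp add: borel_eq_box)
      have "(LINT x|lborel. indicat_real (UNIV - A) x *\<^sub>R H' x) =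
          (LINT x|lborel. H' x - indicat_real A x *\<^sub>R H' x)"
        by (intro Bochner_Integration.integral_cong) (auto simp: indicator_def)
      also have "\<dots> = (LINT x|lborel. H' x) - (LINT x|lborel. indicat_real A x *\<^sub>R H' x)"
        by (intro Bochner_Integration.integral_diff H' integrable_mult_indicator) auto
      also have "\<dots> = 0" using IH box0[OF cd] by (simp add: H'_def)
      finally show "(LINT x|lborel. indicat_real (UNIV - A) x *\<^sub>R H' x) = 0" .
    next
      fix A :: "nat \<Rightarrow> (real^'n) set"
      assume dis: "disjoint_family A" and A: "range A \<subseteq> sigma_sets UNIV (range (\<lambda>(a, b). box a b))"
        and IH: "\<And>i. (LINT x|lborel. indicat_real (A i) x *\<^sub>R H' x) = 0"
      have [measurable]: "A i \<in> sets borel" for i using A by (auto simp: borel_eq_box)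
      have "set_lebesgue_integral lborel (\<Union>i. A i) H' = (\<Sum>i. set_lebesgue_integral lborel (A i) H')"
      proof (rule lebesgue_integral_countable_add)
        show "\<And>i j. i \<noteq> j \<Longrightarrow> A i \<inter> A j = {}" using dis by (auto simp: disjoint_family_on_def)
        show "set_integrable lborel (\<Union> (range A)) H'"
          unfolding set_integrable_def by (intro integrable_mult_indicator H') auto
      qed auto
      then show "(LINT x|lborel. indicat_real (\<Union> (range A)) x *\<^sub>R H' x) = 0"
        using IH by (simp add: set_lebesgue_integral_def)
    qed
  qed
  then show ?thesis by eventually_elim (auto simp: H'_def)
qed

text \<open>An open set is a countable union of closed boxes, and the faces of a box are null, so
  only countably many null sets have to be discarded.\<close>

lemma AE_zero_on_open_if_box_integrals_zero:
  fixes H :: "real^'n::finite \<Rightarrow> real"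
  assumes H: "integrable lborel H" and U: "open U"
    and zero: "\<And>a b. (\<forall>j. a $ j < b $ j) \<Longrightarrow> cbox a b \<subseteq> U \<Longrightarrow>
       (\<integral>x. indicator (box a b) x * H x \<partial>lborel) = 0"
  shows "AE x in lborel. x \<in> U \<longrightarrow> H x = 0"
proof -
  obtain D where D: "countable D" "D \<subseteq> Pow U" "\<And>X. X \<in> D \<Longrightarrow> \<exists>a b. X = cbox a b" "\<Union> D = U"
    using open_countable_Union_open_cbox[OF U] by metis
  have "AE x in lborel. \<forall>X\<in>D. x \<in> X \<longrightarrow> H x = 0"
  proof (subst AE_ball_countable[OF D(1)], rule ballI)
    fix X assume X: "X \<in> D"
    then obtain c d where cd: "X = cbox c d" using D(3) by blast
    have "AE x in lborel. x \<in> box c d \<longrightarrow> H x = 0"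
      using AE_zero_if_box_integrals_zero[OF H zero] X D(2) cd by blast
    moreover have "AE x in lborel. x \<notin> cbox c d - box c d"
    proof (rule AE_not_in)
      have "emeasure lborel (cbox c d - box c d) = emeasure lborel (cbox c d) - emeasure lborel (box c d)"
        by (rule emeasure_Diff) (use emeasure_lborel_box_finite[of c d] in \<open>auto simp: box_subset_cbox\<close>)
      also have "\<dots> = 0"
        by (simp add: emeasure_lborel_cbox_eq emeasure_lborel_box_eq)
      finally show "cbox c d - box c d \<in> null_sets lborel" by auto
    qed
    ultimately show "AE x in lborel. x \<in> X \<longrightarrow> H x = 0"
      by eventually_elim (auto simp: cd)
  qed
  then show ?thesis by eventually_elim (use D(4) in auto)
qed

text \<open>Both functions are integrable Borel functions on the whole space, so translations and
  Fubini for \<open>lborel\<close> apply directly; the domain enters through the test functions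
  alone.\<close>

definition borel_weak_deriv ::
  "(real^'n::finite) set \<Rightarrow> 'n \<Rightarrow> (real^'n \<Rightarrow> real) \<Rightarrow> (real^'n \<Rightarrow> real) \<Rightarrow> bool" where
  "borel_weak_deriv \<Omega> i f g \<longleftrightarrow> integrable lborel f \<and> integrable lborel g \<and>
     (\<forall>\<phi>\<in>test_functions \<Omega>. (\<integral>x. partial_deriv i \<phi> x * f x \<partial>lborel) = - (\<integral>x. \<phi> x * g x \<partial>lborel))"

text \<open>The integral from \<open>a - 1\<close> serves on the whole line. To the left of
  \<open>a\<close> it is identically 0, also where the interval is empty; from \<open>a\<close> on,
  the fundamental theorem applies at an interior point of the interval.\<close>

lemma continuous_antiderivative:
  fixes \<alpha> :: "real \<Rightarrow> real"
  assumes cont: "continuous_on UNIV \<alpha>" and zero: "\<And>s. s < a \<Longrightarrow> \<alpha> s = 0"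
  obtains \<Psi> where "\<And>s. (\<Psi> has_real_derivative \<alpha> s) (at s)"
proof -
  define \<Psi> where "\<Psi> s = integral {a - 1..s} \<alpha>" for s
  have z: "\<Psi> s = 0" if "s < a" for s
  proof -
    have "integral {a - 1..s} \<alpha> = integral {a - 1..s} (\<lambda>_. 0)"
      by (rule Henstock_Kurzweil_Integration.integral_cong) (use that zero in auto)
    then show ?thesis by (simp add: \<Psi>_def)
  qed
  have "(\<Psi> has_real_derivative \<alpha> s) (at s)" for s
  proof (cases "s < a")
    case True
    have "((\<lambda>_. 0) has_real_derivative 0) (at s)" by simp
    then have "(\<Psi> has_real_derivative 0) (at s)"
      by (rule has_field_derivative_transform_within_open[where S = "{..<a}"]) (use True z in auto)
    then show ?thesis using True zero by simp
  next
    case False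
    have "((\<lambda>u. integral {a - 1..u} \<alpha>) has_real_derivative \<alpha> s) (at s within {a - 1..s + 1})"
      by (rule integral_has_real_derivative) (use False cont continuous_on_subset in auto)
    then have "((\<lambda>u. integral {a - 1..u} \<alpha>) has_real_derivative \<alpha> s) (at s)"
      using False by (subst (asm) at_within_interior) auto
    then show ?thesis by (simp add: \<Psi>_def[abs_def])
  qed
  then show ?thesis by (rule that)
qed

text \<open>With an antiderivative \<open>\<Psi>\<close> of the cutoff, the average over the shifts
  in \<open>{0..t}\<close> is \<open>\<Psi> s - \<Psi> (s - t)\<close>. Used as a factor of a test
  function it turns the weak derivative identity into one about increments of length
  \<open>t\<close>, without mollifying the function that is differentiated.\<close>

lemma smooth1_shift_integral:
  fixes \<alpha> :: "real \<Rightarrow> real"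
  assumes \<alpha>: "smooth1 \<alpha>" and zero: "\<And>s. s \<notin> {a..b} \<Longrightarrow> \<alpha> s = 0" and "0 \<le> t"
  defines "\<Theta> \<equiv> \<lambda>s. \<integral>r. \<alpha> (s - r) * indicator {0..t} r \<partial>lborel"
  shows "smooth1 \<Theta>" and "(\<Theta> has_real_derivative (\<alpha> s - \<alpha> (s - t))) (at s)"
    and "s \<notin> {a..b + t} \<Longrightarrow> \<Theta> s = 0"
proof -
  have cont: "continuous_on UNIV \<alpha>" using \<alpha> by (rule smooth1_continuous)
  have "\<And>s. s < a \<Longrightarrow> \<alpha> s = 0" using zero by simp
  then obtain \<Psi> where \<Psi>: "\<And>s. (\<Psi> has_real_derivative \<alpha> s) (at s)"
    using continuous_antiderivative[OF cont, of a] by metis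
  have \<Theta>: "\<Theta> s = \<Psi> s - \<Psi> (s - t)" for s
  proof -
    have "has_bochner_integral lborel (\<lambda>r. \<alpha> (s - r) * indicator {0..t} r) (- \<Psi> (s - t) - - \<Psi> (s - 0))"
    proof (rule has_bochner_integral_FTC_Icc_real[OF \<open>0 \<le> t\<close>])
      fix r
      have "((\<lambda>r. \<Psi> (s - r)) has_real_derivative \<alpha> (s - r) * (- 1)) (at r)"
        by (rule DERIV_chain2[OF \<Psi>]) (auto intro!: derivative_eq_intros)
      then show "((\<lambda>r. - \<Psi> (s - r)) has_real_derivative \<alpha> (s - r)) (at r)"
        by (auto dest: DERIV_minus)
      have "continuous_on UNIV (\<lambda>r. \<alpha> (s - r))"
        by (rule continuous_on_compose2[OF cont]) (auto intro!: continuous_intros)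
      then show "isCont (\<lambda>r. \<alpha> (s - r)) r"
        by (simp add: continuous_on_eq_continuous_at)
    qed
    then show ?thesis by (simp add: \<Theta>_def has_bochner_integral_integral_eq)
  qed
  show D: "(\<Theta> has_real_derivative (\<alpha> s - \<alpha> (s - t))) (at s)" for s
  proof -
    have "((\<lambda>s. \<Psi> (s - t)) has_real_derivative \<alpha> (s - t) * 1) (at s)"
      by (rule DERIV_chain2[OF \<Psi>]) (auto intro!: derivative_eq_intros)
    then show ?thesis unfolding \<Theta>[abs_def] by (auto intro!: DERIV_diff \<Psi>)
  qed
  show "smooth1 \<Theta>"
    using D smooth1_diff_shift[OF \<alpha>, of t] by (rule smooth1.intros)
  assume s: "s \<notin> {a..b + t}"
  have "\<alpha> (s - r) * indicator {0..t} r = 0" for r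
    using s by (cases "r \<in> {0..t}") (auto intro!: zero)
  then have "\<Theta> s = (\<integral>r. 0 \<partial>(lborel :: real measure))"
    unfolding \<Theta>_def by (rule Bochner_Integration.integral_cong[OF refl])
  then show "\<Theta> s = 0" by simp
qed

lemma integrable_segment_translates:
  fixes g :: "'a::euclidean_space \<Rightarrow> real" and e :: 'a
  assumes g: "integrable lborel g"
  shows "integrable (lborel \<Otimes>\<^sub>M lborel) (\<lambda>(r, x). indicator {0..t::real} r * g (x + r *\<^sub>R e))"
proof -
  have [measurable]: "g \<in> borel_measurable borel" using g by auto
  show ?thesis
  proof (rule lborel_pair.Fubini_integrable)
    have "(\<integral>y. norm (case (r, y) of (r, x) \<Rightarrow> indicator {0..t} r * g (x + r *\<^sub>R e)) \<partial>lborel)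
        = indicator {0..t} r * (\<integral>y. \<bar>g y\<bar> \<partial>lborel)" for r
      using integral_lborel_translation[of "\<lambda>y. \<bar>g y\<bar>" "r *\<^sub>R e"]
      by (simp add: abs_mult)
    moreover have "integrable lborel (\<lambda>r. indicator {0..t} r * (\<integral>y. \<bar>g y\<bar> \<partial>lborel))"
      by (intro integrable_mult_left integrable_real_indicator) (auto simp: emeasure_lborel_Icc_eq)
    ultimately show "integrable lborel (\<lambda>r. \<integral>y. norm (case (r, y) of (r, x) \<Rightarrow> indicator {0..t} r * g (x + r *\<^sub>R e)) \<partial>lborel)"
      by simp
    show "AE r in lborel. integrable lborel (\<lambda>y. case (r, y) of (r, x) \<Rightarrow> indicator {0..t} r * g (x + r *\<^sub>R e))"
      using integrable_lborel_translation[OF g] by simp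
  qed measurable
qed

text \<open>Tested against the average of \<open>\<phi>\<close> over shifts, the weak derivative
  identity has the difference of \<open>\<phi>\<close> and its translate by \<open>t\<close> on one
  side and an integral over \<open>r\<close> on the other. Translating the variable moves all shifts
  from \<open>\<phi>\<close> to \<open>f\<close> and \<open>g\<close>.\<close>

lemma cutoff_box_integral:
  fixes f g :: "real^'n::finite \<Rightarrow> real" and k :: nat
  assumes wd: "borel_weak_deriv \<Omega> i f g" and "0 \<le> t" and ab: "\<And>j. a $ j < b $ j"
    and sub: "cbox a (b + t *\<^sub>R axis i 1) \<subseteq> \<Omega>"
  defines "\<phi> \<equiv> \<lambda>x. \<Prod>j\<in>UNIV. cutoff k (a $ j) (b $ j) (x $ j)"
  shows "(\<integral>x. \<phi> x * (f (x + t *\<^sub>R axis i 1) - f x -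
     (\<integral>r. indicator {0..t} r * g (x + r *\<^sub>R axis i 1) \<partial>lborel)) \<partial>lborel) = 0"
proof -
  define e :: "real^'n" where "e = axis i 1"
  define \<alpha> where "\<alpha> j = cutoff k (a $ j) (b $ j)" for j
  define \<Theta> where "\<Theta> s = (\<integral>r. \<alpha> i (s - r) * indicator {0..t} r \<partial>lborel)" for s
  have f: "integrable lborel f" and g: "integrable lborel g"
    using wd by (auto simp: borel_weak_deriv_def)
  then have [measurable]: "f \<in> borel_measurable borel" "g \<in> borel_measurable borel" by auto
  have \<alpha>s: "smooth1 (\<alpha> j)" for j unfolding \<alpha>_def by (rule cutoff_props(1)[OF ab])
  have \<alpha>0: "\<alpha> j s = 0" if "s \<notin> {a $ j..b $ j}" for j s
    unfolding \<alpha>_def by (rule cutoff_props(4)[OF ab]) (use that in auto)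
  have \<alpha>01: "0 \<le> \<alpha> j s" "\<alpha> j s \<le> 1" for j s
    unfolding \<alpha>_def by (rule cutoff_props[OF ab])+
  have \<alpha>m[measurable]: "\<alpha> j \<in> borel_measurable borel" for j
    using smooth1_continuous[OF \<alpha>s] by (rule borel_measurable_continuous_onI)
  have \<phi>m[measurable]: "\<phi> \<in> borel_measurable borel"
    unfolding \<phi>_def \<alpha>_def[symmetric] by measurable
  have \<phi>01: "0 \<le> \<phi> x" "\<phi> x \<le> 1" for x
    unfolding \<phi>_def \<alpha>_def[symmetric] by (auto intro!: prod_nonneg prod_le_1 \<alpha>01)
  note \<Theta> = smooth1_shift_integral[OF \<alpha>s[of i] \<alpha>0[of _ i] \<open>0 \<le> t\<close>, folded \<Theta>_def]
  \<comment> \<open>Only the factor in direction \<open>i\<close> is averaged. Hence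
    \<open>\<Phi> x\<close> is the integral of \<open>\<phi> (x - r *\<^sub>R e)\<close> over
    \<open>r\<close> in \<open>{0..t}\<close>, and the supporting box grows by \<open>t\<close> in
    that direction.\<close>
  define \<Phi> where "\<Phi> x = (\<Prod>j\<in>UNIV. (\<alpha>(i := \<Theta>)) j (x $ j))" for x :: "real^'n"
  have sm: "smooth1 ((\<alpha>(i := \<Theta>)) j)" for j using \<alpha>s \<Theta>(1) by simp
  have test: "\<Phi> \<in> test_functions \<Omega>"
    unfolding \<Phi>_def
  proof (rule prod_coords_test_function[OF sm _ sub])
    fix j s assume "s \<notin> {a $ j..(b + t *\<^sub>R axis i 1) $ j}"
    then show "(\<alpha>(i := \<Theta>)) j s = 0"
      using \<Theta>(3) \<alpha>0 \<open>0 \<le> t\<close> by (auto simp: axis_def)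
  qed
  have split: "(\<Prod>j\<in>UNIV. (\<alpha>(i := \<beta>)) j (x $ j)) = \<beta> (x $ i) * (\<Prod>j\<in>UNIV - {i}. \<alpha> j (x $ j))"
    for \<beta> and x :: "real^'n"
    by (subst prod.remove[of UNIV i]) (auto intro!: prod.cong)
  have shift: "\<phi> (x - r *\<^sub>R e) = \<alpha> i (x $ i - r) * (\<Prod>j\<in>UNIV - {i}. \<alpha> j (x $ j))" for x r
    unfolding \<phi>_def \<alpha>_def[symmetric] e_def
    by (subst prod.remove[of UNIV i]) (auto intro!: prod.cong simp: axis_def)
  have dPhi: "partial_deriv i \<Phi> x = \<phi> x - \<phi> (x - t *\<^sub>R e)" for x
  proof -
    have "partial_deriv i \<Phi> = (\<lambda>x. \<Prod>j\<in>UNIV. ((\<alpha>(i := \<Theta>))(i := \<lambda>s. \<alpha> i s - \<alpha> i (s - t))) j (x $ j))"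
      unfolding \<Phi>_def[abs_def]
      by (rule partial_deriv_prod_coords[OF sm]) (use \<Theta>(2) in simp)
    then have "partial_deriv i \<Phi> x = (\<alpha> i (x $ i) - \<alpha> i (x $ i - t)) * (\<Prod>j\<in>UNIV - {i}. \<alpha> j (x $ j))"
      unfolding fun_upd_upd split by simp
    then show ?thesis
      using shift[of x 0] shift[of x t] by (simp add: left_diff_distrib)
  qed
  have Phi: "\<Phi> x = (\<integral>r. indicator {0..t} r * \<phi> (x - r *\<^sub>R e) \<partial>lborel)" for x
    unfolding \<Phi>_def split shift \<Theta>_def
    by (subst integral_mult_left_zero[symmetric]) (simp add: mult_ac)
  have int1: "integrable lborel (\<lambda>x. \<phi> x * f (x + t *\<^sub>R e))"
    by (rule Bochner_Integration.integrable_bound[OF integrable_lborel_translation[OF f, of "t *\<^sub>R e"]])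
       (use \<phi>01 in \<open>auto simp: abs_mult intro!: mult_left_le_one_le\<close>)
  have int2: "integrable lborel (\<lambda>x. \<phi> x * f x)"
    by (rule Bochner_Integration.integrable_bound[OF f])
       (use \<phi>01 in \<open>auto simp: abs_mult intro!: mult_left_le_one_le\<close>)
  have int3: "integrable lborel (\<lambda>x. \<phi> (x - t *\<^sub>R e) * f x)"
    by (rule Bochner_Integration.integrable_bound[OF f])
       (use \<phi>01 in \<open>auto simp: abs_mult intro!: mult_left_le_one_le\<close>)
  have L: "(\<integral>x. partial_deriv i \<Phi> x * f x \<partial>lborel) = (\<integral>x. \<phi> x * f x \<partial>lborel) - (\<integral>x. \<phi> x * f (x + t *\<^sub>R e) \<partial>lborel)"
  proof -
    have "(\<integral>x. partial_deriv i \<Phi> x * f x \<partial>lborel) = (\<integral>x. \<phi> x * f x \<partial>lborel) - (\<integral>x. \<phi> (x - t *\<^sub>R e) * f x \<partial>lborel)"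
      unfolding dPhi left_diff_distrib by (rule Bochner_Integration.integral_diff[OF int2 int3])
    also have "(\<integral>x. \<phi> (x - t *\<^sub>R e) * f x \<partial>lborel) = (\<integral>x. \<phi> x * f (x + t *\<^sub>R e) \<partial>lborel)"
      using integral_lborel_translation[of "\<lambda>x. \<phi> (x - t *\<^sub>R e) * f x" "t *\<^sub>R e"] by simp
    finally show ?thesis .
  qed
  have Gint: "integrable (lborel \<Otimes>\<^sub>M lborel) (\<lambda>(r, x). indicator {0..t::real} r * g (x + r *\<^sub>R e))"
    by (rule integrable_segment_translates[OF g])
  have I1: "integrable (lborel \<Otimes>\<^sub>M lborel) (\<lambda>(r, x). \<phi> x * (indicator {0..t::real} r * g (x + r *\<^sub>R e)))"
    by (rule Bochner_Integration.integrable_bound[OF Gint])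
       (use \<phi>01 in \<open>auto simp: abs_mult split_beta intro!: AE_I2 mult_left_le_one_le\<close>)
  have I2: "integrable (lborel \<Otimes>\<^sub>M lborel) (\<lambda>(r, x). \<phi> (x - r *\<^sub>R e) * (indicator {0..t::real} r * g x))"
    by (rule Bochner_Integration.integrable_bound[OF integrable_segment_translates[OF g, of t 0]])
       (use \<phi>01 in \<open>auto simp: abs_mult split_beta intro!: AE_I2 mult_left_le_one_le\<close>)
  have "(\<integral>x. \<Phi> x * g x \<partial>lborel) = (\<integral>x. (\<integral>r. \<phi> (x - r *\<^sub>R e) * (indicator {0..t} r * g x) \<partial>lborel) \<partial>lborel)"
  proof (rule Bochner_Integration.integral_cong[OF refl])
    fix x :: "real^'n"
    have "(\<lambda>r. \<phi> (x - r *\<^sub>R e) * (indicator {0..t} r * g x)) = (\<lambda>r. (indicator {0..t} r * \<phi> (x - r *\<^sub>R e)) * g x)"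
      by (simp add: fun_eq_iff mult_ac)
    then show "\<Phi> x * g x = (\<integral>r. \<phi> (x - r *\<^sub>R e) * (indicator {0..t} r * g x) \<partial>lborel)"
      unfolding Phi by (simp only: integral_mult_left_zero)
  qed
  also have "\<dots> = (\<integral>r. (\<integral>x. \<phi> (x - r *\<^sub>R e) * (indicator {0..t} r * g x) \<partial>lborel) \<partial>lborel)"
    using lborel_pair.Fubini_integral[OF I2] by simp
  also have "\<dots> = (\<integral>r. (\<integral>x. \<phi> x * (indicator {0..t} r * g (x + r *\<^sub>R e)) \<partial>lborel) \<partial>lborel)"
  proof (rule Bochner_Integration.integral_cong[OF refl])
    fix r :: real
    show "(\<integral>x. \<phi> (x - r *\<^sub>R e) * (indicator {0..t} r * g x) \<partial>lborel) =
        (\<integral>x. \<phi> x * (indicator {0..t} r * g (x + r *\<^sub>R e)) \<partial>lborel)"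
      using integral_lborel_translation[of "\<lambda>x. \<phi> (x - r *\<^sub>R e) * (indicator {0..t} r * g x)" "r *\<^sub>R e"]
      by simp
  qed
  also have "\<dots> = (\<integral>x. (\<integral>r. \<phi> x * (indicator {0..t} r * g (x + r *\<^sub>R e)) \<partial>lborel) \<partial>lborel)"
    using lborel_pair.Fubini_integral[OF I1] by simp
  also have "\<dots> = (\<integral>x. \<phi> x * (\<integral>r. indicator {0..t} r * g (x + r *\<^sub>R e) \<partial>lborel) \<partial>lborel)"
    by simp
  finally have R: "(\<integral>x. \<Phi> x * g x \<partial>lborel) = (\<integral>x. \<phi> x * (\<integral>r. indicator {0..t} r * g (x + r *\<^sub>R e) \<partial>lborel) \<partial>lborel)" .
  have int4: "integrable lborel (\<lambda>x. \<phi> x * (\<integral>r. indicator {0..t} r * g (x + r *\<^sub>R e) \<partial>lborel))"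
    using lborel_pair.integrable_snd[OF I1] by simp
  have "(\<integral>x. \<phi> x * (f (x + t *\<^sub>R e) - f x - (\<integral>r. indicator {0..t} r * g (x + r *\<^sub>R e) \<partial>lborel)) \<partial>lborel)
     = (\<integral>x. \<phi> x * f (x + t *\<^sub>R e) \<partial>lborel) - (\<integral>x. \<phi> x * f x \<partial>lborel) - (\<integral>x. \<Phi> x * g x \<partial>lborel)"
    unfolding R right_diff_distrib
    by (simp add: Bochner_Integration.integral_diff int1 int2 int4)
  also have "\<dots> = 0"
    using wd test L by (simp add: borel_weak_deriv_def)
  finally show ?thesis by (simp add: e_def)
qed

section \<open>Measure of phase jumps\<close>

text \<open>Fundamental theorem of calculus on almost every segment: as \<open>k\<close> grows, the
  cutoffs tend to the indicator of a box, so the error \<open>H\<close> has zero integral over all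
  boxes in \<open>U\<close> and vanishes almost everywhere there.\<close>

lemma borel_weak_deriv_segment:
  fixes f g :: "real^'n::finite \<Rightarrow> real"
  assumes wd: "borel_weak_deriv \<Omega> i f g" and t: "0 \<le> t" and U: "open U"
    and seg: "\<And>x r. x \<in> U \<Longrightarrow> 0 \<le> r \<Longrightarrow> r \<le> t \<Longrightarrow> x + r *\<^sub>R axis i 1 \<in> \<Omega>"
  shows "AE x in lborel. x \<in> U \<longrightarrow>
    f (x + t *\<^sub>R axis i 1) - f x = (\<integral>r. indicator {0..t} r * g (x + r *\<^sub>R axis i 1) \<partial>lborel)"
proof -
  define e :: "real^'n" where "e = axis i 1"
  have f: "integrable lborel f" and g: "integrable lborel g"
    using wd by (auto simp: borel_weak_deriv_def)
  define H where "H x = f (x + t *\<^sub>R e) - f x - (\<integral>r. indicator {0..t} r * g (x + r *\<^sub>R e) \<partial>lborel)" for x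
  have "integrable lborel (\<lambda>x. \<integral>r. indicator {0..t} r * g (x + r *\<^sub>R e) \<partial>lborel)"
    by (rule lborel_pair.integrable_snd) (rule integrable_segment_translates[OF g])
  then have H: "integrable lborel H"
    unfolding H_def[abs_def]
    by (intro Bochner_Integration.integrable_diff integrable_lborel_translation f)
  then have [measurable]: "H \<in> borel_measurable borel" by auto
  have "AE x in lborel. x \<in> U \<longrightarrow> H x = 0"
  proof (rule AE_zero_on_open_if_box_integrals_zero[OF H U])
    fix a b :: "real^'n" assume ab: "\<forall>j. a $ j < b $ j" and sub: "cbox a b \<subseteq> U"
    have sub': "cbox a (b + t *\<^sub>R axis i 1) \<subseteq> \<Omega>"
    proof
      fix y assume y: "y \<in> cbox a (b + t *\<^sub>R axis i 1)"
      \<comment> \<open>How far \<open>y\<close> sticks out of the original box in direction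
        \<open>i\<close>. Going back by \<open>r\<close> lands in \<open>cbox a b\<close>, so
        \<open>y\<close> lies on a segment that starts in \<open>U\<close>.\<close>
      define r where "r = max 0 (y $ i - b $ i)"
      have r: "0 \<le> r" "r \<le> t" using y t by (auto simp: r_def mem_box_cart dest!: spec[of _ i])
      have "y - r *\<^sub>R axis i 1 \<in> cbox a b"
        unfolding mem_box_cart
      proof (intro allI)
        fix j
        have "a $ j \<le> y $ j" "y $ j \<le> b $ j + t * (if j = i then 1 else 0)"
          using y by (auto simp: mem_box_cart axis_def)
        then show "a $ j \<le> (y - r *\<^sub>R axis i 1) $ j \<and> (y - r *\<^sub>R axis i 1) $ j \<le> b $ j"
          using ab[rule_format, of j] by (auto simp: axis_def r_def max_def)
      qed
      then have "y - r *\<^sub>R axis i 1 + r *\<^sub>R axis i 1 \<in> \<Omega>"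
        using seg r sub by blast
      then show "y \<in> \<Omega>" by simp
    qed
    define \<phi> where "\<phi> k x = (\<Prod>j\<in>UNIV. cutoff k (a $ j) (b $ j) (x $ j))" for k and x :: "real^'n"
    have [measurable]: "cutoff k (a $ j) (b $ j) \<in> borel_measurable borel" for k j
      using smooth1_continuous[OF cutoff_props(1)[OF ab[rule_format]]] by (rule borel_measurable_continuous_onI)
    have "(\<lambda>k. \<integral>x. \<phi> k x * H x \<partial>lborel) \<longlonglongrightarrow> (\<integral>x. indicator (box a b) x * H x \<partial>lborel)"
    proof (rule integral_dominated_convergence)
      show "integrable lborel (\<lambda>x. \<bar>H x\<bar>)" using H by simp
      have "(\<lambda>k. \<phi> k x) \<longlonglongrightarrow> indicator (box a b) x" for x
      proof -
        have "(\<lambda>k. \<phi> k x) \<longlonglongrightarrow> (\<Prod>j\<in>UNIV. indicator {a $ j<..<b $ j} (x $ j))"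
          unfolding \<phi>_def by (intro tendsto_prod cutoff_props(5) ab[rule_format])
        also have "(\<Prod>j\<in>UNIV. indicator {a $ j<..<b $ j} (x $ j)) = (indicator (box a b) x :: real)"
          by (auto simp: indicator_def mem_box_cart)
        finally show ?thesis .
      qed
      then show "AE x in lborel. (\<lambda>k. \<phi> k x * H x) \<longlonglongrightarrow> indicator (box a b) x * H x"
        by (intro AE_I2 tendsto_mult_right)
      have "0 \<le> \<phi> k x" "\<phi> k x \<le> 1" for k x
        unfolding \<phi>_def by (auto intro!: prod_nonneg prod_le_1 cutoff_props ab[rule_format])
      then show "AE x in lborel. norm (\<phi> k x * H x) \<le> \<bar>H x\<bar>" for k
        by (intro AE_I2) (simp add: abs_mult mult_left_le_one_le)
    qed (simp_all add: \<phi>_def[abs_def])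
    moreover have "(\<integral>x. \<phi> k x * H x \<partial>lborel) = 0" for k
      using cutoff_box_integral[OF wd t _ sub', of k] ab by (simp add: \<phi>_def H_def e_def)
    ultimately show "(\<integral>x. indicator (box a b) x * H x \<partial>lborel) = 0"
      by (simp add: LIMSEQ_const_iff)
  qed
  then show ?thesis by eventually_elim (simp add: H_def e_def)
qed

text \<open>By Young's inequality a large increment forces the integral \<open>S x\<close> of
  \<open>g\<^sup>2\<close> along the segment to be at least \<open>\<kappa>\<^sup>2 / t\<close>.
  Since \<open>S\<close> integrates to at most \<open>t * G\<close> by Fubini, Markov's inequality
  yields the bound.\<close>

lemma weak_deriv_difference_quotient_chebyshev:
  fixes f g :: "real^'n::finite \<Rightarrow> real"
  assumes wd: "borel_weak_deriv \<Omega> i f g" and t: "0 \<le> t" and U: "open U"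
    and seg: "\<And>x r. x \<in> U \<Longrightarrow> 0 \<le> r \<Longrightarrow> r \<le> t \<Longrightarrow> x + r *\<^sub>R axis i 1 \<in> \<Omega>"
    and G: "(\<integral>\<^sup>+x. ennreal ((g x)\<^sup>2) \<partial>lborel) \<le> ennreal G" and "0 \<le> G" and \<kappa>: "0 < \<kappa>"
  shows "emeasure lborel {x \<in> U. \<kappa> \<le> \<bar>f (x + t *\<^sub>R axis i 1) - f x\<bar>} \<le> ennreal (t\<^sup>2 / \<kappa>\<^sup>2 * G)"
proof -
  define e :: "real^'n" where "e = axis i 1"
  have f: "integrable lborel f" and g: "integrable lborel g"
    using wd by (auto simp: borel_weak_deriv_def)
  then have [measurable]: "f \<in> borel_measurable borel" "g \<in> borel_measurable borel" by auto
  have [measurable]: "U \<in> sets borel" using U by simp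
  define S where "S x = (\<integral>\<^sup>+r. indicator {0..t} r * ennreal ((g (x + r *\<^sub>R e))\<^sup>2) \<partial>lborel)" for x
  have [measurable]: "S \<in> borel_measurable borel" unfolding S_def[abs_def] by measurable
  have intS: "(\<integral>\<^sup>+x. S x \<partial>lborel) \<le> ennreal (t * G)"
  proof -
    have "(\<integral>\<^sup>+x. S x \<partial>lborel) = (\<integral>\<^sup>+r. (\<integral>\<^sup>+x. indicator {0..t} r * ennreal ((g (x + r *\<^sub>R e))\<^sup>2) \<partial>lborel) \<partial>lborel)"
      unfolding S_def by (rule lborel_pair.Fubini'[symmetric]) measurable
    also have "\<dots> = (\<integral>\<^sup>+r. indicator {0..t} r * (\<integral>\<^sup>+x. ennreal ((g x)\<^sup>2) \<partial>lborel) \<partial>lborel)"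
    proof (rule nn_integral_cong)
      fix r :: real
      show "(\<integral>\<^sup>+x. indicator {0..t} r * ennreal ((g (x + r *\<^sub>R e))\<^sup>2) \<partial>lborel) =
          indicator {0..t} r * (\<integral>\<^sup>+x. ennreal ((g x)\<^sup>2) \<partial>lborel)"
        using nn_integral_lborel_translation[of "\<lambda>x. ennreal ((g x)\<^sup>2)" "r *\<^sub>R e"]
        by (simp add: nn_integral_cmult)
    qed
    also have "\<dots> = ennreal t * (\<integral>\<^sup>+x. ennreal ((g x)\<^sup>2) \<partial>lborel)"
      using t by (simp add: nn_integral_multc mult.commute emeasure_lborel_Icc_eq)
    also have "\<dots> \<le> ennreal t * ennreal G" using G by (rule mult_left_mono) simp
    finally show ?thesis using t \<open>0 \<le> G\<close> by (simp add: ennreal_mult)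
  qed
  have segment: "AE x in lborel. x \<in> U \<longrightarrow>
      f (x + t *\<^sub>R e) - f x = (\<integral>r. indicator {0..t} r * g (x + r *\<^sub>R e) \<partial>lborel)"
    unfolding e_def by (rule borel_weak_deriv_segment[OF wd t U]) (rule seg)
  have "AE x in lborel. x \<in> {x \<in> U. \<kappa> \<le> \<bar>f (x + t *\<^sub>R e) - f x\<bar>} \<longrightarrow> x \<in> {x. 1 \<le> ennreal (t / \<kappa>\<^sup>2) * S x}"
    using segment
  proof eventually_elim
    case (elim x)
    show ?case
    proof
      assume "x \<in> {x \<in> U. \<kappa> \<le> \<bar>f (x + t *\<^sub>R e) - f x\<bar>}"
      then have x: "\<kappa> \<le> \<bar>\<integral>r. indicator {0..t} r * g (x + r *\<^sub>R e) \<partial>lborel\<bar>" using elim by auto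
      have "t \<noteq> 0"
      proof
        assume "t = 0"
        then have "AE r in lborel. indicator {0..t} r * g (x + r *\<^sub>R e) = 0"
          by (intro eventually_mono[OF AE_lborel_singleton[of "0::real"]]) (auto simp: indicator_def)
        then have "(\<integral>r. indicator {0..t} r * g (x + r *\<^sub>R e) \<partial>lborel) = 0"
          by (rule integral_eq_zero_AE)
        then show False using x \<kappa> by simp
      qed
      then have tp: "0 < t" using t by simp
      \<comment> \<open>The integral of a non-integrable function is 0 by convention, which would
        contradict the lower bound \<open>\<kappa>\<close>.\<close>
      have int: "integrable lborel (\<lambda>r. indicator {0..t} r * g (x + r *\<^sub>R e))"
        using x \<kappa> not_integrable_integral_eq by fastforce
      have "ennreal \<kappa> \<le> ennreal \<bar>\<integral>r. indicator {0..t} r * g (x + r *\<^sub>R e) \<partial>lborel\<bar>"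
        using x by (intro ennreal_leI)
      also have "\<dots> \<le> (\<integral>\<^sup>+r. ennreal (norm (indicator {0..t} r * g (x + r *\<^sub>R e))) \<partial>lborel)"
        using integral_norm_bound_ennreal[OF int] by simp
      also have "\<dots> \<le> (\<integral>\<^sup>+r. ennreal (\<kappa> / (2 * t)) * indicator {0..t} r +
          ennreal (t / (2 * \<kappa>)) * (indicator {0..t} r * ennreal ((g (x + r *\<^sub>R e))\<^sup>2)) \<partial>lborel)"
      proof (rule nn_integral_mono)
        fix r :: real
        define w where "w = g (x + r *\<^sub>R e)"
        \<comment> \<open>The weights are chosen so that the constant part integrates to
          \<open>\<kappa> / 2\<close> over \<open>{0..t}\<close> and can be absorbed by the lower
          bound \<open>\<kappa>\<close>.\<close>
        have "0 \<le> (\<kappa> / t - \<bar>w\<bar>)\<^sup>2 * (t / (2 * \<kappa>))" using tp \<kappa> by simp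
        also have "\<dots> = \<kappa> / (2 * t) - \<bar>w\<bar> + t / (2 * \<kappa>) * w\<^sup>2"
          using tp \<kappa> by (simp add: power2_eq_square field_simps)
        finally have "\<bar>w\<bar> \<le> \<kappa> / (2 * t) + t / (2 * \<kappa>) * w\<^sup>2" by simp
        then have "ennreal \<bar>w\<bar> \<le> ennreal (\<kappa> / (2 * t) + t / (2 * \<kappa>) * w\<^sup>2)" by (rule ennreal_leI)
        also have "\<dots> = ennreal (\<kappa> / (2 * t)) + ennreal (t / (2 * \<kappa>) * w\<^sup>2)"
          by (rule ennreal_plus) (use tp \<kappa> in auto)
        also have "ennreal (t / (2 * \<kappa>) * w\<^sup>2) = ennreal (t / (2 * \<kappa>)) * ennreal (w\<^sup>2)"
          by (rule ennreal_mult) (use tp \<kappa> in auto)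
        finally have "ennreal \<bar>w\<bar> \<le> ennreal (\<kappa> / (2 * t)) + ennreal (t / (2 * \<kappa>)) * ennreal (w\<^sup>2)" .
        then show "ennreal (norm (indicator {0..t} r * g (x + r *\<^sub>R e))) \<le>
           ennreal (\<kappa> / (2 * t)) * indicator {0..t} r +
          ennreal (t / (2 * \<kappa>)) * (indicator {0..t} r * ennreal ((g (x + r *\<^sub>R e))\<^sup>2))"
          by (cases "r \<in> {0..t}") (auto simp: w_def)
      qed
      also have "\<dots> = ennreal (\<kappa> / (2 * t)) * ennreal t + ennreal (t / (2 * \<kappa>)) * S x"
        unfolding S_def using t
        by (subst nn_integral_add) (auto simp: nn_integral_cmult emeasure_lborel_Icc_eq)
      also have "ennreal (\<kappa> / (2 * t)) * ennreal t = ennreal (\<kappa> / 2)"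
        using tp \<kappa> by (simp flip: ennreal_mult)
      finally have "ennreal \<kappa> - ennreal (\<kappa> / 2) \<le> ennreal (t / (2 * \<kappa>)) * S x"
        by (simp add: ennreal_minus_le_iff)
      then have "ennreal (\<kappa> / 2) \<le> ennreal (t / (2 * \<kappa>)) * S x"
        using \<kappa> by (subst (asm) ennreal_minus) auto
      then have "ennreal (2 / \<kappa>) * ennreal (\<kappa> / 2) \<le> ennreal (2 / \<kappa>) * (ennreal (t / (2 * \<kappa>)) * S x)"
        by (rule mult_left_mono) simp
      moreover have "ennreal (2 / \<kappa>) * ennreal (\<kappa> / 2) = 1" using \<kappa> by (simp flip: ennreal_mult)
      moreover have "ennreal (2 / \<kappa>) * (ennreal (t / (2 * \<kappa>)) * S x) = ennreal (t / \<kappa>\<^sup>2) * S x"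
        unfolding mult.assoc[symmetric] using \<kappa> t by (simp flip: ennreal_mult add: power2_eq_square)
      ultimately show "x \<in> {x. 1 \<le> ennreal (t / \<kappa>\<^sup>2) * S x}" by simp
    qed
  qed
  then have "emeasure lborel {x \<in> U. \<kappa> \<le> \<bar>f (x + t *\<^sub>R e) - f x\<bar>} \<le> emeasure lborel {x. 1 \<le> ennreal (t / \<kappa>\<^sup>2) * S x}"
    by (rule emeasure_mono_AE) measurable
  also have "\<dots> = emeasure lborel {x\<in>UNIV. 1 \<le> ennreal (t / \<kappa>\<^sup>2) * S x}" by simp
  also have "\<dots> \<le> ennreal (t / \<kappa>\<^sup>2) * (\<integral>\<^sup>+x. S x * indicator UNIV x \<partial>lborel)"
    by (rule nn_integral_Markov_inequality) simp_all
  also have "\<dots> \<le> ennreal (t / \<kappa>\<^sup>2) * ennreal (t * G)" using intS by (intro mult_left_mono) simp_all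
  also have "\<dots> = ennreal (t\<^sup>2 / \<kappa>\<^sup>2 * G)"
    using t \<open>0 \<le> G\<close> \<kappa> by (simp flip: ennreal_mult add: power2_eq_square mult_ac)
  finally show ?thesis by (simp add: e_def)
qed

section \<open>Chains of short steps inside a ball\<close>

lemma ball_translate:
  fixes c :: "'a::real_normed_vector"
  assumes "x \<in> ball x0 \<rho>" "\<rho> + norm c \<le> \<sigma>"
  shows "x + c \<in> ball x0 \<sigma>"
proof -
  have "dist x0 (x + c) \<le> dist x0 x + dist x (x + c)" by (rule dist_triangle)
  also have "dist x (x + c) = norm c" by (simp add: dist_norm)
  finally show ?thesis using assms by simp
qed

lemma ball_translate_segment:
  fixes e :: "'a::real_normed_vector"
  assumes "x \<in> ball x0 \<rho>" "norm e = 1" "0 \<le> r" "\<rho> + r \<le> \<sigma>"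
  shows "x + r *\<^sub>R e \<in> ball x0 \<sigma>"
  using assms by (intro ball_translate[OF assms(1)]) simp

text \<open>If the phases at the two ends of the chain differ, they differ across one of its
  \<open>N\<close> steps, and the points for which this is a given step lie in a translate of the
  single-step jump set.\<close>

lemma emeasure_jump_chain:
  fixes v :: "'a::euclidean_space"
  assumes [measurable]: "E \<in> sets borel" "B \<in> sets borel" "B' \<in> sets borel"
    and m: "emeasure lborel {x \<in> B. (x \<in> E) \<noteq> (x + v \<in> E)} \<le> m"
    and sub: "\<And>x k. x \<in> B' \<Longrightarrow> k < N \<Longrightarrow> x + real k *\<^sub>R v \<in> B"
  shows "emeasure lborel {x \<in> B'. (x \<in> E) \<noteq> (x + real N *\<^sub>R v \<in> E)} \<le> of_nat N * m"
  using sub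
proof (induction N)
  case (Suc N)
  let ?J = "{x \<in> B. (x \<in> E) \<noteq> (x + v \<in> E)}"
  have [measurable]: "?J \<in> sets borel" by measurable
  have "emeasure lborel {x \<in> B'. (x \<in> E) \<noteq> (x + real (Suc N) *\<^sub>R v \<in> E)}
     \<le> emeasure lborel ({x \<in> B'. (x \<in> E) \<noteq> (x + real N *\<^sub>R v \<in> E)} \<union> {x. x + real N *\<^sub>R v \<in> ?J})"
  proof (rule emeasure_mono)
    show "{x \<in> B'. (x \<in> E) \<noteq> (x + real (Suc N) *\<^sub>R v \<in> E)} \<subseteq>
        {x \<in> B'. (x \<in> E) \<noteq> (x + real N *\<^sub>R v \<in> E)} \<union> {x. x + real N *\<^sub>R v \<in> ?J}"
      using Suc.prems[of _ N] by (auto simp: algebra_simps)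
  qed measurable
  also have "\<dots> \<le> emeasure lborel {x \<in> B'. (x \<in> E) \<noteq> (x + real N *\<^sub>R v \<in> E)} + emeasure lborel {x. x + real N *\<^sub>R v \<in> ?J}"
    by (rule emeasure_subadditive) measurable
  also have "\<dots> \<le> of_nat N * m + m"
    by (intro add_mono Suc.IH) (use Suc.prems m emeasure_lborel_translation[of ?J "real N *\<^sub>R v"] in auto)
  finally show ?case by (simp add: algebra_simps)
qed simp

text \<open>A jump across a step of length \<open>s / N\<close> either has an end in
  \<open>Bad\<close>, at cost \<open>2 * \<beta>\<close>, or makes \<open>q\<close> change by at
  least \<open>\<kappa>\<close>, at cost \<open>K * (s / N)\<^sup>2\<close>. Multiplying by
  \<open>N\<close> shows the trade-off in the number of steps. The detector \<open>q\<close> is left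
  open: it will be \<open>y\<close> itself or an increment of \<open>v\<close>.\<close>

lemma emeasure_jump_le:
  fixes q :: "'a::euclidean_space \<Rightarrow> real" and e x0 :: 'a and N :: nat and \<rho> s \<kappa> K \<beta> :: real
  assumes [measurable]: "E \<in> sets borel" "Bad \<in> sets borel" "q \<in> borel_measurable borel"
    and e: "norm e = 1" and s: "0 \<le> s" and N: "1 \<le> N" and K: "0 \<le> K" and \<beta>: "0 \<le> \<beta>"
    and good: "\<And>x. x \<in> ball x0 (\<rho> + s) \<Longrightarrow> x \<notin> Bad \<Longrightarrow> if x \<in> E then \<kappa> / 2 \<le> q x else q x \<le> - \<kappa> / 2"
    and step: "emeasure lborel {x \<in> ball x0 (\<rho> + s - s / N). \<kappa> \<le> \<bar>q (x + (s / N) *\<^sub>R e) - q x\<bar>} \<le> ennreal (K * (s / N)\<^sup>2)"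
    and bad: "emeasure lborel (Bad \<inter> ball x0 (\<rho> + s)) \<le> ennreal \<beta>"
  shows "emeasure lborel {x \<in> ball x0 \<rho>. (x \<in> E) \<noteq> (x + s *\<^sub>R e \<in> E)} \<le> ennreal (K * s\<^sup>2 / N + 2 * N * \<beta>)"
proof -
  define \<tau> where "\<tau> = s / N"
  have \<tau>: "0 \<le> \<tau>" "real N * \<tau> = s" using s N by (auto simp: \<tau>_def)
  let ?B = "ball x0 (\<rho> + s - \<tau>)" and ?Bad = "Bad \<inter> ball x0 (\<rho> + s)"
  have near: "x + r *\<^sub>R e \<in> ball x0 (\<sigma> + r)" if "x \<in> ball x0 \<sigma>" "0 \<le> r" for x \<sigma> r
    using ball_translate_segment[OF that(1) e that(2)] by simp
  have [measurable]: "?Bad \<in> sets borel" by measurable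
  have "emeasure lborel {x \<in> ?B. (x \<in> E) \<noteq> (x + \<tau> *\<^sub>R e \<in> E)} \<le>
     emeasure lborel ({x \<in> ?B. \<kappa> \<le> \<bar>q (x + \<tau> *\<^sub>R e) - q x\<bar>} \<union> (?Bad \<union> {x. x + \<tau> *\<^sub>R e \<in> ?Bad}))"
  proof (rule emeasure_mono)
    show "{x \<in> ?B. (x \<in> E) \<noteq> (x + \<tau> *\<^sub>R e \<in> E)} \<subseteq>
      {x \<in> ?B. \<kappa> \<le> \<bar>q (x + \<tau> *\<^sub>R e) - q x\<bar>} \<union> (?Bad \<union> {x. x + \<tau> *\<^sub>R e \<in> ?Bad})"
    proof (rule subsetI, rule ccontr)
      fix x assume x: "x \<in> {x \<in> ?B. (x \<in> E) \<noteq> (x + \<tau> *\<^sub>R e \<in> E)}"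
        and n: "x \<notin> {x \<in> ?B. \<kappa> \<le> \<bar>q (x + \<tau> *\<^sub>R e) - q x\<bar>} \<union> (?Bad \<union> {x. x + \<tau> *\<^sub>R e \<in> ?Bad})"
      have b: "x \<in> ball x0 (\<rho> + s)" "x + \<tau> *\<^sub>R e \<in> ball x0 (\<rho> + s)"
        using x \<tau> near[of x "\<rho> + s - \<tau>" \<tau>] by auto
      then have "x \<notin> Bad" "x + \<tau> *\<^sub>R e \<notin> Bad" using n by auto
      with good b have "if x \<in> E then \<kappa> / 2 \<le> q x else q x \<le> - \<kappa> / 2"
        "if x + \<tau> *\<^sub>R e \<in> E then \<kappa> / 2 \<le> q (x + \<tau> *\<^sub>R e) else q (x + \<tau> *\<^sub>R e) \<le> - \<kappa> / 2" by blast+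
      moreover have "\<bar>q (x + \<tau> *\<^sub>R e) - q x\<bar> < \<kappa>" using x n by auto
      moreover have "(x \<in> E) \<noteq> (x + \<tau> *\<^sub>R e \<in> E)" using x by auto
      ultimately show False by (auto split: if_splits)
    qed
  qed measurable
  also have "\<dots> \<le> emeasure lborel {x \<in> ?B. \<kappa> \<le> \<bar>q (x + \<tau> *\<^sub>R e) - q x\<bar>} +
      (emeasure lborel ?Bad + emeasure lborel {x. x + \<tau> *\<^sub>R e \<in> ?Bad})"
    by (intro order.trans[OF emeasure_subadditive] add_mono order_refl emeasure_subadditive) measurable
  also have "\<dots> \<le> ennreal (K * \<tau>\<^sup>2) + (ennreal \<beta> + ennreal \<beta>)"
    using step bad emeasure_lborel_translation[of ?Bad "\<tau> *\<^sub>R e"] unfolding \<tau>_def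
    by (intro add_mono) auto
  also have "\<dots> = ennreal (K * \<tau>\<^sup>2 + 2 * \<beta>)" using K \<beta> by (simp flip: ennreal_plus)
  finally have "emeasure lborel {x \<in> ball x0 \<rho>. (x \<in> E) \<noteq> (x + real N *\<^sub>R (\<tau> *\<^sub>R e) \<in> E)} \<le> of_nat N * ennreal (K * \<tau>\<^sup>2 + 2 * \<beta>)"
  proof (rule emeasure_jump_chain[rotated 3])
    fix x k assume x: "x \<in> ball x0 \<rho>" and k: "k < N"
    have "(real k + 1) * \<tau> \<le> real N * \<tau>" using k \<tau>(1) by (intro mult_right_mono) auto
    then have "real k * \<tau> + \<tau> \<le> s" using \<tau>(2) by (simp add: algebra_simps)
    then show "x + real k *\<^sub>R (\<tau> *\<^sub>R e) \<in> ?B"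
      using near[OF x, of "real k * \<tau>"] \<tau>(1) by auto
  qed measurable
  also have "of_nat N * ennreal (K * \<tau>\<^sup>2 + 2 * \<beta>) = ennreal (K * s\<^sup>2 / N + 2 * N * \<beta>)"
  proof -
    have "real N * (K * \<tau>\<^sup>2 + 2 * \<beta>) = K * s\<^sup>2 / N + 2 * N * \<beta>"
      using N by (simp add: \<tau>_def power2_eq_square distrib_left)
    then show ?thesis
      using K \<beta> by (simp add: ennreal_of_nat_eq_real_of_nat del: ennreal_plus flip: ennreal_mult)
  qed
  finally show ?thesis using \<tau>(2) by simp
qed

text \<open>The derivative contributes \<open>C * s * h\<close>, the bad ends of the steps twice as
  much, and rounding \<open>N\<close> up the remaining \<open>2 * C * \<epsilon>\<close>. The case
  \<open>s = 0\<close> is separate because the formula for \<open>N\<close> would give no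
  step.\<close>

lemma emeasure_jump_transition_le:
  fixes y z :: "real^'n::finite \<Rightarrow> real" and x0 :: "real^'n"
    and \<rho> s C h \<epsilon> :: real
  assumes wd: "borel_weak_deriv \<Omega> k y z" and s: "0 \<le> s" and ball: "ball x0 (\<rho> + s) \<subseteq> \<Omega>"
    and h: "0 < h" and \<epsilon>: "0 < \<epsilon>" and C: "0 \<le> C"
    and z: "(\<integral>\<^sup>+x. ennreal ((z x)\<^sup>2) \<partial>lborel) \<le> ennreal (C * h\<^sup>2 / \<epsilon>)"
    and bad: "emeasure lborel {x \<in> \<Omega>. \<bar>y x\<bar> < 1/2} \<le> ennreal (C * \<epsilon>)" and \<Omega>: "open \<Omega>"
  shows "emeasure lborel {x \<in> ball x0 \<rho>. (0 \<le> y x) \<noteq> (0 \<le> y (x + s *\<^sub>R axis k 1))}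
     \<le> ennreal (3 * C * s * h + 2 * C * \<epsilon>)"
proof (cases "s = 0")
  case False
  then have sp: "0 < s" using s by simp
  have [measurable]: "y \<in> borel_measurable borel" using wd by (auto simp: borel_weak_deriv_def)
  have [measurable]: "\<Omega> \<in> sets borel" using \<Omega> by simp
  let ?Bad = "{x \<in> \<Omega>. \<bar>y x\<bar> < 1/2}"
  have [measurable]: "?Bad \<in> sets borel" by measurable
  \<comment> \<open>Steps of length at most \<open>\<epsilon> / h\<close> balance the cost \<open>h\<^sup>2 / \<epsilon>\<close> of a single step against the
    measure \<open>\<epsilon>\<close> of the transition layer: both contribute \<open>O(h)\<close> after \<open>N\<close> steps.\<close>
  define N where "N = nat \<lceil>s * h / \<epsilon>\<rceil>"
  have pos: "0 < s * h / \<epsilon>" using sp h \<epsilon> by simp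
  have N: "1 \<le> N" "s * h / \<epsilon> \<le> real N" "real N \<le> s * h / \<epsilon> + 1"
    unfolding N_def using pos by linarith+
  have e: "norm (axis k 1 :: real^'n) = 1" by (simp add: norm_axis_1)
  have "emeasure lborel {x \<in> ball x0 \<rho>. (x \<in> {x. 0 \<le> y x}) \<noteq> (x + s *\<^sub>R axis k 1 \<in> {x. 0 \<le> y x})}
     \<le> ennreal (C * h\<^sup>2 / \<epsilon> * s\<^sup>2 / N + 2 * N * (C * \<epsilon>))"
  proof (rule emeasure_jump_le[where Bad = ?Bad and q = y and \<kappa> = 1])
    show "if x \<in> {x. 0 \<le> y x} then 1 / 2 \<le> y x else y x \<le> - 1 / 2"
      if "x \<in> ball x0 (\<rho> + s)" "x \<notin> ?Bad" for x
      using that ball by auto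
    have "emeasure lborel {x \<in> ball x0 (\<rho> + s - s / N). 1 \<le> \<bar>y (x + (s / N) *\<^sub>R axis k 1) - y x\<bar>}
        \<le> ennreal ((s / N)\<^sup>2 / 1\<^sup>2 * (C * h\<^sup>2 / \<epsilon>))"
    proof (rule weak_deriv_difference_quotient_chebyshev[OF wd])
      fix x r assume "x \<in> ball x0 (\<rho> + s - s / N)" "0 \<le> r" "r \<le> s / N"
      then show "x + r *\<^sub>R axis k 1 \<in> \<Omega>"
        using ball_translate_segment[OF _ e, of x x0 "\<rho> + s - s / N" r "\<rho> + s"] ball by auto
    qed (use s z C \<epsilon> in auto)
    then show "emeasure lborel {x \<in> ball x0 (\<rho> + s - s / N). 1 \<le> \<bar>y (x + (s / N) *\<^sub>R axis k 1) - y x\<bar>}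
        \<le> ennreal (C * h\<^sup>2 / \<epsilon> * (s / N)\<^sup>2)" by (simp add: mult.commute)
    have "emeasure lborel (?Bad \<inter> ball x0 (\<rho> + s)) \<le> emeasure lborel ?Bad"
      by (rule emeasure_mono) auto
    then show "emeasure lborel (?Bad \<inter> ball x0 (\<rho> + s)) \<le> ennreal (C * \<epsilon>)" using bad by simp
  qed (use e s N C \<epsilon> h in auto)
  also have "\<dots> \<le> ennreal (3 * C * s * h + 2 * C * \<epsilon>)"
  proof (rule ennreal_leI)
    have "s / N \<le> \<epsilon> / h"
      using N(1,2) h \<epsilon> by (simp add: field_simps)
    then have "C * h\<^sup>2 / \<epsilon> * s * (s / N) \<le> C * h\<^sup>2 / \<epsilon> * s * (\<epsilon> / h)"
      using C \<epsilon> s by (intro mult_left_mono) auto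
    also have "\<dots> = C * s * h" using h \<epsilon> by (simp add: power2_eq_square)
    finally have 1: "C * h\<^sup>2 / \<epsilon> * s\<^sup>2 / N \<le> C * s * h" by (simp add: power2_eq_square)
    have "N * (C * \<epsilon>) \<le> (s * h / \<epsilon> + 1) * (C * \<epsilon>)"
      using N(3) C \<epsilon> by (intro mult_right_mono) auto
    also have "\<dots> = C * s * h + C * \<epsilon>" using \<epsilon> by (simp add: field_simps)
    finally show "C * h\<^sup>2 / \<epsilon> * s\<^sup>2 / N + 2 * N * (C * \<epsilon>) \<le> 3 * C * s * h + 2 * C * \<epsilon>"
      using 1 by (simp add: mult.assoc)
  qed
  finally show ?thesis by simp
qed (use C \<epsilon> in auto)

text \<open>A point is bad if the vertical increment of \<open>v\<close> misses \<open>t\<close> or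
  \<open>- t\<close>, as prescribed by the phase, by more than \<open>t / 2\<close>. The deviation
  integrates to at most \<open>t * (\<delta> + 2 * J)\<close>, and Markov's inequality at level
  \<open>t / 2\<close> gives \<open>2 * \<delta> + 4 * J\<close>; both ends of a step and
  \<open>N\<close> steps account for the factor \<open>2 * N\<close>.\<close>

lemma emeasure_jump_transversal_le:
  fixes v y g :: "real^'n::finite \<Rightarrow> real" and x0 :: "real^'n" and N :: nat
    and \<rho> s t \<delta> J C :: real
  assumes vy: "borel_weak_deriv \<Omega> k v y" and vg: "borel_weak_deriv \<Omega> i v g"
    and s: "0 \<le> s" and t: "0 < t" and ball: "ball x0 (\<rho> + s + t) \<subseteq> \<Omega>" and \<Omega>: "open \<Omega>"
    and g: "(\<integral>\<^sup>+x. ennreal ((g x)\<^sup>2) \<partial>lborel) \<le> ennreal C" and C: "0 \<le> C"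
    and \<delta>: "(\<integral>\<^sup>+x. indicator \<Omega> x * ennreal \<bar>\<bar>y x\<bar> - 1\<bar> \<partial>lborel) \<le> ennreal \<delta>" "0 \<le> \<delta>"
    and J: "\<And>r. 0 \<le> r \<Longrightarrow> r \<le> t \<Longrightarrow>
       emeasure lborel {x \<in> ball x0 (\<rho> + s). (0 \<le> y x) \<noteq> (0 \<le> y (x + r *\<^sub>R axis k 1))} \<le> ennreal J" "0 \<le> J"
    and N: "1 \<le> N"
  shows "emeasure lborel {x \<in> ball x0 \<rho>. (0 \<le> y x) \<noteq> (0 \<le> y (x + s *\<^sub>R axis i 1))}
     \<le> ennreal (8 * C / t\<^sup>2 * s\<^sup>2 / N + 2 * N * (2 * \<delta> + 4 * J))"
proof -
  define e :: "real^'n" where "e = axis k 1"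
  have y: "integrable lborel y" using vy by (auto simp: borel_weak_deriv_def)
  have [measurable]: "y \<in> borel_measurable borel" "v \<in> borel_measurable borel"
    using vy by (auto simp: borel_weak_deriv_def)
  have [measurable]: "\<Omega> \<in> sets borel" using \<Omega> by simp
  have ne: "norm e = 1" "norm (axis i 1 :: real^'n) = 1" by (simp_all add: e_def norm_axis_1)
  \<comment> \<open>This increment is close to \<open>t\<close> or to \<open>- t\<close>, according to the phase at \<open>x\<close>, while its differences
    in direction \<open>i\<close> are controlled by \<open>g\<close>.\<close>
  define q where "q x = v (x + t *\<^sub>R e) - v x" for x
  have qm[measurable]: "q \<in> borel_measurable borel" unfolding q_def[abs_def] by measurable
  let ?B = "ball x0 (\<rho> + s)"
  define Bad where "Bad = {x \<in> ?B. if 0 \<le> y x then q x < t / 2 else - t / 2 < q x}"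
  have [measurable]: "Bad \<in> sets borel" unfolding Bad_def by measurable
  define JJ where "JJ r x \<longleftrightarrow> x \<in> ?B \<and> (0 \<le> y x) \<noteq> (0 \<le> y (x + r *\<^sub>R e))" for r x
  \<comment> \<open>Dominates \<open>1\<close> minus the signed value of \<open>y\<close> at height
    \<open>r\<close>: the first summand suffices while the phase is that of \<open>x\<close>, and
    after a change of phase the error grows by at most 2.\<close>
  define F where "F r x = indicator {0..t} r * (indicator \<Omega> (x + r *\<^sub>R e) * ennreal \<bar>\<bar>y (x + r *\<^sub>R e)\<bar> - 1\<bar>
     + 2 * indicator {x. JJ r x} x)" for r :: real and x
  have [measurable]: "?B \<in> sets borel" by simp
  have [measurable]: "Measurable.pred (borel \<Otimes>\<^sub>M borel) (\<lambda>x. (0 \<le> y (snd x)) \<noteq> (0 \<le> y (snd x + (fst x :: real) *\<^sub>R e)))"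
    by measurable
  have [measurable]: "(\<lambda>(r, x). F r x) \<in> borel_measurable (lborel \<Otimes>\<^sub>M lborel)"
    unfolding F_def JJ_def indicator_def[abs_def] split_beta'
    by (simp cong: measurable_cong_sets)
  define S where "S x = (\<integral>\<^sup>+r. F r x \<partial>lborel)" for x
  have [measurable]: "S \<in> borel_measurable borel" unfolding S_def[abs_def] by measurable
  have JJm[measurable]: "{x. JJ r x} \<in> sets borel" for r unfolding JJ_def by measurable
  have intS: "(\<integral>\<^sup>+x. S x \<partial>lborel) \<le> ennreal (t * (\<delta> + 2 * J))"
  proof -
    have "(\<integral>\<^sup>+x. S x \<partial>lborel) = (\<integral>\<^sup>+r. (\<integral>\<^sup>+x. F r x \<partial>lborel) \<partial>lborel)"
      unfolding S_def by (rule lborel_pair.Fubini'[symmetric]) measurable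
    also have "\<dots> \<le> (\<integral>\<^sup>+r. indicator {0..t} r * ennreal (\<delta> + 2 * J) \<partial>lborel)"
    proof (rule nn_integral_mono)
      fix r :: real
      show "(\<integral>\<^sup>+x. F r x \<partial>lborel) \<le> indicator {0..t} r * ennreal (\<delta> + 2 * J)"
      proof (cases "r \<in> {0..t}")
        case True
        have "(\<integral>\<^sup>+x. F r x \<partial>lborel) = (\<integral>\<^sup>+x. indicator \<Omega> (x + r *\<^sub>R e) * ennreal \<bar>\<bar>y (x + r *\<^sub>R e)\<bar> - 1\<bar> \<partial>lborel)
            + 2 * emeasure lborel {x. JJ r x}"
          using True unfolding F_def by (simp add: nn_integral_add nn_integral_cmult)
        also have "(\<integral>\<^sup>+x. indicator \<Omega> (x + r *\<^sub>R e) * ennreal \<bar>\<bar>y (x + r *\<^sub>R e)\<bar> - 1\<bar> \<partial>lborel)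
           = (\<integral>\<^sup>+x. indicator \<Omega> x * ennreal \<bar>\<bar>y x\<bar> - 1\<bar> \<partial>lborel)"
          by (rule nn_integral_lborel_translation[of "\<lambda>x. indicator \<Omega> x * ennreal \<bar>\<bar>y x\<bar> - 1\<bar>" "r *\<^sub>R e"]) measurable
        also have "\<dots> + 2 * emeasure lborel {x. JJ r x} \<le> ennreal \<delta> + 2 * ennreal J"
          using \<delta> J(1)[of r] True by (intro add_mono mult_left_mono) (auto simp: JJ_def e_def)
        also have "\<dots> = ennreal (\<delta> + 2 * J)" using \<delta>(2) J(2)
          by (simp add: ennreal_plus ennreal_mult)
        finally show ?thesis using True by simp
      qed (simp add: F_def)
    qed
    also have "\<dots> = ennreal (t * (\<delta> + 2 * J))"
      using t \<delta>(2) J(2) by (simp add: nn_integral_multc emeasure_lborel_Icc_eq ennreal_mult)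
    finally show ?thesis .
  qed
  have segment: "AE x in lborel. x \<in> ?B \<longrightarrow>
      q x = (\<integral>r. indicator {0..t} r * y (x + r *\<^sub>R e) \<partial>lborel)"
    unfolding q_def e_def
  proof (rule borel_weak_deriv_segment[OF vy])
    fix x r assume "x \<in> ?B" "0 \<le> r" "r \<le> t"
    then show "x + r *\<^sub>R axis k 1 \<in> \<Omega>"
      using ball_translate_segment[OF _ ne(1), of x x0 "\<rho> + s" r "\<rho> + s + t"] ball by (auto simp: e_def)
  qed (use t in auto)
  have seg_int: "AE x in lborel. integrable lborel (\<lambda>r. indicator {0..t} r * y (x + r *\<^sub>R e))"
    by (rule lborel_pair.AE_integrable_snd) (rule integrable_segment_translates[OF y])
  have "AE x in lborel. x \<in> Bad \<longrightarrow> x \<in> {x. 1 \<le> ennreal (2 / t) * S x}"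
    using segment seg_int
  proof eventually_elim
    case (elim x)
    show ?case
    proof
      assume x: "x \<in> Bad"
      \<comment> \<open>The phase at \<open>x\<close> as a sign. On \<open>Bad\<close> the deficit
        \<open>t - \<sigma> * q x\<close> exceeds \<open>t / 2\<close>, and it is the integral of
        \<open>1 - \<sigma> * y\<close> along the vertical segment.\<close>
      define \<sigma> :: real where "\<sigma> = (if 0 \<le> y x then 1 else -1)"
      have xB: "x \<in> ?B" and q: "\<sigma> * q x < t / 2"
        using x by (auto simp: Bad_def \<sigma>_def split: if_splits)
      have "\<sigma> * q x = (\<integral>r. \<sigma> * (indicator {0..t} r * y (x + r *\<^sub>R e)) \<partial>lborel)"
        using elim(1) xB by simp
      moreover have "(\<integral>r. indicator {0..t} r \<partial>lborel) = t" using t by simp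
      ultimately have "t - \<sigma> * q x = (\<integral>r. indicator {0..t} r - \<sigma> * (indicator {0..t} r * y (x + r *\<^sub>R e)) \<partial>lborel)"
        using elim(2) by (subst Bochner_Integration.integral_diff) (auto simp: emeasure_lborel_Icc_eq)
      then have "ennreal (t / 2) \<le> ennreal (norm (\<integral>r. indicator {0..t} r - \<sigma> * (indicator {0..t} r * y (x + r *\<^sub>R e)) \<partial>lborel))"
        using q by (intro ennreal_leI) simp
      also have "\<dots> \<le> (\<integral>\<^sup>+r. ennreal (norm (indicator {0..t} r - \<sigma> * (indicator {0..t} r * y (x + r *\<^sub>R e)))) \<partial>lborel)"
        using elim(2)
        by (intro integral_norm_bound_ennreal Bochner_Integration.integrable_diff integrable_mult_right)
           (auto simp: emeasure_lborel_Icc_eq)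
      also have "\<dots> \<le> S x"
        unfolding S_def
      proof (rule nn_integral_mono)
        fix r :: real
        show "ennreal (norm (indicator {0..t} r - \<sigma> * (indicator {0..t} r * y (x + r *\<^sub>R e)))) \<le> F r x"
        proof (cases "r \<in> {0..t}")
          case True
          then have in\<Omega>: "x + r *\<^sub>R e \<in> \<Omega>"
            using ball_translate_segment[OF xB ne(1), of r "\<rho> + s + t"] ball by auto
          define w where "w = y (x + r *\<^sub>R e)"
          show ?thesis
          proof (cases "JJ r x")
            case J: True
            have "\<bar>1 - \<sigma> * w\<bar> \<le> \<bar>\<bar>w\<bar> - 1\<bar> + 2" by (auto simp: \<sigma>_def)
            then have "ennreal \<bar>1 - \<sigma> * w\<bar> \<le> ennreal \<bar>\<bar>w\<bar> - 1\<bar> + 2"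
              by (metis abs_ge_zero ennreal_leI ennreal_numeral ennreal_plus zero_le_numeral)
            then show ?thesis using True J in\<Omega> by (simp add: F_def w_def)
          next
            case J: False
            then have "(0 \<le> y x) = (0 \<le> w)" using xB by (auto simp: JJ_def w_def)
            then have "\<bar>1 - \<sigma> * w\<bar> \<le> \<bar>\<bar>w\<bar> - 1\<bar>" by (auto simp: \<sigma>_def)
            then show ?thesis using True J in\<Omega> by (simp add: F_def w_def ennreal_leI)
          qed
        qed (simp add: F_def)
      qed
      finally have "ennreal (2 / t) * ennreal (t / 2) \<le> ennreal (2 / t) * S x"
        by (rule mult_left_mono) simp
      then show "x \<in> {x. 1 \<le> ennreal (2 / t) * S x}"
        using t by (simp flip: ennreal_mult)
    qed
  qed
  then have "emeasure lborel Bad \<le> emeasure lborel {x. 1 \<le> ennreal (2 / t) * S x}"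
    by (rule emeasure_mono_AE) measurable
  also have "\<dots> = emeasure lborel {x\<in>UNIV. 1 \<le> ennreal (2 / t) * S x}" by simp
  also have "\<dots> \<le> ennreal (2 / t) * (\<integral>\<^sup>+x. S x * indicator UNIV x \<partial>lborel)"
    by (rule nn_integral_Markov_inequality) simp_all
  also have "\<dots> \<le> ennreal (2 / t) * ennreal (t * (\<delta> + 2 * J))" using intS by (intro mult_left_mono) simp_all
  also have "\<dots> = ennreal (2 * \<delta> + 4 * J)"
    using t \<delta>(2) J(2) by (simp flip: ennreal_mult add: distrib_left)
  finally have Bad: "emeasure lborel Bad \<le> ennreal (2 * \<delta> + 4 * J)" .
  have "emeasure lborel {x \<in> ball x0 \<rho>. (x \<in> {x. 0 \<le> y x}) \<noteq> (x + s *\<^sub>R axis i 1 \<in> {x. 0 \<le> y x})}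
     \<le> ennreal (8 * C / t\<^sup>2 * s\<^sup>2 / N + 2 * N * (2 * \<delta> + 4 * J))"
  proof (rule emeasure_jump_le[where Bad = Bad and q = q and \<kappa> = t])
    show "if x \<in> {x. 0 \<le> y x} then t / 2 \<le> q x else q x \<le> - t / 2" if "x \<in> ?B" "x \<notin> Bad" for x
      using that by (auto simp: Bad_def)
    have "emeasure lborel (Bad \<inter> ?B) \<le> emeasure lborel Bad" by (rule emeasure_mono) auto
    then show "emeasure lborel (Bad \<inter> ?B) \<le> ennreal (2 * \<delta> + 4 * J)" using Bad by simp
    define \<tau> where "\<tau> = s / N"
    have \<tau>: "0 \<le> \<tau>" "\<tau> \<le> s" using s N by (auto simp: \<tau>_def divide_le_eq mult_le_cancel_left1)
    let ?V = "ball x0 (\<rho> + s + t - \<tau>)"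
    \<comment> \<open>A change of \<open>q\<close> by \<open>t\<close> forces \<open>v\<close> to
      change by \<open>t / 2\<close> at the lower or at the upper end of the vertical segment. Each
      event costs \<open>4 * C / t\<^sup>2 * \<tau>\<^sup>2\<close>, whence the constant 8. The
      radius of \<open>?V\<close> leaves room for the vertical shift as well as for the
      step.\<close>
    let ?X = "{x \<in> ?V. t / 2 \<le> \<bar>v (x + \<tau> *\<^sub>R axis i 1) - v x\<bar>}"
    have X: "emeasure lborel ?X \<le> ennreal (\<tau>\<^sup>2 / (t / 2)\<^sup>2 * C)"
    proof (rule weak_deriv_difference_quotient_chebyshev[OF vg])
      fix x r assume "x \<in> ?V" "0 \<le> r" "r \<le> \<tau>"
      then show "x + r *\<^sub>R axis i 1 \<in> \<Omega>"
        using ball_translate_segment[OF _ ne(2), of x x0 "\<rho> + s + t - \<tau>" r "\<rho> + s + t"] ball by auto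
    qed (use \<tau> t g C in auto)
    have [measurable]: "?X \<in> sets borel" by measurable
    have "emeasure lborel {x \<in> ball x0 (\<rho> + s - \<tau>). t \<le> \<bar>q (x + \<tau> *\<^sub>R axis i 1) - q x\<bar>}
      \<le> emeasure lborel (?X \<union> {x. x + t *\<^sub>R e \<in> ?X})"
    proof (rule emeasure_mono)
      show "{x \<in> ball x0 (\<rho> + s - \<tau>). t \<le> \<bar>q (x + \<tau> *\<^sub>R axis i 1) - q x\<bar>} \<subseteq> ?X \<union> {x. x + t *\<^sub>R e \<in> ?X}"
      proof (rule subsetI, rule ccontr)
        fix x assume x: "x \<in> {x \<in> ball x0 (\<rho> + s - \<tau>). t \<le> \<bar>q (x + \<tau> *\<^sub>R axis i 1) - q x\<bar>}"
          and n: "x \<notin> ?X \<union> {x. x + t *\<^sub>R e \<in> ?X}"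
        have "x \<in> ?V" "x + t *\<^sub>R e \<in> ?V"
          using x t ball_translate_segment[OF _ ne(1), of x x0 "\<rho> + s - \<tau>" t "\<rho> + s + t - \<tau>"] by auto
        then have "\<bar>v (x + \<tau> *\<^sub>R axis i 1) - v x\<bar> < t / 2"
          "\<bar>v (x + t *\<^sub>R e + \<tau> *\<^sub>R axis i 1) - v (x + t *\<^sub>R e)\<bar> < t / 2" using n by auto
        moreover have "x + t *\<^sub>R e + \<tau> *\<^sub>R axis i 1 = x + \<tau> *\<^sub>R axis i 1 + t *\<^sub>R e" by simp
        ultimately have "\<bar>q (x + \<tau> *\<^sub>R axis i 1) - q x\<bar> < t" unfolding q_def by (simp only:)
        then show False using x by auto
      qed
    qed measurable
    also have "\<dots> \<le> emeasure lborel ?X + emeasure lborel {x. x + t *\<^sub>R e \<in> ?X}"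
      by (rule emeasure_subadditive) measurable
    also have "\<dots> \<le> ennreal (\<tau>\<^sup>2 / (t / 2)\<^sup>2 * C) + ennreal (\<tau>\<^sup>2 / (t / 2)\<^sup>2 * C)"
      using X emeasure_lborel_translation[of ?X "t *\<^sub>R e"] by (intro add_mono) auto
    also have "\<dots> = ennreal (8 * C / t\<^sup>2 * \<tau>\<^sup>2)"
      using C by (simp add: power_divide mult_ac flip: ennreal_plus)
    finally show "emeasure lborel {x \<in> ball x0 (\<rho> + s - s / N). t \<le> \<bar>q (x + (s / N) *\<^sub>R axis i 1) - q x\<bar>}
        \<le> ennreal (8 * C / t\<^sup>2 * (s / N)\<^sup>2)" by (simp add: \<tau>_def)
  qed (use ne s N C \<delta>(2) J(2) in auto)
  then show ?thesis by simp
qed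

section \<open>Separation of phases\<close>

lemma ennreal_tendsto_0I:
  fixes f :: "'a \<Rightarrow> ennreal"
  assumes "\<And>\<eta>::real. 0 < \<eta> \<Longrightarrow> \<forall>\<^sub>F n in F. f n \<le> ennreal \<eta>"
  shows "(f \<longlongrightarrow> 0) F"
proof (rule order_tendstoI)
  fix a :: ennreal assume "0 < a"
  then obtain b where b: "0 < b" "b < a" using dense by blast
  then obtain \<eta> where \<eta>: "b = ennreal \<eta>" "0 < \<eta>"
    by (cases b) (auto simp: less_top)
  show "\<forall>\<^sub>F n in F. f n < a"
    using assms[OF \<eta>(2)] by eventually_elim (use b \<eta> in auto)
qed simp

lemma ennreal_tendsto_0_mono:
  fixes f g :: "'a \<Rightarrow> ennreal"
  assumes "(g \<longlongrightarrow> 0) F" "\<And>n. f n \<le> g n"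
  shows "(f \<longlongrightarrow> 0) F"
  by (rule tendsto_sandwich[OF _ _ tendsto_const assms(1)]) (use assms(2) in auto)

text \<open>In direction \<open>k\<close> the explicit bound tends to 0. In the other directions the
  order of the limits matters: \<open>N\<close> is fixed first to make the term in
  \<open>1 / N\<close> small, and only then does \<open>n\<close> grow, which removes
  \<open>N * \<beta> n\<close>.\<close>

lemma jump_axis_vanishes:
  fixes v y z :: "nat \<Rightarrow> real^'n::finite \<Rightarrow> real" and g :: "'n \<Rightarrow> nat \<Rightarrow> real^'n \<Rightarrow> real"
    and h \<epsilon> \<delta> :: "nat \<Rightarrow> real" and \<rho> \<rho>' s C :: real
  assumes \<Omega>: "open \<Omega>" and C: "0 \<le> C"
    and vy: "\<And>n. borel_weak_deriv \<Omega> k (v n) (y n)" and yz: "\<And>n. borel_weak_deriv \<Omega> k (y n) (z n)"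
    and vg: "\<And>i n. i \<noteq> k \<Longrightarrow> borel_weak_deriv \<Omega> i (v n) (g i n)"
    and h: "\<And>n. 0 < h n" "h \<longlonglongrightarrow> 0" and \<epsilon>: "\<And>n. 0 < \<epsilon> n" "\<epsilon> \<longlonglongrightarrow> 0"
    and z: "\<And>n. (\<integral>\<^sup>+x. ennreal ((z n x)\<^sup>2) \<partial>lborel) \<le> ennreal (C * (h n)\<^sup>2 / \<epsilon> n)"
    and g: "\<And>i n. i \<noteq> k \<Longrightarrow> (\<integral>\<^sup>+x. ennreal ((g i n x)\<^sup>2) \<partial>lborel) \<le> ennreal C"
    and bad: "\<And>n. emeasure lborel {x \<in> \<Omega>. \<bar>y n x\<bar> < 1/2} \<le> ennreal (C * \<epsilon> n)"
    and \<delta>: "\<And>n. (\<integral>\<^sup>+x. indicator \<Omega> x * ennreal \<bar>\<bar>y n x\<bar> - 1\<bar> \<partial>lborel) \<le> ennreal (\<delta> n)"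
      "\<And>n. 0 \<le> \<delta> n" "\<delta> \<longlonglongrightarrow> 0"
    and s: "0 \<le> s" and \<rho>: "\<rho> + s < \<rho>'" and ball: "ball x0 \<rho>' \<subseteq> \<Omega>"
  shows "(\<lambda>n. emeasure lborel {x \<in> ball x0 \<rho>. (0 \<le> y n x) \<noteq> (0 \<le> y n (x + s *\<^sub>R axis i 1))}) \<longlonglongrightarrow> 0"
proof -
  have along: "emeasure lborel {x \<in> ball x0 \<sigma>. (0 \<le> y n x) \<noteq> (0 \<le> y n (x + r *\<^sub>R axis k 1))}
      \<le> ennreal (3 * C * r * h n + 2 * C * \<epsilon> n)" if "0 \<le> r" "\<sigma> + r \<le> \<rho>'" for \<sigma> r n
    by (rule emeasure_jump_transition_le[OF yz that(1) _ h(1) \<epsilon>(1) C z bad \<Omega>])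
       (use ball that subset_ball[of "\<sigma> + r" \<rho>' x0] in blast)
  show ?thesis
  proof (cases "i = k")
    case True
    have "(\<lambda>n. ennreal (3 * C * s * h n + 2 * C * \<epsilon> n)) \<longlonglongrightarrow> ennreal (3 * C * s * 0 + 2 * C * 0)"
      by (intro tendsto_ennrealI tendsto_intros h \<epsilon>)
    then have "(\<lambda>n. ennreal (3 * C * s * h n + 2 * C * \<epsilon> n)) \<longlonglongrightarrow> 0" by simp
    then show ?thesis
    proof (rule ennreal_tendsto_0_mono)
      fix n
      show "emeasure lborel {x \<in> ball x0 \<rho>. (0 \<le> y n x) \<noteq> (0 \<le> y n (x + s *\<^sub>R axis i 1))}
          \<le> ennreal (3 * C * s * h n + 2 * C * \<epsilon> n)"
        unfolding True using \<rho> by (intro along[OF s]) simp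
    qed
  next
    case False
    \<comment> \<open>The room that the larger ball leaves for vertical segments once the step of
      length \<open>s\<close> is accounted for.\<close>
    define t where "t = \<rho>' - \<rho> - s"
    have t: "0 < t" using \<rho> by (simp add: t_def)
    define J where "J n = 3 * C * t * h n + 2 * C * \<epsilon> n" for n
    have J0: "0 \<le> J n" for n using C t h(1)[of n] \<epsilon>(1)[of n] by (simp add: J_def)
    define \<beta> where "\<beta> n = 2 * \<delta> n + 4 * J n" for n
    have "(\<lambda>n. 2 * \<delta> n + 4 * (3 * C * t * h n + 2 * C * \<epsilon> n)) \<longlonglongrightarrow> 2 * 0 + 4 * (3 * C * t * 0 + 2 * C * 0)"
      by (intro tendsto_intros h \<epsilon> \<delta>)
    then have \<beta>: "\<beta> \<longlonglongrightarrow> 0" by (simp add: \<beta>_def[abs_def] J_def)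
    have across: "emeasure lborel {x \<in> ball x0 \<rho>. (0 \<le> y n x) \<noteq> (0 \<le> y n (x + s *\<^sub>R axis i 1))}
       \<le> ennreal (8 * C / t\<^sup>2 * s\<^sup>2 / N + 2 * N * \<beta> n)" if "1 \<le> N" for N :: nat and n
      unfolding \<beta>_def
    proof (rule emeasure_jump_transversal_le[OF vy vg[OF False] s t _ \<Omega> g[OF False] C \<delta>(1,2) _ J0 that])
      show "ball x0 (\<rho> + s + t) \<subseteq> \<Omega>" using ball by (simp add: t_def)
      fix r assume r: "0 \<le> r" "r \<le> t"
      have "emeasure lborel {x \<in> ball x0 (\<rho> + s). (0 \<le> y n x) \<noteq> (0 \<le> y n (x + r *\<^sub>R axis k 1))}
         \<le> ennreal (3 * C * r * h n + 2 * C * \<epsilon> n)" using r by (intro along) (auto simp: t_def)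
      also have "\<dots> \<le> ennreal (J n)"
        unfolding J_def using r C h(1)[of n] by (intro ennreal_leI add_mono mult_right_mono mult_left_mono) auto
      finally show "emeasure lborel {x \<in> ball x0 (\<rho> + s). (0 \<le> y n x) \<noteq> (0 \<le> y n (x + r *\<^sub>R axis k 1))}
         \<le> ennreal (J n)" .
    qed
    show ?thesis
    proof (rule ennreal_tendsto_0I)
      fix \<eta> :: real assume \<eta>: "0 < \<eta>"
      obtain N0 :: nat where N0: "8 * C / t\<^sup>2 * s\<^sup>2 / (\<eta> / 2) < real N0"
        using reals_Archimedean2 by blast
      define N where "N = Suc N0"
      have "8 * C / t\<^sup>2 * s\<^sup>2 / (\<eta> / 2) < real N" using N0 by (simp add: N_def)
      then have N: "8 * C / t\<^sup>2 * s\<^sup>2 / N < \<eta> / 2"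
        using \<eta> pos_divide_less_eq[of "\<eta> / 2" "8 * C / t\<^sup>2 * s\<^sup>2" "real N"]
          pos_divide_less_eq[of "real N" "8 * C / t\<^sup>2 * s\<^sup>2" "\<eta> / 2"]
        by (simp only: N_def mult.commute)
      have "(\<lambda>n. 2 * N * \<beta> n) \<longlonglongrightarrow> real (2 * N) * 0" by (intro tendsto_intros \<beta>)
      then have "\<forall>\<^sub>F n in sequentially. 2 * N * \<beta> n < \<eta> / 2"
        using \<eta> by (intro order_tendstoD) auto
      then show "\<forall>\<^sub>F n in sequentially. emeasure lborel {x \<in> ball x0 \<rho>. (0 \<le> y n x) \<noteq> (0 \<le> y n (x + s *\<^sub>R axis i 1))} \<le> ennreal \<eta>"
      proof eventually_elim
        case (elim n)
        have "1 \<le> N" by (simp add: N_def)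
        from across[OF this, of n] show ?case
          by (rule order.trans) (use elim N in \<open>intro ennreal_leI, simp\<close>)
      qed
    qed
  qed
qed

definition jump_vanishes :: "(nat \<Rightarrow> 'a::euclidean_space set) \<Rightarrow> 'a \<Rightarrow> real \<Rightarrow> 'a \<Rightarrow> bool" where
  "jump_vanishes E x0 \<rho> c \<longleftrightarrow>
     (\<lambda>n. emeasure lborel {x \<in> ball x0 \<rho>. (x \<in> E n) \<noteq> (x + c \<in> E n)}) \<longlonglongrightarrow> 0"

text \<open>A jump across \<open>c + d\<close> occurs across \<open>c\<close> or, from the point
  \<open>x + c\<close>, across \<open>d\<close>; that intermediate point may leave the ball, hence
  the larger radius for \<open>d\<close>.\<close>

lemma jump_vanishes_add:
  fixes c d :: "'a::euclidean_space"
  assumes [measurable]: "\<And>n. E n \<in> sets borel"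
    and c: "jump_vanishes E x0 \<rho> c" and d: "jump_vanishes E x0 (\<rho> + norm c) d"
  shows "jump_vanishes E x0 \<rho> (c + d)"
  unfolding jump_vanishes_def
proof (rule ennreal_tendsto_0_mono)
  let ?D = "\<lambda>n. {x \<in> ball x0 (\<rho> + norm c). (x \<in> E n) \<noteq> (x + d \<in> E n)}"
  have [measurable]: "?D n \<in> sets borel" for n by measurable
  show "(\<lambda>n. emeasure lborel {x \<in> ball x0 \<rho>. (x \<in> E n) \<noteq> (x + c \<in> E n)} + emeasure lborel (?D n)) \<longlonglongrightarrow> 0"
    using tendsto_add[OF c[unfolded jump_vanishes_def] d[unfolded jump_vanishes_def]] by simp
  fix n
  have "emeasure lborel {x \<in> ball x0 \<rho>. (x \<in> E n) \<noteq> (x + (c + d) \<in> E n)} \<le>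
     emeasure lborel ({x \<in> ball x0 \<rho>. (x \<in> E n) \<noteq> (x + c \<in> E n)} \<union> {x. x + c \<in> ?D n})"
  proof (rule emeasure_mono)
    show "{x \<in> ball x0 \<rho>. (x \<in> E n) \<noteq> (x + (c + d) \<in> E n)} \<subseteq>
      {x \<in> ball x0 \<rho>. (x \<in> E n) \<noteq> (x + c \<in> E n)} \<union> {x. x + c \<in> ?D n}"
      using ball_translate[of _ x0 \<rho> c "\<rho> + norm c"] by (auto simp: add.assoc)
  qed measurable
  also have "\<dots> \<le> emeasure lborel {x \<in> ball x0 \<rho>. (x \<in> E n) \<noteq> (x + c \<in> E n)} + emeasure lborel {x. x + c \<in> ?D n}"
    by (rule emeasure_subadditive) measurable
  finally show "emeasure lborel {x \<in> ball x0 \<rho>. (x \<in> E n) \<noteq> (x + (c + d) \<in> E n)} \<le>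
     emeasure lborel {x \<in> ball x0 \<rho>. (x \<in> E n) \<noteq> (x + c \<in> E n)} + emeasure lborel (?D n)"
    by (simp only: emeasure_lborel_translation[OF \<open>?D n \<in> sets borel\<close>])
qed

text \<open>Read from its other end, a jump across \<open>- c\<close> is a jump across
  \<open>c\<close>.\<close>

lemma jump_vanishes_minus:
  fixes c :: "'a::euclidean_space"
  assumes [measurable]: "\<And>n. E n \<in> sets borel"
    and c: "jump_vanishes E x0 (\<rho> + norm c) c"
  shows "jump_vanishes E x0 \<rho> (- c)"
  unfolding jump_vanishes_def
proof (rule ennreal_tendsto_0_mono)
  let ?D = "\<lambda>n. {x \<in> ball x0 (\<rho> + norm c). (x \<in> E n) \<noteq> (x + c \<in> E n)}"
  have [measurable]: "?D n \<in> sets borel" for n by measurable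
  show "(\<lambda>n. emeasure lborel (?D n)) \<longlonglongrightarrow> 0" using c by (simp add: jump_vanishes_def)
  fix n
  have "emeasure lborel {x \<in> ball x0 \<rho>. (x \<in> E n) \<noteq> (x + - c \<in> E n)} \<le> emeasure lborel {x. x + - c \<in> ?D n}"
  proof (rule emeasure_mono)
    show "{x \<in> ball x0 \<rho>. (x \<in> E n) \<noteq> (x + - c \<in> E n)} \<subseteq> {x. x + - c \<in> ?D n}"
      using ball_translate[of _ x0 \<rho> "- c" "\<rho> + norm c"] by auto
  qed measurable
  then show "emeasure lborel {x \<in> ball x0 \<rho>. (x \<in> E n) \<noteq> (x + - c \<in> E n)} \<le> emeasure lborel (?D n)"
    by (simp only: emeasure_lborel_translation[OF \<open>?D n \<in> sets borel\<close>])
qed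

lemma jump_vanishes_zero: "jump_vanishes E x0 \<rho> 0"
  by (simp add: jump_vanishes_def)

text \<open>The displacement is covered one coordinate at a time. A negative coordinate reverses a
  positive step that needs a ball already enlarged by its length, which is the source of the factor
  2.\<close>

lemma jump_vanishes_coords:
  fixes c :: "real^'n::finite"
  assumes E: "\<And>n. E n \<in> sets borel"
    and axis: "\<And>\<sigma> s i. 0 \<le> s \<Longrightarrow> \<sigma> + s < \<rho>' \<Longrightarrow> jump_vanishes E x0 \<sigma> (s *\<^sub>R axis i 1)"
    and \<rho>: "\<rho> + 2 * (\<Sum>i\<in>UNIV. \<bar>c $ i\<bar>) < \<rho>'"
  shows "jump_vanishes E x0 \<rho> c"
proof -
  have "jump_vanishes E x0 \<rho> (\<Sum>i\<in>I. (c $ i) *\<^sub>R axis i 1)"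
    if "finite I" "\<rho> + 2 * (\<Sum>i\<in>I. \<bar>c $ i\<bar>) < \<rho>'" for I
    using that
  proof (induction I rule: finite_induct)
    case (insert i I)
    let ?w = "\<Sum>i\<in>I. (c $ i) *\<^sub>R axis i (1::real) :: real^'n"
    have "norm ?w \<le> (\<Sum>i\<in>I. \<bar>c $ i\<bar>)"
      by (rule order.trans[OF norm_sum]) (simp add: norm_axis_1)
    moreover have "0 \<le> (\<Sum>i\<in>I. \<bar>c $ i\<bar>)" by (simp add: sum_nonneg)
    moreover have "(\<Sum>i\<in>insert i I. \<bar>c $ i\<bar>) = \<bar>c $ i\<bar> + (\<Sum>i\<in>I. \<bar>c $ i\<bar>)"
      using insert.hyps by simp
    ultimately have le: "\<rho> + norm ?w + 2 * \<bar>c $ i\<bar> < \<rho>'"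
      using insert.prems by linarith
    have "jump_vanishes E x0 (\<rho> + norm ?w) ((c $ i) *\<^sub>R axis i 1)"
    proof (cases "0 \<le> c $ i")
      case True
      then show ?thesis using le by (intro axis) auto
    next
      case False
      then have "jump_vanishes E x0 (\<rho> + norm ?w + norm ((- c $ i) *\<^sub>R axis i (1::real) :: real^'n)) ((- c $ i) *\<^sub>R axis i 1)"
        using le by (intro axis) (auto simp: norm_axis_1)
      from jump_vanishes_minus[OF E this] show ?thesis by simp
    qed
    moreover have "jump_vanishes E x0 \<rho> ?w"
      using insert.prems insert.hyps by (intro insert.IH) auto
    ultimately have "jump_vanishes E x0 \<rho> (?w + (c $ i) *\<^sub>R axis i 1)"
      by (intro jump_vanishes_add E)
    then show ?case using insert.hyps by (simp add: add.commute)
  qed (simp add: jump_vanishes_zero)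
  from this[of UNIV] have "jump_vanishes E x0 \<rho> (\<Sum>i\<in>UNIV. (c $ i) *\<^sub>R axis i 1)" using \<rho> by simp
  then show ?thesis using basis_expansion[of c] by (simp add: scalar_mult_eq_scaleR)
qed

text \<open>Points of the two phases are written as \<open>x\<close> and \<open>x + c\<close>. By
  Fubini the product of the measures is an integral over \<open>c\<close> of measures of sets
  contained in the jump sets. Only \<open>c\<close> in \<open>ball 0 (2 * \<rho>)\<close> occurs, so
  the measure of the ball is an integrable bound for dominated convergence.\<close>

lemma phases_separate_if_jumps_vanish:
  fixes E :: "nat \<Rightarrow> 'a::euclidean_space set"
  assumes [measurable]: "\<And>n. E n \<in> sets borel"
    and jump: "\<And>c. norm c < 2 * \<rho> \<Longrightarrow> jump_vanishes E x0 \<rho> c"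
  shows "(\<lambda>n. emeasure lborel (E n \<inter> ball x0 \<rho>) * emeasure lborel (ball x0 \<rho> - E n)) \<longlonglongrightarrow> 0"
proof (rule ennreal_tendsto_0_mono)
  let ?Q = "ball x0 \<rho>"
  have [measurable]: "?Q \<in> sets borel" "ball (0::'a) (2 * \<rho>) \<in> sets borel" by simp_all
  define J where "J n c = emeasure lborel {x \<in> ?Q. (x \<in> E n) \<noteq> (x + c \<in> E n)}" for n c
  have Jint: "J n c = (\<integral>\<^sup>+x. indicator {x \<in> ?Q. (x \<in> E n) \<noteq> (x + c \<in> E n)} x \<partial>lborel)" for n c
    unfolding J_def by simp
  have jm[measurable]: "Measurable.pred (borel \<Otimes>\<^sub>M borel) (\<lambda>p. snd p \<in> ?Q \<and> ((snd p \<in> E n) \<noteq> (snd p + fst p \<in> E n)))" for n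
    by measurable
  have [measurable]: "(\<lambda>(c, x). indicator {x \<in> ?Q. (x \<in> E n) \<noteq> (x + c \<in> E n)} x :: ennreal) \<in> borel_measurable (lborel \<Otimes>\<^sub>M lborel)" for n
    unfolding indicator_def[abs_def] split_beta' by (simp cong: measurable_cong_sets)
  have [measurable]: "J n \<in> borel_measurable borel" for n
    unfolding Jint[abs_def] by measurable
  have fin: "emeasure lborel (ball x r) < \<infinity>" for x :: 'a and r
    using emeasure_bounded_finite[OF bounded_ball] by simp
  show "(\<lambda>n. \<integral>\<^sup>+c. indicator (ball (0::'a) (2 * \<rho>)) c * J n c \<partial>lborel) \<longlonglongrightarrow> 0"
  proof -
    have "(\<lambda>n. \<integral>\<^sup>+c. indicator (ball (0::'a) (2 * \<rho>)) c * J n c \<partial>lborel) \<longlonglongrightarrow> (\<integral>\<^sup>+c. 0 \<partial>(lborel :: 'a measure))"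
    proof (rule nn_integral_dominated_convergence[where w = "\<lambda>c. indicator (ball (0::'a) (2 * \<rho>)) c * emeasure lborel ?Q"])
      have "(\<integral>\<^sup>+c. indicator (ball (0::'a) (2 * \<rho>)) c * emeasure lborel ?Q \<partial>lborel) = emeasure lborel (ball (0::'a) (2 * \<rho>)) * emeasure lborel ?Q"
        by (subst nn_integral_multc) simp_all
      also have "\<dots> < \<infinity>" using fin by (simp add: ennreal_mult_less_top)
      finally show "(\<integral>\<^sup>+c. indicator (ball (0::'a) (2 * \<rho>)) c * emeasure lborel ?Q \<partial>lborel) < \<infinity>" .
      show "AE c in lborel. indicator (ball (0::'a) (2 * \<rho>)) c * J n c \<le> indicator (ball (0::'a) (2 * \<rho>)) c * emeasure lborel ?Q" for n
        by (intro AE_I2 mult_left_mono) (auto simp: J_def intro!: emeasure_mono)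
      show "AE c in lborel. (\<lambda>n. indicator (ball (0::'a) (2 * \<rho>)) c * J n c) \<longlonglongrightarrow> 0"
      proof (rule AE_I2)
        fix c :: 'a
        show "(\<lambda>n. indicator (ball (0::'a) (2 * \<rho>)) c * J n c) \<longlonglongrightarrow> 0"
          using jump[of c] by (cases "c \<in> ball 0 (2 * \<rho>)") (auto simp: jump_vanishes_def J_def)
      qed
    qed measurable
    then show ?thesis by simp
  qed
  fix n
  have "emeasure lborel (E n \<inter> ?Q) * emeasure lborel (?Q - E n) =
     (\<integral>\<^sup>+x. indicator (E n \<inter> ?Q) x * emeasure lborel (?Q - E n) \<partial>lborel)"
    by (subst nn_integral_multc) auto
  also have "\<dots> = (\<integral>\<^sup>+x. (\<integral>\<^sup>+c. indicator (E n \<inter> ?Q) x * indicator (?Q - E n) (x + c) \<partial>lborel) \<partial>lborel)"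
  proof (rule nn_integral_cong)
    fix x
    have "(\<integral>\<^sup>+c. indicator (?Q - E n) (c + x) \<partial>lborel) = (\<integral>\<^sup>+c. indicator (?Q - E n) c \<partial>lborel)"
      by (rule nn_integral_lborel_translation) measurable
    then show "indicator (E n \<inter> ?Q) x * emeasure lborel (?Q - E n) =
        (\<integral>\<^sup>+c. indicator (E n \<inter> ?Q) x * indicator (?Q - E n) (x + c) \<partial>lborel)"
      by (simp add: nn_integral_cmult add.commute)
  qed
  also have "\<dots> = (\<integral>\<^sup>+c. (\<integral>\<^sup>+x. indicator (E n \<inter> ?Q) x * indicator (?Q - E n) (x + c) \<partial>lborel) \<partial>lborel)"
    by (rule lborel_pair.Fubini') measurable
  also have "\<dots> \<le> (\<integral>\<^sup>+c. indicator (ball (0::'a) (2 * \<rho>)) c * J n c \<partial>lborel)"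
  proof (rule nn_integral_mono)
    fix c
    have "(\<integral>\<^sup>+x. indicator (E n \<inter> ?Q) x * indicator (?Q - E n) (x + c) \<partial>lborel) \<le>
        (\<integral>\<^sup>+x. indicator (ball (0::'a) (2 * \<rho>)) c * indicator {x \<in> ?Q. (x \<in> E n) \<noteq> (x + c \<in> E n)} x \<partial>lborel)"
    proof (rule nn_integral_mono)
      fix x
      show "indicator (E n \<inter> ?Q) x * indicator (?Q - E n) (x + c) \<le>
        indicator (ball (0::'a) (2 * \<rho>)) c * (indicator {x \<in> ?Q. (x \<in> E n) \<noteq> (x + c \<in> E n)} x :: ennreal)"
      proof (cases "x \<in> E n \<inter> ?Q \<and> x + c \<in> ?Q - E n")
        case True
        then have "dist x (x + c) < 2 * \<rho>" using dist_triangle2[of x "x + c" x0] by (auto simp: dist_commute)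
        then show ?thesis using True by (auto simp: indicator_def dist_norm)
      qed (auto simp: indicator_def)
    qed
    also have "\<dots> = indicator (ball (0::'a) (2 * \<rho>)) c * J n c"
      unfolding Jint by (rule nn_integral_cmult) measurable
    finally show "(\<integral>\<^sup>+x. indicator (E n \<inter> ?Q) x * indicator (?Q - E n) (x + c) \<partial>lborel) \<le>
      indicator (ball (0::'a) (2 * \<rho>)) c * J n c" .
  qed
  finally show "emeasure lborel (E n \<inter> ?Q) * emeasure lborel (?Q - E n) \<le>
     (\<integral>\<^sup>+c. indicator (ball (0::'a) (2 * \<rho>)) c * J n c \<partial>lborel)" .
qed

text \<open>Covers the two ways in which one factor is singled out: \<open>b\<close> eventually
  bounded below, or \<open>b\<close> at least as large as \<open>a\<close>.\<close>

lemma ennreal_tendsto_0_if_mult: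
  fixes a b :: "nat \<Rightarrow> ennreal"
  assumes ab: "(\<lambda>n. a n * b n) \<longlonglongrightarrow> 0"
    and b: "\<And>\<mu>::real. 0 < \<mu> \<Longrightarrow> \<exists>\<eta>>0. \<forall>\<^sub>F n in sequentially. ennreal \<mu> \<le> a n \<longrightarrow> ennreal \<eta> \<le> b n"
  shows "a \<longlonglongrightarrow> 0"
proof (rule ennreal_tendsto_0I)
  fix \<mu> :: real assume \<mu>: "0 < \<mu>"
  obtain \<eta> where \<eta>: "0 < \<eta>" and ev: "\<forall>\<^sub>F n in sequentially. ennreal \<mu> \<le> a n \<longrightarrow> ennreal \<eta> \<le> b n"
    using b[OF \<mu>] by blast
  have "\<forall>\<^sub>F n in sequentially. a n * b n < ennreal (\<mu> * \<eta>)"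
    using ab by (rule order_tendstoD) (use \<mu> \<eta> in simp)
  then show "\<forall>\<^sub>F n in sequentially. a n \<le> ennreal \<mu>"
    using ev
  proof eventually_elim
    case (elim n)
    show ?case
    proof (rule ccontr)
      assume "\<not> a n \<le> ennreal \<mu>"
      then have "ennreal \<mu> * ennreal \<eta> \<le> a n * b n"
        using elim by (intro mult_mono) auto
      then show False using elim(1) \<mu> \<eta> by (simp add: ennreal_mult)
    qed
  qed
qed

text \<open>The set \<open>S\<close> of points near which \<open>F\<close> disappears is open. A
  ball meeting \<open>S\<close> contains an open piece of some measure \<open>m > 0\<close> on which
  \<open>F\<close> disappears, so the complement of \<open>F\<close> keeps at least
  \<open>m / 2\<close> in the ball and the product hypothesis makes \<open>F\<close> disappear on
  all of it. Hence \<open>\<Omega> - S\<close> is open too, and connectedness gives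
  \<open>S = \<Omega>\<close>.\<close>

lemma measure_vanishes_by_propagation:
  fixes F :: "nat \<Rightarrow> 'a::euclidean_space set"
  assumes \<Omega>: "open \<Omega>" "connected \<Omega>" "emeasure lborel \<Omega> < \<infinity>"
    and F[measurable]: "\<And>n. F n \<in> sets borel"
    and loc: "\<And>x. x \<in> \<Omega> \<Longrightarrow> \<exists>\<rho>>0. ball x \<rho> \<subseteq> \<Omega> \<and>
       (\<lambda>n. emeasure lborel (F n \<inter> ball x \<rho>) * emeasure lborel (ball x \<rho> - F n)) \<longlonglongrightarrow> 0"
    and x0: "x0 \<in> \<Omega>" "0 < \<rho>0" "(\<lambda>n. emeasure lborel (F n \<inter> ball x0 \<rho>0)) \<longlonglongrightarrow> 0"
  shows "(\<lambda>n. emeasure lborel (F n \<inter> \<Omega>)) \<longlonglongrightarrow> 0"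
proof -
  define S where "S = {x \<in> \<Omega>. \<exists>\<rho>>0. (\<lambda>n. emeasure lborel (F n \<inter> ball x \<rho>)) \<longlonglongrightarrow> 0}"
  have spread: "x \<in> S" if x: "x \<in> \<Omega>" and r: "0 < r" "ball x r \<inter> S \<noteq> {}"
      "(\<lambda>n. emeasure lborel (F n \<inter> ball x r) * emeasure lborel (ball x r - F n)) \<longlonglongrightarrow> 0" for x r
  proof -
    obtain y \<sigma> where y: "y \<in> ball x r" "0 < \<sigma>" "(\<lambda>n. emeasure lborel (F n \<inter> ball y \<sigma>)) \<longlonglongrightarrow> 0"
      using r(2) by (auto simp: S_def)
    define U where "U = ball x r \<inter> ball y \<sigma>"
    have "open U" "U \<noteq> {}" using y by (auto simp: U_def)
    then have Upos: "0 < emeasure lborel U"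
      using open_not_negligible[of U] \<open>open U\<close> null_sets_completion_iff[of U lborel]
      by (auto simp: negligible_iff_null_sets zero_less_iff_neq_zero)
    have Ufin: "emeasure lborel U < \<infinity>"
      unfolding U_def using emeasure_bounded_finite[of "ball x r \<inter> ball y \<sigma>"] by (simp add: bounded_Int)
    obtain m where m: "emeasure lborel U = ennreal m" "0 < m"
      using Upos Ufin by (cases "emeasure lborel U") auto
    have [measurable]: "U \<in> sets borel" using \<open>open U\<close> by simp
    have "\<forall>\<^sub>F n in sequentially. emeasure lborel (F n \<inter> ball y \<sigma>) < ennreal (m / 2)"
      using y(3) by (rule order_tendstoD) (use m in simp)
    then have ev: "\<forall>\<^sub>F n in sequentially. ennreal (m / 2) \<le> emeasure lborel (ball x r - F n)"
    proof eventually_elim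
      case (elim n)
      have "ennreal m \<le> emeasure lborel ((U - F n) \<union> (F n \<inter> ball y \<sigma>))"
        unfolding m(1)[symmetric] by (rule emeasure_mono) (auto simp: U_def)
      also have "\<dots> \<le> emeasure lborel (U - F n) + emeasure lborel (F n \<inter> ball y \<sigma>)"
        by (rule emeasure_subadditive) auto
      also have "\<dots> \<le> emeasure lborel (ball x r - F n) + ennreal (m / 2)"
        using elim by (intro add_mono emeasure_mono) (auto simp: U_def)
      finally have "ennreal m - ennreal (m / 2) \<le> emeasure lborel (ball x r - F n)"
        by (simp add: ennreal_minus_le_iff add.commute)
      then show ?case using m(2) by (subst (asm) ennreal_minus) auto
    qed
    have "(\<lambda>n. emeasure lborel (F n \<inter> ball x r)) \<longlonglongrightarrow> 0"
      
    proof (rule ennreal_tendsto_0_if_mult[OF r(3)], intro exI conjI)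
      show "0 < m / 2" using m(2) by simp
      show "\<forall>\<^sub>F n in sequentially. ennreal \<mu> \<le> emeasure lborel (F n \<inter> ball x r) \<longrightarrow>
          ennreal (m / 2) \<le> emeasure lborel (ball x r - F n)" for \<mu>
        using ev by eventually_elim simp
    qed
    then show "x \<in> S" using x r(1) by (auto simp: S_def)
  qed
  have oS: "open S"
    unfolding open_contains_ball
  proof
    fix x assume "x \<in> S"
    then obtain \<rho> where x: "x \<in> \<Omega>" and \<rho>: "0 < \<rho>" "(\<lambda>n. emeasure lborel (F n \<inter> ball x \<rho>)) \<longlonglongrightarrow> 0"
      by (auto simp: S_def)
    obtain r where r: "0 < r" "ball x r \<subseteq> \<Omega>" using \<Omega>(1) x open_contains_ball by blast
    have "ball x (min r (\<rho> / 2)) \<subseteq> S"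
    proof
      fix y assume y: "y \<in> ball x (min r (\<rho> / 2))"
      have sub: "ball y (\<rho> / 2) \<subseteq> ball x \<rho>"
      proof
        fix w assume "w \<in> ball y (\<rho> / 2)"
        then show "w \<in> ball x \<rho>" using y dist_triangle[of x w y] by auto
      qed
      have "(\<lambda>n. emeasure lborel (F n \<inter> ball y (\<rho> / 2))) \<longlonglongrightarrow> 0"
        by (rule ennreal_tendsto_0_mono[OF \<rho>(2)], rule emeasure_mono) (use sub in auto)
      then show "y \<in> S" using y r \<rho>(1) by (auto simp: S_def intro!: exI[of _ "\<rho> / 2"])
    qed
    then show "\<exists>e>0. ball x e \<subseteq> S" using r \<rho>(1) by (intro exI[of _ "min r (\<rho> / 2)"]) auto
  qed
  have oT: "open (\<Omega> - S)"
    unfolding open_contains_ball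
  proof
    fix x assume x: "x \<in> \<Omega> - S"
    then obtain r where r: "0 < r" "ball x r \<subseteq> \<Omega>"
      "(\<lambda>n. emeasure lborel (F n \<inter> ball x r) * emeasure lborel (ball x r - F n)) \<longlonglongrightarrow> 0"
      using loc by blast
    then have "ball x r \<inter> S = {}" using spread[of x r] x by blast
    then show "\<exists>e>0. ball x e \<subseteq> \<Omega> - S" using r by blast
  qed
  have "x0 \<in> S" using x0 by (auto simp: S_def)
  then have S: "S = \<Omega>"
    using connectedD[OF \<Omega>(2) oS oT] x0 by (auto simp: S_def)
  \<comment> \<open>From local to global: each compact set of an exhaustion is covered by finitely
    many good balls, and the rest of \<open>\<Omega>\<close> is small because its measure is
    finite.\<close>
  obtain C where C: "\<And>n. compact (C n)" "\<And>n. C n \<subseteq> \<Omega>" "\<And>n. C n \<subseteq> interior (C (Suc n))" "\<Union> (range C) = \<Omega>"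
    by (rule open_Union_compact_subsets[OF \<Omega>(1)]) blast
  have Cm[measurable]: "C n \<in> sets borel" for n using C(1) by (simp add: borel_compact)
  have \<Omega>m[measurable]: "\<Omega> \<in> sets borel" using \<Omega>(1) by simp
  have "(\<lambda>n. emeasure lborel (\<Omega> - C n)) \<longlonglongrightarrow> emeasure lborel (\<Inter>n. \<Omega> - C n)"
  proof (rule Lim_emeasure_decseq)
    have "C n \<subseteq> C (Suc n)" for n using C(3)[of n] interior_subset by blast
    then show "decseq (\<lambda>n. \<Omega> - C n)" by (intro decseq_SucI) blast
    have "emeasure lborel (\<Omega> - C i) \<le> emeasure lborel \<Omega>" for i by (rule emeasure_mono) auto
    then show "emeasure lborel (\<Omega> - C i) \<noteq> \<infinity>" for i using \<Omega>(3) by (metis infinity_ennreal_def leD)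
  qed auto
  also have "(\<Inter>n. \<Omega> - C n) = {}" using C(4) by auto
  finally have tail: "(\<lambda>n. emeasure lborel (\<Omega> - C n)) \<longlonglongrightarrow> 0" by simp
  have K: "(\<lambda>n. emeasure lborel (F n \<inter> K)) \<longlonglongrightarrow> 0" if Kc: "compact K" "K \<subseteq> \<Omega>" for K
  proof -
    have "\<forall>x\<in>K. \<exists>\<rho>>0. (\<lambda>n. emeasure lborel (F n \<inter> ball x \<rho>)) \<longlonglongrightarrow> 0"
      using Kc(2) S by (auto simp: S_def)
    then obtain R where R: "\<And>x. x \<in> K \<Longrightarrow> 0 < R x" "\<And>x. x \<in> K \<Longrightarrow> (\<lambda>n. emeasure lborel (F n \<inter> ball x (R x))) \<longlonglongrightarrow> 0"
      by metis
    obtain D where D: "D \<subseteq> K" "finite D" "K \<subseteq> (\<Union>x\<in>D. ball x (R x))"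
      using compactE_image[OF Kc(1), where C = K and f = "\<lambda>x. ball x (R x)"] R(1)
      by (metis (no_types, lifting) UN_I centre_in_ball open_ball subsetI)
    have Km: "K \<in> sets borel" using Kc(1) by (simp add: borel_compact)
    show ?thesis
    proof (rule ennreal_tendsto_0_mono)
      show "(\<lambda>n. \<Sum>x\<in>D. emeasure lborel (F n \<inter> ball x (R x))) \<longlonglongrightarrow> 0"
        by (rule tendsto_null_sum) (use R(2) D(1) in blast)
      fix n
      have um: "(\<Union>x\<in>D. F n \<inter> ball x (R x)) \<in> sets lborel"
        using D(2) by (intro sets.finite_UN) auto
      have "emeasure lborel (F n \<inter> K) \<le> emeasure lborel (\<Union>x\<in>D. F n \<inter> ball x (R x))"
        by (rule emeasure_mono[OF _ um]) (use D(3) in auto)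
      also have "\<dots> \<le> (\<Sum>x\<in>D. emeasure lborel (F n \<inter> ball x (R x)))"
        using D(2) by (intro emeasure_subadditive_finite) auto
      finally show "emeasure lborel (F n \<inter> K) \<le> (\<Sum>x\<in>D. emeasure lborel (F n \<inter> ball x (R x)))" .
    qed
  qed
  show ?thesis
  proof (rule ennreal_tendsto_0I)
    fix \<eta> :: real assume \<eta>: "0 < \<eta>"
    have "\<forall>\<^sub>F k in sequentially. emeasure lborel (\<Omega> - C k) < ennreal (\<eta> / 2)"
      using tail by (rule order_tendstoD) (use \<eta> in simp)
    then obtain k where k: "emeasure lborel (\<Omega> - C k) < ennreal (\<eta> / 2)"
      using eventually_happens'[OF sequentially_bot] by blast
    have "\<forall>\<^sub>F n in sequentially. emeasure lborel (F n \<inter> C k) < ennreal (\<eta> / 2)"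
      using K[OF C(1,2)] by (rule order_tendstoD) (use \<eta> in simp)
    then show "\<forall>\<^sub>F n in sequentially. emeasure lborel (F n \<inter> \<Omega>) \<le> ennreal \<eta>"
    proof eventually_elim
      case (elim n)
      have "emeasure lborel (F n \<inter> \<Omega>) \<le> emeasure lborel ((F n \<inter> C k) \<union> (\<Omega> - C k))"
        by (rule emeasure_mono) auto
      also have "\<dots> \<le> emeasure lborel (F n \<inter> C k) + emeasure lborel (\<Omega> - C k)"
        by (rule emeasure_subadditive) auto
      also have "\<dots> \<le> ennreal (\<eta> / 2) + ennreal (\<eta> / 2)"
        using elim k by (intro add_mono) auto
      finally show ?case using \<eta> by (simp flip: ennreal_plus)
    qed
  qed
qed

text \<open>One fixed ball decides. The indices at which \<open>E n\<close> is the minority there,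
  or else all the others, form a subsequence; along it the smaller of two factors with vanishing
  product tends to 0, and this minority phase then disappears everywhere by propagation.\<close>

lemma phase_selection:
  fixes E :: "nat \<Rightarrow> 'a::euclidean_space set"
  assumes \<Omega>: "open \<Omega>" "connected \<Omega>" "emeasure lborel \<Omega> < \<infinity>"
    and E: "\<And>n. E n \<in> sets borel"
    and loc: "\<And>x. x \<in> \<Omega> \<Longrightarrow> \<exists>\<rho>>0. ball x \<rho> \<subseteq> \<Omega> \<and>
       (\<lambda>n. emeasure lborel (E n \<inter> ball x \<rho>) * emeasure lborel (ball x \<rho> - E n)) \<longlonglongrightarrow> 0"
  shows "\<exists>r. strict_mono r \<and> ((\<lambda>n. emeasure lborel (E (r n) \<inter> \<Omega>)) \<longlonglongrightarrow> 0 \<or>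
     (\<lambda>n. emeasure lborel (\<Omega> - E (r n))) \<longlonglongrightarrow> 0)"
proof (cases "\<Omega> = {}")
  case True
  then show ?thesis by (intro exI[of _ id]) (auto simp: strict_mono_def)
next
  case False
  then obtain x0 where x0: "x0 \<in> \<Omega>" by blast
  then obtain \<rho> where \<rho>: "0 < \<rho>"
    "(\<lambda>n. emeasure lborel (E n \<inter> ball x0 \<rho>) * emeasure lborel (ball x0 \<rho> - E n)) \<longlonglongrightarrow> 0"
    using loc by blast
  have half: "a \<longlonglongrightarrow> 0" if ab: "(\<lambda>n. a n * b n) \<longlonglongrightarrow> 0" and le: "\<And>n. a n \<le> b n" for a b :: "nat \<Rightarrow> ennreal"
    using ab by (rule ennreal_tendsto_0_if_mult) (use le in \<open>blast intro: order.trans always_eventually\<close>)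
  define P where "P = {n. emeasure lborel (E n \<inter> ball x0 \<rho>) \<le> emeasure lborel (ball x0 \<rho> - E n)}"
  show ?thesis
  proof (cases "infinite P")
    case True
    define r where "r = enumerate P"
    have r: "strict_mono r" "r n \<in> P" for n
      using True by (auto simp: r_def strict_mono_enumerate enumerate_in_set)
    have "(\<lambda>n. emeasure lborel (E (r n) \<inter> \<Omega>)) \<longlonglongrightarrow> 0"
    proof (rule measure_vanishes_by_propagation[OF \<Omega> E _ x0 \<rho>(1)])
      show "(\<lambda>n. emeasure lborel (E (r n) \<inter> ball x0 \<rho>)) \<longlonglongrightarrow> 0"
        by (rule half[OF LIMSEQ_subseq_LIMSEQ[OF \<rho>(2) r(1), unfolded comp_def]]) (use r(2) in \<open>auto simp: P_def\<close>)
      fix x assume "x \<in> \<Omega>"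
      then obtain \<sigma> where \<sigma>: "0 < \<sigma>" "ball x \<sigma> \<subseteq> \<Omega>"
        "(\<lambda>n. emeasure lborel (E n \<inter> ball x \<sigma>) * emeasure lborel (ball x \<sigma> - E n)) \<longlonglongrightarrow> 0"
        using loc by blast
      then show "\<exists>\<sigma>>0. ball x \<sigma> \<subseteq> \<Omega> \<and>
        (\<lambda>n. emeasure lborel (E (r n) \<inter> ball x \<sigma>) * emeasure lborel (ball x \<sigma> - E (r n))) \<longlonglongrightarrow> 0"
        using LIMSEQ_subseq_LIMSEQ[OF \<sigma>(3) r(1)] by (auto simp: comp_def)
    qed
    then show ?thesis using r(1) by blast
  next
    case False
    then have inf: "infinite (- P)" by (simp add: finite_compl[symmetric] Compl_eq_Diff_UNIV)
    define r where "r = enumerate (- P)"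
    have r: "strict_mono r" "r n \<in> - P" for n
      unfolding r_def by (rule strict_mono_enumerate[OF inf], rule enumerate_in_set[OF inf])
    have eq: "- A \<inter> ball x \<sigma> = ball x \<sigma> - A" "ball x \<sigma> - - A = A \<inter> ball x \<sigma>" for A :: "'a set" and x \<sigma> by auto
    have "(\<lambda>n. emeasure lborel (- E (r n) \<inter> \<Omega>)) \<longlonglongrightarrow> 0"
    proof (rule measure_vanishes_by_propagation[OF \<Omega> _ _ x0 \<rho>(1)])
      show "- E (r n) \<in> sets borel" for n using E by (rule borel_comp)
      have 1: "(\<lambda>n. emeasure lborel (ball x0 \<rho> - E (r n)) * emeasure lborel (E (r n) \<inter> ball x0 \<rho>)) \<longlonglongrightarrow> 0"
        using LIMSEQ_subseq_LIMSEQ[OF \<rho>(2) r(1)] by (simp add: comp_def mult.commute)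
      show "(\<lambda>n. emeasure lborel (- E (r n) \<inter> ball x0 \<rho>)) \<longlonglongrightarrow> 0"
        unfolding eq by (rule half[OF 1]) (use r(2) in \<open>auto simp: P_def not_le intro: less_imp_le\<close>)
      fix x assume "x \<in> \<Omega>"
      then obtain \<sigma> where \<sigma>: "0 < \<sigma>" "ball x \<sigma> \<subseteq> \<Omega>"
        "(\<lambda>n. emeasure lborel (E n \<inter> ball x \<sigma>) * emeasure lborel (ball x \<sigma> - E n)) \<longlonglongrightarrow> 0"
        using loc by blast
      then show "\<exists>\<sigma>>0. ball x \<sigma> \<subseteq> \<Omega> \<and>
        (\<lambda>n. emeasure lborel (- E (r n) \<inter> ball x \<sigma>) * emeasure lborel (ball x \<sigma> - - E (r n))) \<longlonglongrightarrow> 0"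
        unfolding eq using LIMSEQ_subseq_LIMSEQ[OF \<sigma>(3) r(1)] by (auto simp: comp_def mult.commute)
    qed
    moreover have "- E (r n) \<inter> \<Omega> = \<Omega> - E (r n)" for n by auto
    ultimately show ?thesis using r(1) by auto
  qed
qed

section \<open>From the energy to scalar functions\<close>

text \<open>The scalar core, in any dimension. The bounds on \<open>z\<close> and on the layer where
  \<open>\<bar>y\<bar>\<close> is below \<open>1/2\<close> drive the transition estimate in
  direction \<open>k\<close>. The bounds on \<open>g\<close> and on the distance of
  \<open>\<bar>y\<bar>\<close> from 1 drive the transversal one.\<close>

theorem scalar_phase_selection:
  fixes v y z :: "nat \<Rightarrow> real^'n::finite \<Rightarrow> real" and g :: "'n \<Rightarrow> nat \<Rightarrow> real^'n \<Rightarrow> real"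
    and h \<epsilon> \<delta> :: "nat \<Rightarrow> real" and C :: real
  assumes \<Omega>: "open \<Omega>" "connected \<Omega>" "emeasure lborel \<Omega> < \<infinity>" and C: "0 \<le> C"
    and vy: "\<And>n. borel_weak_deriv \<Omega> k (v n) (y n)" and yz: "\<And>n. borel_weak_deriv \<Omega> k (y n) (z n)"
    and vg: "\<And>i n. i \<noteq> k \<Longrightarrow> borel_weak_deriv \<Omega> i (v n) (g i n)"
    and h: "\<And>n. 0 < h n" "h \<longlonglongrightarrow> 0" and \<epsilon>: "\<And>n. 0 < \<epsilon> n" "\<epsilon> \<longlonglongrightarrow> 0"
    and z: "\<And>n. (\<integral>\<^sup>+x. ennreal ((z n x)\<^sup>2) \<partial>lborel) \<le> ennreal (C * (h n)\<^sup>2 / \<epsilon> n)"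
    and g: "\<And>i n. i \<noteq> k \<Longrightarrow> (\<integral>\<^sup>+x. ennreal ((g i n x)\<^sup>2) \<partial>lborel) \<le> ennreal C"
    and bad: "\<And>n. emeasure lborel {x \<in> \<Omega>. \<bar>y n x\<bar> < 1/2} \<le> ennreal (C * \<epsilon> n)"
    and \<delta>: "\<And>n. (\<integral>\<^sup>+x. indicator \<Omega> x * ennreal \<bar>\<bar>y n x\<bar> - 1\<bar> \<partial>lborel) \<le> ennreal (\<delta> n)"
      "\<And>n. 0 \<le> \<delta> n" "\<delta> \<longlonglongrightarrow> 0"
  shows "\<exists>r. strict_mono r \<and> ((\<lambda>n. emeasure lborel {x \<in> \<Omega>. 0 \<le> y (r n) x}) \<longlonglongrightarrow> 0 \<or>
     (\<lambda>n. emeasure lborel {x \<in> \<Omega>. y (r n) x < 0}) \<longlonglongrightarrow> 0)"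
proof -
  define E where "E n = {x. 0 \<le> y n x}" for n
  have ym[measurable]: "y n \<in> borel_measurable borel" for n
    using yz[of n] by (auto simp: borel_weak_deriv_def)
  have E: "E n \<in> sets borel" for n unfolding E_def by measurable
  have "\<exists>r. strict_mono r \<and> ((\<lambda>n. emeasure lborel (E (r n) \<inter> \<Omega>)) \<longlonglongrightarrow> 0 \<or>
     (\<lambda>n. emeasure lborel (\<Omega> - E (r n))) \<longlonglongrightarrow> 0)"
  proof (rule phase_selection[OF \<Omega> E])
    fix x0 assume "x0 \<in> \<Omega>"
    then obtain \<rho>' where \<rho>': "0 < \<rho>'" "ball x0 \<rho>' \<subseteq> \<Omega>" using \<Omega>(1) open_contains_ball by blast
    define m where "m = real CARD('n)"
    \<comment> \<open>For \<open>norm c < 2 * \<rho>\<close> the sum of the \<open>m\<close>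
      coordinates is at most \<open>2 * m * \<rho>\<close> in absolute value, so
      \<open>jump_vanishes_coords\<close> needs \<open>\<rho> * (1 + 4 * m) < \<rho>'\<close>; the
      extra 2 in the denominator makes this strict.\<close>
    define \<rho> where "\<rho> = \<rho>' / (2 * (1 + 4 * m))"
    have m: "0 \<le> m" by (simp add: m_def)
    have "0 < 1 + 4 * m" using m by simp
    then have \<rho>: "0 < \<rho>" "\<rho> * (1 + 4 * m) < \<rho>'" using \<rho>'(1)
      by (simp_all add: \<rho>_def pos_divide_less_eq)
    have axis: "jump_vanishes E x0 \<sigma> (s *\<^sub>R axis i 1)" if "0 \<le> s" "\<sigma> + s < \<rho>'" for \<sigma> s i
      using jump_axis_vanishes[OF \<Omega>(1) C vy yz vg h \<epsilon> z g bad \<delta> that \<rho>'(2), of i]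
      by (simp add: jump_vanishes_def E_def)
    have "(\<lambda>n. emeasure lborel (E n \<inter> ball x0 \<rho>) * emeasure lborel (ball x0 \<rho> - E n)) \<longlonglongrightarrow> 0"
    proof (rule phases_separate_if_jumps_vanish[OF E])
      fix c :: "real^'n" assume c: "norm c < 2 * \<rho>"
      have "(\<Sum>i\<in>UNIV. \<bar>c $ i\<bar>) \<le> (\<Sum>i\<in>(UNIV::'n set). 2 * \<rho>)"
        using c component_le_norm_cart[of c] by (intro sum_mono) (meson less_imp_le order_trans)
      then have "\<rho> + 2 * (\<Sum>i\<in>UNIV. \<bar>c $ i\<bar>) < \<rho>'"
        using \<rho>(2) by (simp add: m_def algebra_simps)
      from jump_vanishes_coords[where E = E and \<rho>' = \<rho>', OF E axis this]
      show "jump_vanishes E x0 \<rho> c" .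
    qed
    moreover have "ball x0 \<rho> \<subseteq> \<Omega>"
    proof (rule order.trans[OF subset_ball \<rho>'(2)])
      have "\<rho> * 1 \<le> \<rho> * (1 + 4 * m)" using \<rho>(1) m by (intro mult_left_mono) auto
      then show "\<rho> \<le> \<rho>'" using \<rho>(2) by simp
    qed
    ultimately show "\<exists>\<rho>>0. ball x0 \<rho> \<subseteq> \<Omega> \<and>
       (\<lambda>n. emeasure lborel (E n \<inter> ball x0 \<rho>) * emeasure lborel (ball x0 \<rho> - E n)) \<longlonglongrightarrow> 0"
      using \<rho>(1) by blast
  qed
  moreover have "E n \<inter> \<Omega> = {x \<in> \<Omega>. 0 \<le> y n x}" "\<Omega> - E n = {x \<in> \<Omega>. y n x < 0}" for n
    by (auto simp: E_def)
  ultimately show ?thesis by simp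
qed

text \<open>Sobolev functions are only Lebesgue measurable, and only on \<open>\<Omega>\<close>. A
  Borel representative extended by 0 moves all integrals to \<open>lborel\<close>, where Fubini and
  translations are at hand.\<close>

definition borel_version ::
  "'a::euclidean_space set \<Rightarrow> ('a \<Rightarrow> real) \<Rightarrow> ('a \<Rightarrow> real) \<Rightarrow> bool" where
  "borel_version \<Omega> f f' \<longleftrightarrow> f' \<in> borel_measurable borel \<and> (\<forall>x. x \<notin> \<Omega> \<longrightarrow> f' x = 0) \<and>
     (AE x in lborel. x \<in> \<Omega> \<longrightarrow> f' x = f x)"

lemma borel_version_exists:
  fixes f :: "'a::euclidean_space \<Rightarrow> real"
  assumes f: "f \<in> borel_measurable (lebesgue_on \<Omega>)" and \<Omega>: "open \<Omega>"
  shows "\<exists>f'. borel_version \<Omega> f f'"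
proof -
  have [measurable]: "\<Omega> \<in> sets borel" using \<Omega> by simp
  have "(\<lambda>x. if x \<in> \<Omega> then f x else 0) \<in> borel_measurable lebesgue"
    using f \<Omega> by (simp add: borel_measurable_if)
  then obtain g where g: "g \<in> borel_measurable lborel" "AE x in lborel. (if x \<in> \<Omega> then f x else 0) = g x"
    using completion_ex_borel_measurable_real by blast
  then have [measurable]: "g \<in> borel_measurable borel" by simp
  have "borel_version \<Omega> f (\<lambda>x. indicator \<Omega> x * g x)"
    unfolding borel_version_def
  proof (intro conjI)
    show "AE x in lborel. x \<in> \<Omega> \<longrightarrow> indicator \<Omega> x * g x = f x"
      using g(2) by eventually_elim auto
  qed auto
  then show ?thesis by blast
qed

lemma nn_integral_borel_version:
  assumes "borel_version \<Omega> f f'" and \<Omega>: "open \<Omega>"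
  shows "(\<integral>\<^sup>+x. indicator \<Omega> x * G (f' x) \<partial>lborel) = (\<integral>\<^sup>+x. G (f x) \<partial>lebesgue_on \<Omega>)"
proof -
  have "(\<integral>\<^sup>+x. G (f x) \<partial>lebesgue_on \<Omega>) = (\<integral>\<^sup>+x. G (f x) * indicator \<Omega> x \<partial>lborel)"
    using \<Omega> by (simp add: nn_integral_restrict_space nn_integral_completion)
  also have "\<dots> = (\<integral>\<^sup>+x. indicator \<Omega> x * G (f' x) \<partial>lborel)"
  proof (rule nn_integral_cong_AE)
    show "AE x in lborel. G (f x) * indicator \<Omega> x = indicator \<Omega> x * G (f' x)"
      using assms(1) unfolding borel_version_def
      by (auto elim!: eventually_mono simp: indicator_def)
  qed
  finally show ?thesis by simp
qed

lemma integral_borel_version: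
  fixes f :: "'a::euclidean_space \<Rightarrow> real"
  assumes v: "borel_version \<Omega> f f'" and \<Omega>: "open \<Omega>" and f: "f \<in> borel_measurable (lebesgue_on \<Omega>)"
    and [measurable]: "\<psi> \<in> borel_measurable borel"
  shows "(\<integral>x. \<psi> x * f x \<partial>lebesgue_on \<Omega>) = (\<integral>x. \<psi> x * f' x \<partial>lborel)"
proof -
  have [measurable]: "\<Omega> \<in> sets borel" using \<Omega> by simp
  have f'm[measurable]: "f' \<in> borel_measurable borel" using v by (simp add: borel_version_def)
  have 1: "(\<lambda>x. if x \<in> \<Omega> then f x else 0) \<in> borel_measurable lebesgue"
    using f \<Omega> by (simp add: borel_measurable_if)
  have \<psi>: "\<psi> \<in> borel_measurable lebesgue" "f' \<in> borel_measurable lebesgue"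
    by (auto intro: measurable_completion)
  have "(\<integral>x. \<psi> x * f x \<partial>lebesgue_on \<Omega>) = (\<integral>x. indicator \<Omega> x *\<^sub>R (\<psi> x * f x) \<partial>lebesgue)"
    using \<Omega> by (subst integral_restrict_space) auto
  also have "\<dots> = (\<integral>x. \<psi> x * (if x \<in> \<Omega> then f x else 0) \<partial>lebesgue)"
    by (rule Bochner_Integration.integral_cong) (auto simp: indicator_def)
  also have "\<dots> = (\<integral>x. \<psi> x * f' x \<partial>lebesgue)"
  proof (rule integral_cong_AE)
    show "(\<lambda>x. \<psi> x * (if x \<in> \<Omega> then f x else 0)) \<in> borel_measurable lebesgue"
      using \<psi>(1) 1 by (rule borel_measurable_times)
    show "(\<lambda>x. \<psi> x * f' x) \<in> borel_measurable lebesgue"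
      using \<psi> by (rule borel_measurable_times)
    have "AE x in lborel. \<psi> x * (if x \<in> \<Omega> then f x else 0) = \<psi> x * f' x"
      using v unfolding borel_version_def by (auto elim!: eventually_mono)
    then show "AE x in lebesgue. \<psi> x * (if x \<in> \<Omega> then f x else 0) = \<psi> x * f' x"
      by (rule AE_completion)
  qed
  also have "\<dots> = (\<integral>x. \<psi> x * f' x \<partial>lborel)" by (rule integral_completion) simp
  finally show ?thesis .
qed

text \<open>Outside the closed support a test function is locally 0, hence so is its derivative; a
  continuous function vanishing off a compact set is bounded.\<close>

lemma test_function_bounds:
  fixes \<phi> :: "real^'n::finite \<Rightarrow> real"
  assumes \<phi>: "\<phi> \<in> test_functions \<Omega>"
  shows "continuous_on UNIV \<phi>" "continuous_on UNIV (partial_deriv i \<phi>)"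
    "\<exists>M. \<forall>x. \<bar>\<phi> x\<bar> \<le> M" "\<exists>M. \<forall>x. \<bar>partial_deriv i \<phi> x\<bar> \<le> M"
proof -
  let ?K = "closure {x. \<phi> x \<noteq> 0}"
  have K: "compact ?K" using \<phi> by (simp add: test_functions_def)
  have Ck: "C_k k \<phi>" for k using \<phi> by (simp add: test_functions_def)
  show c: "continuous_on UNIV \<phi>" "continuous_on UNIV (partial_deriv i \<phi>)"
    using Ck[of 0] Ck[of "Suc 0"] by simp_all
  have bnd: "\<exists>M. \<forall>x. \<bar>\<psi> x\<bar> \<le> M" if "continuous_on UNIV \<psi>" "\<And>x. x \<notin> ?K \<Longrightarrow> \<psi> x = 0" for \<psi> :: "real^'n \<Rightarrow> real"
  proof -
    have "bounded (\<psi> ` ?K)"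
      using K that(1) by (intro compact_imp_bounded compact_continuous_image) (auto intro: continuous_on_subset)
    then obtain M where M: "\<And>x. x \<in> ?K \<Longrightarrow> \<bar>\<psi> x\<bar> \<le> M" by (auto simp: bounded_real)
    have "\<bar>\<psi> x\<bar> \<le> \<bar>M\<bar>" for x
      using M[of x] that(2)[of x] by (cases "x \<in> ?K") auto
    then show ?thesis by (intro exI[of _ "\<bar>M\<bar>"] allI)
  qed
  show "\<exists>M. \<forall>x. \<bar>\<phi> x\<bar> \<le> M" 
    by (rule bnd[OF c(1)]) (use closure_subset[of "{x. \<phi> x \<noteq> 0}"] in auto)
  show "\<exists>M. \<forall>x. \<bar>partial_deriv i \<phi> x\<bar> \<le> M"
  proof (rule bnd[OF c(2)])
    fix x assume x: "x \<notin> ?K"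
    have "((\<lambda>_. 0) has_derivative (\<lambda>_. 0)) (at x)" by simp
    then have "(\<phi> has_derivative (\<lambda>_. 0)) (at x)"
    proof (rule has_derivative_transform_within_open)
      show "open (- ?K)" by (rule open_Compl) simp
      show "x \<in> - ?K" using x by simp
      fix y assume "y \<in> - ?K"
      then show "0 = \<phi> y" using closure_subset[of "{x. \<phi> x \<noteq> 0}"] by auto
    qed
    then have "frechet_derivative \<phi> (at x) = (\<lambda>_. 0)" using frechet_derivative_at by metis
    then show "partial_deriv i \<phi> x = 0" by (simp add: partial_deriv_def)
  qed
qed

lemma Lp2_integrable:
  fixes f :: "'a::euclidean_space \<Rightarrow> 'b::euclidean_space"
  assumes f: "f \<in> Lp_on 2 \<Omega>" and \<Omega>: "open \<Omega>" "emeasure lborel \<Omega> < \<infinity>"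
  shows "integrable (lebesgue_on \<Omega>) f"
proof (rule Bochner_Integration.integrable_bound)
  have "emeasure lebesgue \<Omega> < \<infinity>" using \<Omega> by simp
  then have "finite_measure (lebesgue_on \<Omega>)"
    using \<Omega>(1) by (intro finite_measureI) (simp add: emeasure_restrict_space less_top)
  then have "integrable (lebesgue_on \<Omega>) (\<lambda>_. 1 :: real)"
    by (rule finite_measure.integrable_const)
  then show "integrable (lebesgue_on \<Omega>) (\<lambda>x. 1 + norm (f x) powr 2)"
    using f by (auto simp: Lp_on_def)
  show "f \<in> borel_measurable (lebesgue_on \<Omega>)" using f by (simp add: Lp_on_def)
  have "norm w \<le> 1 + (norm w)\<^sup>2" for w :: 'b
    using zero_le_power2[of "norm w - 1/2"] by (simp add: power2_eq_square algebra_simps)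
  then show "AE x in lebesgue_on \<Omega>. norm (f x) \<le> norm (1 + norm (f x) powr 2)"
    by (intro AE_I2) (simp add: powr_numeral)
qed

text \<open>Pairing with the fixed vector \<open>c\<close> passes through the integrals: on a domain
  of finite measure L2 functions are integrable, and test functions and their derivatives are
  bounded.\<close>

lemma borel_weak_derivI:
  fixes u w :: "real^'n::finite \<Rightarrow> 'b::euclidean_space"
  assumes wd: "has_weak_deriv \<Omega> i u w" and u: "u \<in> Lp_on 2 \<Omega>" and w: "w \<in> Lp_on 2 \<Omega>"
    and \<Omega>: "open \<Omega>" "emeasure lborel \<Omega> < \<infinity>"
    and f: "borel_version \<Omega> (\<lambda>x. u x \<bullet> c) f" and g: "borel_version \<Omega> (\<lambda>x. w x \<bullet> c) g"
  shows "borel_weak_deriv \<Omega> i f g"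
proof -
  have int: "integrable lborel f" if f: "borel_version \<Omega> (\<lambda>x. u x \<bullet> c) f" and u: "u \<in> Lp_on 2 \<Omega>"
    for u :: "real^'n \<Rightarrow> 'b" and f
  proof (rule integrableI_bounded)
    show "f \<in> borel_measurable lborel" using f by (simp add: borel_version_def)
    have "integrable (lebesgue_on \<Omega>) (\<lambda>x. u x \<bullet> c)" using Lp2_integrable[OF u \<Omega>] by simp
    then have fin: "(\<integral>\<^sup>+x. ennreal \<bar>u x \<bullet> c\<bar> \<partial>lebesgue_on \<Omega>) < \<infinity>"
      by (simp add: integrable_iff_bounded)
    have "(\<integral>\<^sup>+x. ennreal (norm (f x)) \<partial>lborel) = (\<integral>\<^sup>+x. indicator \<Omega> x * ennreal \<bar>f x\<bar> \<partial>lborel)"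
      by (rule nn_integral_cong) (use f in \<open>auto simp: borel_version_def indicator_def\<close>)
    also have "\<dots> = (\<integral>\<^sup>+x. ennreal \<bar>u x \<bullet> c\<bar> \<partial>lebesgue_on \<Omega>)"
      by (rule nn_integral_borel_version[OF f \<Omega>(1)])
    finally show "(\<integral>\<^sup>+x. ennreal (norm (f x)) \<partial>lborel) < \<infinity>" using fin by simp
  qed
  have slice: "(\<integral>x. \<psi> x *\<^sub>R u x \<partial>lebesgue_on \<Omega>) \<bullet> c = (\<integral>x. \<psi> x * f x \<partial>lborel)"
    if f: "borel_version \<Omega> (\<lambda>x. u x \<bullet> c) f" and u: "u \<in> Lp_on 2 \<Omega>"
      and \<psi>: "continuous_on UNIV \<psi>" "\<exists>M. \<forall>x. \<bar>\<psi> x\<bar> \<le> M"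
    for u :: "real^'n \<Rightarrow> 'b" and f \<psi>
  proof -
    obtain M where M: "\<And>x. \<bar>\<psi> x\<bar> \<le> M" using \<psi>(2) by blast
    have \<psi>m: "\<psi> \<in> borel_measurable borel" using \<psi>(1) by (rule borel_measurable_continuous_onI)
    have ui: "integrable (lebesgue_on \<Omega>) u" by (rule Lp2_integrable[OF u \<Omega>])
    have \<psi>m': "\<psi> \<in> borel_measurable (lebesgue_on \<Omega>)"
      using \<psi>m by (intro measurable_restrict_space1 measurable_completion) simp
    have "integrable (lebesgue_on \<Omega>) (\<lambda>x. \<psi> x *\<^sub>R u x)"
    proof (rule Bochner_Integration.integrable_bound)
      show "integrable (lebesgue_on \<Omega>) (\<lambda>x. M *\<^sub>R u x)" using ui by simp
      show "(\<lambda>x. \<psi> x *\<^sub>R u x) \<in> borel_measurable (lebesgue_on \<Omega>)"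
        using \<psi>m' ui by (intro borel_measurable_scaleR) auto
      show "AE x in lebesgue_on \<Omega>. norm (\<psi> x *\<^sub>R u x) \<le> norm (M *\<^sub>R u x)"
        using order.trans[OF M abs_ge_self] by (intro AE_I2) (auto intro!: mult_right_mono)
    qed
    then have "(\<integral>x. \<psi> x *\<^sub>R u x \<partial>lebesgue_on \<Omega>) \<bullet> c = (\<integral>x. (\<psi> x *\<^sub>R u x) \<bullet> c \<partial>lebesgue_on \<Omega>)"
      by (rule integral_inner_left[symmetric])
    also have "\<dots> = (\<integral>x. \<psi> x * (u x \<bullet> c) \<partial>lebesgue_on \<Omega>)" by simp
    also have "\<dots> = (\<integral>x. \<psi> x * f x \<partial>lborel)"
    proof (rule integral_borel_version[OF f \<Omega>(1) _ \<psi>m])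
      show "(\<lambda>x. u x \<bullet> c) \<in> borel_measurable (lebesgue_on \<Omega>)" using ui by auto
    qed
    finally show ?thesis .
  qed
  show ?thesis
    unfolding borel_weak_deriv_def
  proof (intro conjI ballI)
    show "integrable lborel f" "integrable lborel g" using int f g u w by blast+
    fix \<phi> assume \<phi>: "\<phi> \<in> test_functions \<Omega>"
    have "(\<integral>x. partial_deriv i \<phi> x *\<^sub>R u x \<partial>lebesgue_on \<Omega>) \<bullet> c = (- (\<integral>x. \<phi> x *\<^sub>R w x \<partial>lebesgue_on \<Omega>)) \<bullet> c"
      using wd \<phi> by (simp add: has_weak_deriv_def)
    then show "(\<integral>x. partial_deriv i \<phi> x * f x \<partial>lborel) = - (\<integral>x. \<phi> x * g x \<partial>lborel)"
      using slice[OF f u test_function_bounds(2,4)[OF \<phi>]] slice[OF g w test_function_bounds(1,3)[OF \<phi>]] by simp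
  qed
qed

section \<open>Coercivity of the potential\<close>

lemma infdist_pair: "infdist x {a, b} = min (dist x a) (dist x b)"
  by (simp add: infdist_def cInf_insert_If inf_min)

text \<open>Three regimes: \<open>hyp_near_wells\<close> close to the wells,
  \<open>hyp_growth\<close> far out, and in the compact region between them a positive minimum of
  the continuous \<open>W\<close>, which has no zeros there.\<close>

lemma potential_coercive:
  fixes W :: "real ^ 3 ^ 3 \<Rightarrow> real"
  assumes cont: "continuous_on UNIV W" and nonneg: "\<And>\<xi>. 0 \<le> W \<xi>"
    and zeros: "{\<xi>. W \<xi> = 0} = {A, B}" and growth: "hyp_growth W p" and near: "hyp_near_wells W A B p"
  obtains c where "0 < c" "\<And>\<xi>. c * infdist \<xi> {A, B} powr p \<le> W \<xi>"
proof -
  define d where "d \<xi> = infdist \<xi> {A, B}" for \<xi>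
  have d0: "0 \<le> d \<xi>" for \<xi> by (simp add: d_def infdist_nonneg)
  obtain C1 where p: "2 \<le> p" and C1: "0 < C1" "\<And>\<xi>. 1 / C1 * norm \<xi> powr p - C1 \<le> W \<xi>"
    using growth by (auto simp: hyp_growth_def)
  obtain \<rho> C2 where \<rho>: "0 < \<rho>" "0 < C2" "\<And>\<xi>. d \<xi> \<le> \<rho> \<Longrightarrow> 1 / C2 * d \<xi> powr p \<le> W \<xi>"
    using near unfolding hyp_near_wells_def d_def by blast
  \<comment> \<open>Beyond \<open>1 + norm A\<close> the distance to the wells is at most twice the
    norm. Beyond the second bound, subtracting \<open>C1\<close> costs at most half of
    \<open>norm \<xi> powr p / C1\<close>.\<close>
  define R where "R = max (1 + norm A) ((2 * C1 * C1) powr (1 / p))"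
  have R: "0 < R" "norm A \<le> R" "2 * C1 * C1 \<le> R powr p"
  proof -
    have "1 + norm A \<le> R" by (simp add: R_def)
    then show "0 < R" "norm A \<le> R" using norm_ge_zero[of A] by linarith+
    have "2 * C1 * C1 = ((2 * C1 * C1) powr (1 / p)) powr p" using C1(1) p by (simp add: powr_powr)
    also have "\<dots> \<le> R powr p" using p by (intro powr_mono2) (auto simp: R_def)
    finally show "2 * C1 * C1 \<le> R powr p" .
  qed
  have far: "1 / (2 * C1 * 2 powr p) * d \<xi> powr p \<le> W \<xi>" if "R \<le> norm \<xi>" for \<xi>
  proof -
    have "d \<xi> \<le> dist \<xi> A" by (simp add: d_def infdist_pair)
    also have "\<dots> \<le> norm \<xi> + norm A" by (simp add: dist_norm norm_triangle_ineq4)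
    also have "\<dots> \<le> 2 * norm \<xi>" using that R by simp
    finally have "d \<xi> powr p \<le> (2 * norm \<xi>) powr p" using p d0 by (intro powr_mono2) auto
    also have "\<dots> = 2 powr p * norm \<xi> powr p" by (simp add: powr_mult)
    finally have "1 / (2 * C1 * 2 powr p) * d \<xi> powr p \<le> 1 / (2 * C1 * 2 powr p) * (2 powr p * norm \<xi> powr p)"
      using C1(1) by (intro mult_left_mono) auto
    also have "\<dots> = norm \<xi> powr p / (2 * C1)" by simp
    also have "\<dots> \<le> 1 / C1 * norm \<xi> powr p - C1"
    proof -
      have "R powr p \<le> norm \<xi> powr p" using that R p by (intro powr_mono2) auto
      then have "2 * C1 * C1 \<le> norm \<xi> powr p" using R(3) by simp
      then show ?thesis using C1(1) by (simp add: field_simps)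
    qed
    finally show ?thesis using C1(2)[of \<xi>] by simp
  qed
  define K where "K = cball 0 R \<inter> {\<xi>. \<rho> \<le> d \<xi>}"
  have dc: "continuous_on UNIV d" unfolding d_def by (intro continuous_intros)
  have "closed {\<xi>. \<rho> \<le> d \<xi>}" by (intro closed_Collect_le continuous_intros dc)
  then have K: "compact K" unfolding K_def by (intro compact_Int_closed) auto
  have "\<exists>m>0. \<forall>\<xi>\<in>K. m \<le> W \<xi>"
  proof (cases "K = {}")
    case False
    obtain \<xi>0 where \<xi>0: "\<xi>0 \<in> K" "\<And>\<xi>. \<xi> \<in> K \<Longrightarrow> W \<xi>0 \<le> W \<xi>"
      using continuous_attains_inf[OF K False] cont continuous_on_subset by (metis subset_UNIV)
    have "d A = 0" "d B = 0" by (simp_all add: d_def)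
    then have "\<xi>0 \<notin> {A, B}" using \<xi>0(1) \<rho>(1) by (auto simp: K_def)
    then have "W \<xi>0 \<noteq> 0" using zeros by blast
    then have "0 < W \<xi>0" using nonneg[of \<xi>0] by simp
    then show ?thesis using \<xi>0 by blast
  qed (auto intro: exI[of _ 1])
  then obtain m where m: "0 < m" "\<And>\<xi>. \<xi> \<in> K \<Longrightarrow> m \<le> W \<xi>" by blast
  \<comment> \<open>One constant per regime; in the last one the distance to the wells is at most
    \<open>2 * R\<close>.\<close>
  define c where "c = min (1 / C2) (min (1 / (2 * C1 * 2 powr p)) (m / (2 * R) powr p))"
  have c: "0 < c" using \<rho>(2) C1(1) m(1) R(1) by (auto simp: c_def)
  have "c * d \<xi> powr p \<le> W \<xi>" for \<xi>
  proof -
    consider "d \<xi> \<le> \<rho>" | "R \<le> norm \<xi>" | "\<xi> \<in> K" by (auto simp: K_def dist_norm) linarith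
    then show ?thesis
    proof cases
      case 1
      have "c * d \<xi> powr p \<le> 1 / C2 * d \<xi> powr p" by (intro mult_right_mono) (auto simp: c_def)
      then show ?thesis using \<rho>(3)[OF 1] by simp
    next
      case 2
      have "c * d \<xi> powr p \<le> 1 / (2 * C1 * 2 powr p) * d \<xi> powr p" by (intro mult_right_mono) (auto simp: c_def)
      then show ?thesis using far[OF 2] by simp
    next
      case 3
      have "d \<xi> \<le> dist \<xi> A" by (simp add: d_def infdist_pair)
      also have "\<dots> \<le> norm \<xi> + norm A" by (simp add: dist_norm norm_triangle_ineq4)
      also have "\<dots> \<le> 2 * R" using 3 R by (simp add: K_def)
      finally have "d \<xi> powr p \<le> (2 * R) powr p" using p d0 by (intro powr_mono2) auto
      then have "c * d \<xi> powr p \<le> m / (2 * R) powr p * (2 * R) powr p"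
        using m(1) by (intro mult_mono) (auto simp: c_def)
      also have "\<dots> = m" using R(1) by simp
      finally show ?thesis using m(2)[OF 3] by simp
    qed
  qed
  then show ?thesis using that c by (simp add: d_def)
qed

section \<open>The cylinder, elementary integral bounds and convergence in
  \<open>Lp_on\<close>\<close>

lemma cylinder_properties:
  assumes "bounded \<omega>" "convex \<omega>" "open \<omega>"
  shows "open (cylinder \<omega>)" "convex (cylinder \<omega>)" "bounded (cylinder \<omega>)"
proof -
  define L :: "real^3 \<Rightarrow> real^2" where "L x = vector [x $ 1, x $ 2]" for x
  have Lc: "L x $ 1 = x $ 1" "L x $ 2 = x $ 2" for x by (simp_all add: L_def)
  have L: "linear L"
    by (rule linearI) (simp_all add: vec_eq_iff forall_2 Lc)
  have cyl: "cylinder \<omega> = L -` \<omega> \<inter> {x. - 1/2 < x $ 3 \<and> x $ 3 < 1/2}"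
    by (auto simp: cylinder_def L_def)
  have "open (L -` \<omega>)"
    using linear_continuous_on[OF L[unfolded linear_conv_bounded_linear], of UNIV] assms(3)
    by (simp add: continuous_on_open_vimage)
  moreover have "open {x::real^3. - 1/2 < x $ 3 \<and> x $ 3 < 1/2}"
    by (intro open_Collect_conj open_Collect_less continuous_intros)
  ultimately show "open (cylinder \<omega>)" unfolding cyl by (rule open_Int)
  have "convex {x::real^3. - 1/2 < x $ 3 \<and> x $ 3 < 1/2}"
  proof -
    have "{x::real^3. - 1/2 < x $ 3 \<and> x $ 3 < 1/2} = (\<lambda>x. x $ 3) -` {- 1/2<..<1/2}" by auto
    then show ?thesis by (simp add: convex_linear_vimage bounded_linear.linear[OF bounded_linear_vec_nth])
  qed
  then show "convex (cylinder \<omega>)"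
    unfolding cyl by (intro convex_Int convex_linear_vimage[OF L assms(2)])
  obtain M where M: "\<And>x. x \<in> \<omega> \<Longrightarrow> norm x \<le> M" using assms(1) bounded_iff by blast
  have "norm x \<le> M + M + 1/2" if "x \<in> cylinder \<omega>" for x
  proof -
    have "norm (L x) \<le> M" using that M by (simp add: cyl)
    moreover have "\<bar>x $ 1\<bar> \<le> norm (L x)" "\<bar>x $ 2\<bar> \<le> norm (L x)"
      using component_le_norm_cart[of "L x"] by (metis Lc)+
    moreover have "\<bar>x $ 3\<bar> \<le> 1/2" using that by (auto simp: cyl)
    moreover have "norm x \<le> \<bar>x $ 1\<bar> + \<bar>x $ 2\<bar> + \<bar>x $ 3\<bar>"
      using norm_le_l1_cart[of x] by (simp add: sum_3)
    ultimately show ?thesis by linarith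
  qed
  then show "bounded (cylinder \<omega>)" by (auto simp: bounded_iff)
qed

lemma powr_add_le:
  fixes x y p :: real
  assumes "0 \<le> x" "0 \<le> y" "0 \<le> p"
  shows "(x + y) powr p \<le> 2 powr p * (x powr p + y powr p)"
proof -
  have "(x + y) powr p \<le> (2 * max x y) powr p" using assms by (intro powr_mono2) auto
  also have "\<dots> = 2 powr p * max x y powr p" using assms by (intro powr_mult) 
  also have "\<dots> \<le> 2 powr p * (x powr p + y powr p)" by (intro mult_left_mono) (auto simp: max_def)
  finally show ?thesis .
qed

lemma nn_integral_affine_bound:
  fixes F G :: "'a \<Rightarrow> real" and m a b I :: real
  assumes m: "emeasure M (space M) = ennreal m" "0 \<le> m"
    and [measurable]: "F \<in> borel_measurable M" and F: "\<And>x. x \<in> space M \<Longrightarrow> 0 \<le> F x"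
    and I: "(\<integral>\<^sup>+x. ennreal (F x) \<partial>M) \<le> ennreal I" "0 \<le> I" and ab: "0 \<le> a" "0 \<le> b"
    and G: "\<And>x. x \<in> space M \<Longrightarrow> G x \<le> a + b * F x"
  shows "(\<integral>\<^sup>+x. ennreal (G x) \<partial>M) \<le> ennreal (a * m + b * I)"
proof -
  have "(\<integral>\<^sup>+x. ennreal (G x) \<partial>M) \<le> (\<integral>\<^sup>+x. ennreal a + ennreal b * ennreal (F x) \<partial>M)"
  proof (rule nn_integral_mono)
    fix x assume x: "x \<in> space M"
    have "ennreal (G x) \<le> ennreal (a + b * F x)" using G[OF x] by (rule ennreal_leI)
    then show "ennreal (G x) \<le> ennreal a + ennreal b * ennreal (F x)"
      using F[OF x] ab by (simp add: ennreal_plus ennreal_mult)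
  qed
  also have "\<dots> = ennreal a * ennreal m + ennreal b * (\<integral>\<^sup>+x. ennreal (F x) \<partial>M)"
    by (simp add: nn_integral_add nn_integral_cmult m(1))
  also have "\<dots> \<le> ennreal a * ennreal m + ennreal b * ennreal I"
    using I(1) by (intro add_left_mono mult_left_mono) auto
  also have "\<dots> = ennreal (a * m + b * I)" using ab m I(2) by (simp add: ennreal_plus ennreal_mult)
  finally show ?thesis .
qed

lemma Lp_convergesI:
  fixes f :: "nat \<Rightarrow> 'a::euclidean_space \<Rightarrow> 'b::euclidean_space"
  assumes p: "0 < p" and f: "\<And>n. f n \<in> Lp_on p \<Omega>" and g: "g \<in> Lp_on p \<Omega>"
    and lim: "(\<lambda>n. \<integral>\<^sup>+x. ennreal (norm (f n x - g x) powr p) \<partial>lebesgue_on \<Omega>) \<longlonglongrightarrow> 0"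
  shows "Lp_converges p \<Omega> f g"
proof -
  have m: "f n \<in> borel_measurable (lebesgue_on \<Omega>)" "g \<in> borel_measurable (lebesgue_on \<Omega>)" for n
    using f g by (auto simp: Lp_on_def)
  have "(LINT x|lebesgue_on \<Omega>. norm (f n x - g x) powr p) =
      enn2real (\<integral>\<^sup>+x. ennreal (norm (f n x - g x) powr p) \<partial>lebesgue_on \<Omega>)" for n
    using m by (intro integral_eq_nn_integral) auto
  moreover have "(\<lambda>n. enn2real (\<integral>\<^sup>+x. ennreal (norm (f n x - g x) powr p) \<partial>lebesgue_on \<Omega>)) \<longlonglongrightarrow> 0"
    by (rule tendsto_enn2real) (use lim in simp_all)
  ultimately have "(\<lambda>n. LINT x|lebesgue_on \<Omega>. norm (f n x - g x) powr p) \<longlonglongrightarrow> 0" by simp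
  then have "(\<lambda>n. Lp_norm p \<Omega> (\<lambda>x. f n x - g x)) \<longlonglongrightarrow> 0"
    unfolding Lp_norm_def by (rule tendsto_zero_powrI[OF _ tendsto_const]) (use p in auto)
  then show ?thesis using f g by (simp add: Lp_converges_def)
qed

lemma norm_column_le: "norm (column j M) \<le> norm M" for M :: "real^'n^'m"
  unfolding norm_vec_def[of M] norm_vec_def[of "column j M"]
  by (rule L2_set_mono) (auto simp: column_def component_le_norm_cart)

lemma wells_without_planar_part:
  assumes "hyp_wells W A B" and "planar_part A = planar_part B"
  shows "B = - A" "\<And>i. A $ i $ 1 = 0" "\<And>i. A $ i $ 2 = 0" "column 3 A \<noteq> 0"
proof -
  obtain a where a: "planar_part A = tensor a (axis 1 1)" "- planar_part B = tensor a (axis 1 1)"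
    and col: "column 3 A = - column 3 B" and ne: "A \<noteq> B"
    using assms(1) by (auto simp: hyp_wells_def)
  have "planar_part A = - planar_part A" using a assms(2) by simp
  then have "planar_part A $ i $ j = (- planar_part A) $ i $ j" for i j by metis
  then have "planar_part A $ i $ j = 0" for i j by (simp only: vector_uminus_component) simp
  then have zA: "planar_part A $ i $ j = 0" and zB: "planar_part B $ i $ j = 0" for i j
    unfolding assms(2)[symmetric] by blast+
  have pp: "planar_part M $ i $ 1 = M $ i $ 1" "planar_part M $ i $ 2 = M $ i $ 2" for M i
    by (simp_all add: planar_part_def)
  have z: "A $ i $ 1 = 0" "A $ i $ 2 = 0" "B $ i $ 1 = 0" "B $ i $ 2 = 0" for i
    using zA[of i 1] zA[of i 2] zB[of i 1] zB[of i 2] by (simp_all only: pp)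
  have c3: "A $ i $ 3 = - B $ i $ 3" for i
    using arg_cong[OF col, of "\<lambda>v. v $ i"] by (simp add: column_def)
  show B: "B = - A" using z c3 by (simp add: vec_eq_iff forall_3)
  show "\<And>i. A $ i $ 1 = 0" "\<And>i. A $ i $ 2 = 0" using z by simp_all
  show "column 3 A \<noteq> 0"
  proof
    assume c: "column 3 A = 0"
    have "A $ i $ 3 = 0" for i using arg_cong[OF c, of "\<lambda>v. v $ i"] by (simp add: column_def)
    then have "A = 0" using z by (simp add: vec_eq_iff forall_3)
    then show False using ne B by simp
  qed
qed

text \<open>Because \<open>A\<close> has only a third column, \<open>s\<close> is the coefficient of
  the projection of \<open>\<zeta>\<close> onto \<open>A\<close>. The squared distances to
  \<open>A\<close> and \<open>- A\<close> differ by \<open>4 * (\<zeta> \<bullet> A)\<close>, so the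
  sign of \<open>s\<close> tells the nearer well. Cauchy-Schwarz in the third column compares
  \<open>s\<close> with 1 or -1, and the other columns of \<open>\<zeta>\<close> are part of its
  difference to either well.\<close>

lemma phase_indicator:
  fixes A \<zeta> :: "real^3^3"
  assumes A: "\<And>i. A $ i $ 1 = 0" "\<And>i. A $ i $ 2 = 0" and b: "column 3 A \<noteq> 0"
  defines "s \<equiv> (column 3 \<zeta> \<bullet> column 3 A) / (norm (column 3 A))\<^sup>2"
  shows "0 \<le> s \<Longrightarrow> infdist \<zeta> {A, - A} = norm (\<zeta> - A)"
    and "s < 0 \<Longrightarrow> infdist \<zeta> {A, - A} = norm (\<zeta> - - A)"
    and "\<bar>\<bar>s\<bar> - 1\<bar> \<le> infdist \<zeta> {A, - A} / norm (column 3 A)"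
    and "j \<noteq> 3 \<Longrightarrow> norm (column j \<zeta>) \<le> infdist \<zeta> {A, - A}"
proof -
  define b where "b = column 3 A"
  have b0: "0 < norm b" using b by (simp add: b_def)
  have sb: "s * (norm b)\<^sup>2 = column 3 \<zeta> \<bullet> b" using b0 by (simp add: s_def b_def)
  have dot: "\<zeta> \<bullet> A = column 3 \<zeta> \<bullet> b"
    by (simp add: inner_vec_def sum_3 b_def column_def A)
  have sign: "0 \<le> s \<longleftrightarrow> 0 \<le> \<zeta> \<bullet> A"
    using b0 unfolding dot sb[symmetric] by (simp add: zero_le_mult_iff)
  have sq: "(norm (\<zeta> - A))\<^sup>2 = (norm (\<zeta> - - A))\<^sup>2 - 4 * (\<zeta> \<bullet> A)"
    by (simp add: power2_norm_eq_inner inner_diff inner_add inner_commute algebra_simps)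
  have inf: "infdist \<zeta> {A, - A} = min (norm (\<zeta> - A)) (norm (\<zeta> - - A))"
    by (simp add: infdist_pair dist_norm)
  have 1: "infdist \<zeta> {A, - A} = norm (\<zeta> - A)" if "0 \<le> s"
  proof -
    have "(norm (\<zeta> - A))\<^sup>2 \<le> (norm (\<zeta> - - A))\<^sup>2" using that sign sq by simp
    then have "norm (\<zeta> - A) \<le> norm (\<zeta> - - A)" by (rule power2_le_imp_le) simp
    then show ?thesis unfolding inf by simp
  qed
  have 2: "infdist \<zeta> {A, - A} = norm (\<zeta> - - A)" if "s < 0"
  proof -
    have "(norm (\<zeta> - - A))\<^sup>2 \<le> (norm (\<zeta> - A))\<^sup>2" using that sign sq by simp
    then have "norm (\<zeta> - - A) \<le> norm (\<zeta> - A)" by (rule power2_le_imp_le) simp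
    then show ?thesis unfolding inf by simp
  qed
  show "0 \<le> s \<Longrightarrow> infdist \<zeta> {A, - A} = norm (\<zeta> - A)" "s < 0 \<Longrightarrow> infdist \<zeta> {A, - A} = norm (\<zeta> - - A)"
    by (fact 1, fact 2)
  have proj: "\<bar>s - \<sigma>\<bar> * norm b \<le> norm (\<zeta> - \<sigma> *\<^sub>R A)" for \<sigma>
  proof -
    have "column 3 (\<zeta> - \<sigma> *\<^sub>R A) = column 3 \<zeta> - \<sigma> *\<^sub>R b"
      by (simp add: vec_eq_iff column_def b_def)
    moreover have "(column 3 \<zeta> - \<sigma> *\<^sub>R b) \<bullet> b = (s - \<sigma>) * (norm b)\<^sup>2"
      unfolding left_diff_distrib sb by (simp add: inner_diff_left power2_norm_eq_inner)
    ultimately have "\<bar>s - \<sigma>\<bar> * (norm b)\<^sup>2 = \<bar>column 3 (\<zeta> - \<sigma> *\<^sub>R A) \<bullet> b\<bar>"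
      by (simp add: abs_mult)
    also have "\<dots> \<le> norm (\<zeta> - \<sigma> *\<^sub>R A) * norm b"
      by (rule order.trans[OF Cauchy_Schwarz_ineq2]) (intro mult_right_mono norm_column_le, simp)
    finally have "\<bar>s - \<sigma>\<bar> * norm b * norm b \<le> norm (\<zeta> - \<sigma> *\<^sub>R A) * norm b"
      by (simp add: power2_eq_square mult.assoc)
    then show ?thesis using b0 by simp
  qed
  have "\<bar>\<bar>s\<bar> - 1\<bar> * norm b \<le> infdist \<zeta> {A, - A}"
  proof (cases "0 \<le> s")
    case True
    then show ?thesis using proj[of 1] 1 by simp
  next
    case False
    then have "\<bar>\<bar>s\<bar> - 1\<bar> = \<bar>s - (- 1)\<bar>" by simp
    then show ?thesis using proj[of "- 1"] 2 False by simp
  qed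
  then show "\<bar>\<bar>s\<bar> - 1\<bar> \<le> infdist \<zeta> {A, - A} / norm (column 3 A)"
    using b0 by (simp add: pos_le_divide_eq b_def)
  assume j: "j \<noteq> 3"
  then have "j = 1 \<or> j = 2" using exhaust_3[of j] by auto
  then have "column j (\<zeta> - A) = column j \<zeta>" "column j (\<zeta> - - A) = column j \<zeta>"
    using A by (auto simp: column_def vec_eq_iff)
  then show "norm (column j \<zeta>) \<le> infdist \<zeta> {A, - A}"
    unfolding inf using norm_column_le[of j "\<zeta> - A"] norm_column_le[of j "\<zeta> - - A"] by simp
qed

section \<open>Weak derivatives of \<open>H2\<close> functions and the energy\<close>

lemma H2_weak_derivs:
  assumes "u \<in> H2 \<Omega>"
  shows "u \<in> Lp_on 2 \<Omega>" "has_weak_deriv \<Omega> j u (weak_deriv \<Omega> j u)" "weak_deriv \<Omega> j u \<in> Lp_on 2 \<Omega>"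
    "has_weak_deriv \<Omega> i (weak_deriv \<Omega> j u) (weak_deriv2 \<Omega> i j u)" "weak_deriv2 \<Omega> i j u \<in> Lp_on 2 \<Omega>"
proof -
  show "u \<in> Lp_on 2 \<Omega>" "weak_deriv \<Omega> j u \<in> Lp_on 2 \<Omega>" "weak_deriv2 \<Omega> i j u \<in> Lp_on 2 \<Omega>"
    using assms by (auto simp: H2_def)
  have "\<exists>v. has_weak_deriv \<Omega> j u v" "\<exists>v. has_weak_deriv \<Omega> i (weak_deriv \<Omega> j u) v"
    using assms by (auto simp: H2_def)
  from this[THEN someI_ex] show "has_weak_deriv \<Omega> j u (weak_deriv \<Omega> j u)"
    "has_weak_deriv \<Omega> i (weak_deriv \<Omega> j u) (weak_deriv2 \<Omega> i j u)"
    unfolding weak_deriv_def by simp_all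
qed

lemma scaled_grad_measurable:
  assumes "u \<in> H2 \<Omega>"
  shows "scaled_grad \<Omega> h u \<in> borel_measurable (lebesgue_on \<Omega>)"
proof -
  have "weak_deriv \<Omega> j u \<in> borel_measurable (lebesgue_on \<Omega>)" for j
    using H2_weak_derivs(3)[OF assms] by (simp add: Lp_on_def)
  then have [measurable]: "(\<lambda>x. weak_deriv \<Omega> j u x $ i) \<in> borel_measurable (lebesgue_on \<Omega>)" for i j
    by (rule measurable_compose) (intro borel_measurable_continuous_onI continuous_on_component continuous_on_id)
  have "(\<lambda>x. scaled_grad \<Omega> h u x $ i $ j) \<in> borel_measurable (lebesgue_on \<Omega>)" for i j
    unfolding scaled_grad_def by simp
  then show ?thesis
    by (subst borel_measurable_euclidean_space) (auto simp: Basis_vec_def inner_axis)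
qed

lemma column_scaled_grad:
  "column j (scaled_grad \<Omega> h u x) = (if j = 3 then 1 / h else 1) *\<^sub>R weak_deriv \<Omega> j u x"
  by (simp add: vec_eq_iff column_def scaled_grad_def)

text \<open>All summands of the energy density are nonnegative, so each is bounded by the whole; the
  factors \<open>\<epsilon>\<close> and \<open>h ^ 4 / \<epsilon>\<close> undo its weight.\<close>

lemma energy_bounds:
  fixes W :: "real ^ 3 ^ 3 \<Rightarrow> real"
  assumes u: "u \<in> H2 \<Omega>" and W: "continuous_on UNIV W" "\<And>\<xi>. 0 \<le> W \<xi>"
    and h: "0 < h" and \<epsilon>: "0 < \<epsilon>" and E: "energy W \<Omega> h \<epsilon> u \<le> ennreal M" and M: "0 \<le> M"
  shows "(\<integral>\<^sup>+x. ennreal (W (scaled_grad \<Omega> h u x)) \<partial>lebesgue_on \<Omega>) \<le> ennreal (\<epsilon> * M)"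
    and "(\<integral>\<^sup>+x. ennreal ((norm (weak_deriv2 \<Omega> 3 3 u x))\<^sup>2) \<partial>lebesgue_on \<Omega>) \<le> ennreal (h ^ 4 / \<epsilon> * M)"
proof -
  define F where "F x = 1 / \<epsilon> * W (scaled_grad \<Omega> h u x) + \<epsilon> * scaled_hess_sq \<Omega> h u x" for x
  have Wm: "W \<in> borel_measurable borel" using W(1) by (rule borel_measurable_continuous_onI)
  have [measurable]: "(\<lambda>x. W (scaled_grad \<Omega> h u x)) \<in> borel_measurable (lebesgue_on \<Omega>)"
    using measurable_compose[OF scaled_grad_measurable[OF u] Wm] .
  have [measurable]: "weak_deriv2 \<Omega> i j u \<in> borel_measurable (lebesgue_on \<Omega>)" for i j
    using H2_weak_derivs(5)[OF u] by (simp add: Lp_on_def)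
  have Fm[measurable]: "F \<in> borel_measurable (lebesgue_on \<Omega>)"
    unfolding F_def[abs_def] scaled_hess_sq_def by measurable
  have scale: "(\<integral>\<^sup>+x. ennreal (G x) \<partial>lebesgue_on \<Omega>) \<le> ennreal (c * M)" if "0 \<le> c" "\<And>x. G x \<le> c * F x" for G c
  proof -
    have "(\<integral>\<^sup>+x. ennreal (G x) \<partial>lebesgue_on \<Omega>) \<le> (\<integral>\<^sup>+x. ennreal c * ennreal (F x) \<partial>lebesgue_on \<Omega>)"
      by (rule nn_integral_mono) (use that in \<open>auto simp flip: ennreal_mult' intro!: ennreal_leI\<close>)
    also have "\<dots> = ennreal c * (\<integral>\<^sup>+x. ennreal (F x) \<partial>lebesgue_on \<Omega>)"
      by (rule nn_integral_cmult) measurable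
    also have "(\<integral>\<^sup>+x. ennreal (F x) \<partial>lebesgue_on \<Omega>) = energy W \<Omega> h \<epsilon> u"
      by (simp add: energy_def F_def)
    also have "ennreal c * energy W \<Omega> h \<epsilon> u \<le> ennreal c * ennreal M" using E by (rule mult_left_mono) simp
    finally show ?thesis using that M by (simp add: ennreal_mult)
  qed
  have hess: "1 / h ^ 4 * (norm (weak_deriv2 \<Omega> 3 3 u x))\<^sup>2 \<le> scaled_hess_sq \<Omega> h u x" for x
    unfolding scaled_hess_sq_def using h by (simp add: sum_nonneg)
  have hess0: "0 \<le> scaled_hess_sq \<Omega> h u x" for x
    by (rule order.trans[OF _ hess]) (use h in simp)
  show "(\<integral>\<^sup>+x. ennreal (W (scaled_grad \<Omega> h u x)) \<partial>lebesgue_on \<Omega>) \<le> ennreal (\<epsilon> * M)"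
  proof (rule scale)
    fix x
    have "W (scaled_grad \<Omega> h u x) = \<epsilon> * (1 / \<epsilon> * W (scaled_grad \<Omega> h u x))" using \<epsilon> by simp
    also have "\<dots> \<le> \<epsilon> * F x" using \<epsilon> hess0 by (intro mult_left_mono) (auto simp: F_def)
    finally show "W (scaled_grad \<Omega> h u x) \<le> \<epsilon> * F x" .
  qed (use \<epsilon> in simp)
  show "(\<integral>\<^sup>+x. ennreal ((norm (weak_deriv2 \<Omega> 3 3 u x))\<^sup>2) \<partial>lebesgue_on \<Omega>) \<le> ennreal (h ^ 4 / \<epsilon> * M)"
  proof (rule scale)
    fix x
    have "(norm (weak_deriv2 \<Omega> 3 3 u x))\<^sup>2 = h ^ 4 / \<epsilon> * (\<epsilon> * (1 / h ^ 4 * (norm (weak_deriv2 \<Omega> 3 3 u x))\<^sup>2))"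
      using \<epsilon> h by simp
    also have "\<dots> \<le> h ^ 4 / \<epsilon> * (\<epsilon> * scaled_hess_sq \<Omega> h u x)"
      using \<epsilon> h hess by (intro mult_left_mono) auto
    also have "\<dots> \<le> h ^ 4 / \<epsilon> * F x"
      using \<epsilon> h W(2) by (intro mult_left_mono) (auto simp: F_def)
    finally show "(norm (weak_deriv2 \<Omega> 3 3 u x))\<^sup>2 \<le> h ^ 4 / \<epsilon> * F x" .
  qed (use \<epsilon> h in simp)
qed

theorem theorem6p9:
  fixes \<omega> :: "(real ^ 2) set"
    and W :: "real ^ 3 ^ 3 \<Rightarrow> real"
    and A B :: "real ^ 3 ^ 3"
    and p :: real
    and h \<epsilon> :: "nat \<Rightarrow> real"
    and u :: "nat \<Rightarrow> real ^ 3 \<Rightarrow> real ^ 3"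
  assumes "bounded \<omega>" and "convex \<omega>" and "open \<omega>"
    and "continuous_on UNIV W" and "\<And>\<xi>. W \<xi> \<ge> 0"
    and "hyp_wells W A B" and "hyp_growth W p" and "hyp_near_wells W A B p"
    and "planar_part A = planar_part B"
    and "\<And>n. h n > 0" and "h \<longlonglongrightarrow> 0"
    and "\<And>n. \<epsilon> n > 0" and "\<epsilon> \<longlonglongrightarrow> 0"
    and "bdd_above (range (\<lambda>n. \<epsilon> n / h n powr p))"
    and "\<And>n. u n \<in> H2 (cylinder \<omega>)"
    and "(SUP n. energy W (cylinder \<omega>) (h n) (\<epsilon> n) (u n)) < \<infinity>"
  shows "\<exists>r :: nat \<Rightarrow> nat. \<exists>\<xi>\<^sub>0 \<in> {A, B}. strict_mono r \<and>
           Lp_converges p (cylinder \<omega>)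
             (\<lambda>n. scaled_grad (cylinder \<omega>) (h (r n)) (u (r n))) (\<lambda>_. \<xi>\<^sub>0)"
proof -
  note hp = assms(10) and ep = assms(12) and uH = assms(15)
  define \<Omega> where "\<Omega> = cylinder \<omega>"
  have \<Omega>: "open \<Omega>" "connected \<Omega>" "emeasure lborel \<Omega> < \<infinity>"
    using cylinder_properties[OF assms(1-3)] convex_connected emeasure_bounded_finite by (auto simp: \<Omega>_def)
  define \<Lambda> where "\<Lambda> = lebesgue_on \<Omega>"
  obtain m where m: "emeasure \<Lambda> (space \<Lambda>) = ennreal m" "0 \<le> m"
  proof -
    have "emeasure \<Lambda> (space \<Lambda>) = emeasure lborel \<Omega>"
      using \<Omega>(1) by (simp add: \<Lambda>_def emeasure_restrict_space)
    then show thesis using that \<Omega>(3) by (cases "emeasure lborel \<Omega>") auto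
  qed
  note A0 = wells_without_planar_part[OF assms(6,9)]
  define b where "b = column 3 A"
  define \<beta> where "\<beta> = norm b"
  have \<beta>: "0 < \<beta>" using A0(4) by (simp add: \<beta>_def b_def)
  have p: "2 \<le> p" using assms(7) by (simp add: hyp_growth_def)
  have zeros: "{\<xi>. W \<xi> = 0} = {A, B}" using assms(6) by (simp add: hyp_wells_def)
  define d where "d \<zeta> = infdist \<zeta> {A, - A}" for \<zeta>
  have d0: "0 \<le> d \<zeta>" for \<zeta> by (simp add: d_def infdist_nonneg)
  obtain c where c: "0 < c" "\<And>\<zeta>. c * d \<zeta> powr p \<le> W \<zeta>"
    using potential_coercive[OF assms(4,5) zeros assms(7,8)] unfolding d_def A0(1) by metis
  define s where "s \<zeta> = (column 3 \<zeta> \<bullet> b) / \<beta>\<^sup>2" for \<zeta> :: "real^3^3"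
  have dA: "d \<zeta> = norm (\<zeta> - A)" if "0 \<le> s \<zeta>" for \<zeta>
    using phase_indicator(1)[OF A0(2,3,4), of \<zeta>] that by (simp add: d_def s_def b_def \<beta>_def)
  have dB: "d \<zeta> = norm (\<zeta> - - A)" if "s \<zeta> < 0" for \<zeta>
    using phase_indicator(2)[OF A0(2,3,4), of \<zeta>] that by (simp add: d_def s_def b_def \<beta>_def)
  have ds: "\<bar>\<bar>s \<zeta>\<bar> - 1\<bar> \<le> d \<zeta> / \<beta>" for \<zeta>
    using phase_indicator(3)[OF A0(2,3,4), of \<zeta>] by (simp add: d_def s_def b_def \<beta>_def)
  have dcol: "norm (column j \<zeta>) \<le> d \<zeta>" if "j \<noteq> 3" for j \<zeta>
    using phase_indicator(4)[OF A0(2,3,4) that, of \<zeta>] by (simp add: d_def)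
  have dA_le: "norm (\<zeta> - A) \<le> d \<zeta> + 2 * norm A" "norm (\<zeta> - - A) \<le> d \<zeta> + 2 * norm A" "norm \<zeta> \<le> d \<zeta> + norm A" for \<zeta>
  proof -
    have double: "norm (A + A) \<le> 2 * norm A" using norm_triangle_ineq[of A A] by simp
    have eq: "\<zeta> - A = (\<zeta> - - A) - (A + A)" "\<zeta> - - A = (\<zeta> - A) + (A + A)" by simp_all
    have "norm (\<zeta> - A) \<le> norm (\<zeta> - - A) + norm (A + A)"
      by (subst eq(1)) (rule norm_triangle_ineq4)
    moreover have "norm (\<zeta> - - A) \<le> norm (\<zeta> - A) + norm (A + A)"
      by (subst eq(2)) (rule norm_triangle_ineq)
    ultimately have "norm (\<zeta> - A) \<le> norm (\<zeta> - - A) + 2 * norm A"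
      "norm (\<zeta> - - A) \<le> norm (\<zeta> - A) + 2 * norm A" using double by simp_all
    moreover have "norm \<zeta> \<le> norm (\<zeta> - A) + norm A" "norm \<zeta> \<le> norm (\<zeta> - - A) + norm A"
      using norm_triangle_ineq[of "\<zeta> - A" A] norm_triangle_ineq[of "\<zeta> - - A" "- A"] by simp_all
    ultimately show "norm (\<zeta> - A) \<le> d \<zeta> + 2 * norm A" "norm (\<zeta> - - A) \<le> d \<zeta> + 2 * norm A" "norm \<zeta> \<le> d \<zeta> + norm A"
      using dA[of \<zeta>] dB[of \<zeta>] norm_ge_zero[of A] by (cases "0 \<le> s \<zeta>"; simp)+
  qed

  \<comment> \<open>Energy bounds along the sequence and the scalar functions\<close>
  define \<xi> where "\<xi> n = scaled_grad \<Omega> (h n) (u n)" for n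
  note u = H2_weak_derivs[OF uH[folded \<Omega>_def]]
  have \<xi>m[measurable]: "\<xi> n \<in> borel_measurable \<Lambda>" for n
    unfolding \<xi>_def \<Lambda>_def by (rule scaled_grad_measurable[OF uH[folded \<Omega>_def]])
  have dm[measurable]: "d \<in> borel_measurable borel"
    unfolding d_def[abs_def] by (intro borel_measurable_continuous_onI continuous_intros)
  obtain K where K: "\<And>n. \<epsilon> n / h n powr p \<le> K"
    using assms(14) by (auto simp: bdd_above_def)
  have K0: "0 \<le> K" using order.trans[OF _ K[of 0]] ep[of 0] by simp
  obtain M where M: "0 \<le> M" "\<And>n. energy W \<Omega> (h n) (\<epsilon> n) (u n) \<le> ennreal M"
  proof -
    obtain M where M: "0 \<le> M" "(SUP n. energy W \<Omega> (h n) (\<epsilon> n) (u n)) = ennreal M"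
      using assms(16) unfolding \<Omega>_def by (cases "SUP n. energy W (cylinder \<omega>) (h n) (\<epsilon> n) (u n)") auto
    have "energy W \<Omega> (h n) (\<epsilon> n) (u n) \<le> ennreal M" for n
      unfolding M(2)[symmetric] by (rule SUP_upper) simp
    then show thesis using that M(1) by blast
  qed
  note EB = energy_bounds[OF uH[folded \<Omega>_def] assms(4,5) hp ep M(2,1), folded \<Lambda>_def \<xi>_def]
  define k where "k = M / c"
  have k0: "0 \<le> k" using M(1) c(1) by (simp add: k_def)
  have Wm: "W \<in> borel_measurable borel" using assms(4) by (rule borel_measurable_continuous_onI)
  \<comment> \<open>Coercivity and the energy bound make the distance to the wells of order
    \<open>\<epsilon> n\<close> in the \<open>p\<close>-th power; \<open>affine\<close> feeds every
    pointwise bound by this quantity into an integral bound.\<close>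
  have dp: "(\<integral>\<^sup>+x. ennreal (d (\<xi> n x) powr p) \<partial>\<Lambda>) \<le> ennreal (k * \<epsilon> n)" for n
  proof -
    have "(\<integral>\<^sup>+x. ennreal (d (\<xi> n x) powr p) \<partial>\<Lambda>) \<le> ennreal (0 * m + 1 / c * (\<epsilon> n * M))"
    proof (rule nn_integral_affine_bound[OF m _ _ EB(1)])
      show "(\<lambda>x. W (\<xi> n x)) \<in> borel_measurable \<Lambda>" using measurable_compose[OF \<xi>m Wm] .
      show "d (\<xi> n x) powr p \<le> 0 + 1 / c * W (\<xi> n x)" for x
        using c by (simp add: field_simps)
    qed (use M(1) ep[of n] c(1) assms(5) in auto)
    then show ?thesis by (simp add: k_def mult.commute)
  qed
  have dpm[measurable]: "(\<lambda>x. d (\<xi> n x) powr p) \<in> borel_measurable \<Lambda>" for n by measurable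
  have affine: "(\<integral>\<^sup>+x. ennreal (G x) \<partial>\<Lambda>) \<le> ennreal (a * m + t * (k * \<epsilon> n))"
    if "0 \<le> a" "0 \<le> t" "\<And>x. G x \<le> a + t * d (\<xi> n x) powr p" for G a t n
    by (rule nn_integral_affine_bound[OF m dpm _ dp]) (use that k0 ep[of n] in auto)
  \<comment> \<open>Pairing \<open>u n\<close> with \<open>e n\<close> gives the scalar
    \<open>v\<close>. As the third column of the scaled gradient is \<open>1 / h n\<close> times the
    third derivative, the vertical derivative of \<open>v\<close> is the phase coordinate
    \<open>s (\<xi> n x)\<close>.\<close>
  define e where "e n = (1 / (h n * \<beta>\<^sup>2)) *\<^sub>R b" for n
  have norm_e: "norm (e n) = 1 / (h n * \<beta>)" for n
    using hp[of n] \<beta> by (simp add: e_def \<beta>_def[symmetric] power2_eq_square)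
  have se: "weak_deriv \<Omega> 3 (u n) x \<bullet> e n = s (\<xi> n x)" for n x
    by (simp add: s_def \<xi>_def column_scaled_grad e_def)
  have version: "\<exists>f. borel_version \<Omega> (\<lambda>x. w x \<bullet> e n) f" if "w \<in> Lp_on 2 \<Omega>" for w n
  proof (rule borel_version_exists[OF _ \<Omega>(1)])
    show "(\<lambda>x. w x \<bullet> e n) \<in> borel_measurable (lebesgue_on \<Omega>)"
      using that by (auto simp: Lp_on_def)
  qed
  have "\<exists>f. \<forall>n. borel_version \<Omega> (\<lambda>x. u n x \<bullet> e n) (f n)"
    by (intro choice allI version u)
  then obtain v where v: "\<And>n. borel_version \<Omega> (\<lambda>x. u n x \<bullet> e n) (v n)" by blast
  have "\<exists>f. \<forall>i. \<forall>n. borel_version \<Omega> (\<lambda>x. weak_deriv \<Omega> i (u n) x \<bullet> e n) (f i n)"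
    by (intro choice allI version u)
  then obtain g where g: "\<And>i n. borel_version \<Omega> (\<lambda>x. weak_deriv \<Omega> i (u n) x \<bullet> e n) (g i n)" by blast
  have "\<exists>f. \<forall>n. borel_version \<Omega> (\<lambda>x. weak_deriv2 \<Omega> 3 3 (u n) x \<bullet> e n) (f n)"
    by (intro choice allI version u)
  then obtain z where z: "\<And>n. borel_version \<Omega> (\<lambda>x. weak_deriv2 \<Omega> 3 3 (u n) x \<bullet> e n) (z n)" by blast
  define y where "y = g 3"
  have y: "borel_version \<Omega> (\<lambda>x. s (\<xi> n x)) (y n)" for n
    using g[of 3 n] by (simp add: y_def se)
  have square: "(\<integral>\<^sup>+x. ennreal ((f x)\<^sup>2) \<partial>lborel) = (\<integral>\<^sup>+x. ennreal ((w x)\<^sup>2) \<partial>\<Lambda>)"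
    if "borel_version \<Omega> w f" for w f
  proof -
    have "(\<integral>\<^sup>+x. ennreal ((f x)\<^sup>2) \<partial>lborel) = (\<integral>\<^sup>+x. indicator \<Omega> x * ennreal ((f x)\<^sup>2) \<partial>lborel)"
      by (rule nn_integral_cong) (use that in \<open>auto simp: borel_version_def indicator_def\<close>)
    then show ?thesis using nn_integral_borel_version[OF that \<Omega>(1), of "\<lambda>t. ennreal (t\<^sup>2)"] by (simp add: \<Lambda>_def)
  qed
  have level: "emeasure lborel {x \<in> \<Omega>. P (y n x)} = (\<integral>\<^sup>+x. indicator {t. P t} (s (\<xi> n x)) \<partial>\<Lambda>)"
    if "Measurable.pred borel P" for P n
  proof -
    have [measurable]: "y n \<in> borel_measurable borel" using y[of n] by (simp add: borel_version_def)
    have [measurable]: "\<Omega> \<in> sets borel" using \<Omega>(1) by simp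
    note that[measurable]
    have "emeasure lborel {x \<in> \<Omega>. P (y n x)} = (\<integral>\<^sup>+x. indicator {x \<in> \<Omega>. P (y n x)} x \<partial>lborel)"
      by (rule nn_integral_indicator[symmetric]) measurable
    also have "\<dots> = (\<integral>\<^sup>+x. indicator \<Omega> x * indicator {t. P t} (y n x) \<partial>lborel)"
      by (rule nn_integral_cong) (auto simp: indicator_def)
    finally show ?thesis
      using nn_integral_borel_version[OF y \<Omega>(1), of "indicator {t. P t}" n] by (simp add: \<Lambda>_def)
  qed
  \<comment> \<open>One summand for each of three bounds: the second vertical derivative, the
    in-plane derivatives, and the measure of the transition layer. In that layer the distance to the
    wells is at least \<open>\<beta> / 2\<close>, hence the factor
    \<open>(2 / \<beta>) powr p\<close>.\<close>
  define C where "C = M / \<beta>\<^sup>2 + (m + K * k) / \<beta>\<^sup>2 + (2 / \<beta>) powr p * k"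
  have C0: "0 \<le> M / \<beta>\<^sup>2" "0 \<le> (m + K * k) / \<beta>\<^sup>2" "0 \<le> (2 / \<beta>) powr p * k"
    using M(1) m(2) K0 k0 by auto
  then have C: "0 \<le> C" "M / \<beta>\<^sup>2 \<le> C" "(m + K * k) / \<beta>\<^sup>2 \<le> C" "(2 / \<beta>) powr p * k \<le> C"
    by (simp_all add: C_def)
  \<comment> \<open>Young-type splitting \<open>d \<le> \<eta> + \<eta> powr (1 - p) * d powr p\<close> with \<open>\<eta> = \<epsilon> powr (1 / p)\<close>.\<close>
  define \<delta> where "\<delta> n = (m + k) / \<beta> * \<epsilon> n powr (1 / p)" for n
  have "\<exists>r. strict_mono r \<and> ((\<lambda>n. emeasure lborel {x \<in> \<Omega>. 0 \<le> y (r n) x}) \<longlonglongrightarrow> 0 \<or>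
     (\<lambda>n. emeasure lborel {x \<in> \<Omega>. y (r n) x < 0}) \<longlonglongrightarrow> 0)"
  proof (rule scalar_phase_selection[OF \<Omega> C(1), where k = 3 and v = v and z = z and g = g and h = h and \<epsilon> = \<epsilon> and \<delta> = \<delta>])
    show "borel_weak_deriv \<Omega> 3 (v n) (y n)" for n
      unfolding y_def by (rule borel_weak_derivI[OF u(2) u(1) u(3) \<Omega>(1,3) v g])
    show "borel_weak_deriv \<Omega> i (v n) (g i n)" for i n
      by (rule borel_weak_derivI[OF u(2) u(1) u(3) \<Omega>(1,3) v g])
    show "borel_weak_deriv \<Omega> 3 (y n) (z n)" for n
      unfolding y_def by (rule borel_weak_derivI[OF u(4) u(3) u(5) \<Omega>(1,3) g z])
    show "(\<integral>\<^sup>+x. ennreal ((z n x)\<^sup>2) \<partial>lborel) \<le> ennreal (C * (h n)\<^sup>2 / \<epsilon> n)" for n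
    proof -
      have [measurable]: "weak_deriv2 \<Omega> 3 3 (u n) \<in> borel_measurable \<Lambda>"
        using u(5)[of 3 3 n] by (simp add: Lp_on_def \<Lambda>_def)
      \<comment> \<open>The factor \<open>(norm (e n))\<^sup>2\<close> is
        \<open>1 / (h n * \<beta>)\<^sup>2\<close> and lowers the power of \<open>h n\<close> in the
        energy bound from 4 to 2.\<close>
      have "(\<integral>\<^sup>+x. ennreal ((weak_deriv2 \<Omega> 3 3 (u n) x \<bullet> e n)\<^sup>2) \<partial>\<Lambda>)
          \<le> ennreal (0 * m + (norm (e n))\<^sup>2 * (h n ^ 4 / \<epsilon> n * M))"
      proof (rule nn_integral_affine_bound[OF m _ _ EB(2)])
        fix x
        have "(weak_deriv2 \<Omega> 3 3 (u n) x \<bullet> e n)\<^sup>2 \<le> (norm (weak_deriv2 \<Omega> 3 3 (u n) x) * norm (e n))\<^sup>2"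
          by (rule power2_le_iff_abs_le[THEN iffD2]) (auto intro: Cauchy_Schwarz_ineq2)
        then show "(weak_deriv2 \<Omega> 3 3 (u n) x \<bullet> e n)\<^sup>2 \<le> 0 + (norm (e n))\<^sup>2 * (norm (weak_deriv2 \<Omega> 3 3 (u n) x))\<^sup>2"
          by (simp add: power_mult_distrib mult.commute)
      qed (use M(1) ep[of n] hp[of n] in auto)
      also have "\<dots> = ennreal (M / \<beta>\<^sup>2 * ((h n)\<^sup>2 / \<epsilon> n))"
        using hp[of n] \<beta> by (simp add: norm_e power_divide power_mult_distrib field_simps power4_eq_xxxx power2_eq_square)
      also have "\<dots> \<le> ennreal (C * ((h n)\<^sup>2 / \<epsilon> n))"
        using C(2) ep[of n] by (intro ennreal_leI mult_right_mono) auto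
      finally show ?thesis using square[OF z] by simp
    qed
    show "(\<integral>\<^sup>+x. ennreal ((g i n x)\<^sup>2) \<partial>lborel) \<le> ennreal C" if i: "i \<noteq> 3" for i n
    proof -
      have "(\<integral>\<^sup>+x. ennreal ((weak_deriv \<Omega> i (u n) x \<bullet> e n)\<^sup>2) \<partial>\<Lambda>)
          \<le> ennreal (1 / \<beta>\<^sup>2 * m + 1 / (\<beta>\<^sup>2 * h n powr p) * (k * \<epsilon> n))"
      proof (rule affine)
        fix x
        \<comment> \<open>Since \<open>p\<close> is at least 2, \<open>t\<^sup>2\<close> is at most
          \<open>1 + t powr p\<close>. The integral of \<open>t powr p\<close> is at most
          \<open>k * \<epsilon> n / h n powr p\<close>, and this ratio is where the bound
          \<open>K\<close> on \<open>\<epsilon> n / h n powr p\<close> enters.\<close>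
        define t where "t = norm (weak_deriv \<Omega> i (u n) x) / h n"
        have t: "0 \<le> t" using hp[of n] by (simp add: t_def)
        have "norm (weak_deriv \<Omega> i (u n) x) \<le> d (\<xi> n x)"
          using dcol[OF i, of "\<xi> n x"] i by (simp add: \<xi>_def column_scaled_grad)
        then have tp: "t powr p \<le> d (\<xi> n x) powr p / h n powr p"
          using hp[of n] p by (auto simp: t_def powr_divide intro!: divide_right_mono powr_mono2)
        have "t\<^sup>2 \<le> 1 + t powr p"
        proof (cases "t \<le> 1")
          case True
          then have "t\<^sup>2 \<le> 1" using t by (simp add: power_le_one)
          then show ?thesis by (simp add: add_increasing2)
        next
          case False
          then have "t powr 2 \<le> t powr p" using p by (intro powr_mono) auto
          then show ?thesis using False by (simp add: powr_numeral)
        qed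
        then have t2: "t\<^sup>2 \<le> 1 + d (\<xi> n x) powr p / h n powr p" using tp by simp
        have "(weak_deriv \<Omega> i (u n) x \<bullet> e n)\<^sup>2 \<le> (norm (weak_deriv \<Omega> i (u n) x) * norm (e n))\<^sup>2"
          by (rule power2_le_iff_abs_le[THEN iffD2]) (auto intro: Cauchy_Schwarz_ineq2)
        also have "\<dots> = t\<^sup>2 / \<beta>\<^sup>2" by (simp add: norm_e t_def power_divide power_mult_distrib)
        also have "\<dots> \<le> (1 + d (\<xi> n x) powr p / h n powr p) / \<beta>\<^sup>2" using t2 by (rule divide_right_mono) simp
        also have "\<dots> = 1 / \<beta>\<^sup>2 + 1 / (\<beta>\<^sup>2 * h n powr p) * d (\<xi> n x) powr p"
          by (simp add: add_divide_distrib mult.commute)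
        finally show "(weak_deriv \<Omega> i (u n) x \<bullet> e n)\<^sup>2 \<le> 1 / \<beta>\<^sup>2 + 1 / (\<beta>\<^sup>2 * h n powr p) * d (\<xi> n x) powr p" .
      qed auto
      also have "\<dots> \<le> ennreal C"
      proof (rule ennreal_leI)
        have "1 / \<beta>\<^sup>2 * m + 1 / (\<beta>\<^sup>2 * h n powr p) * (k * \<epsilon> n) = (m + (\<epsilon> n / h n powr p) * k) / \<beta>\<^sup>2"
          by (simp add: add_divide_distrib mult.commute)
        also have "\<dots> \<le> (m + K * k) / \<beta>\<^sup>2"
          using K[of n] k0 by (intro divide_right_mono add_left_mono mult_right_mono) auto
        finally show "1 / \<beta>\<^sup>2 * m + 1 / (\<beta>\<^sup>2 * h n powr p) * (k * \<epsilon> n) \<le> C" using C(3) by simp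
      qed
      finally show ?thesis using square[OF g] by simp
    qed
    show "emeasure lborel {x \<in> \<Omega>. \<bar>y n x\<bar> < 1 / 2} \<le> ennreal (C * \<epsilon> n)" for n
    proof -
      have "emeasure lborel {x \<in> \<Omega>. \<bar>y n x\<bar> < 1 / 2} = (\<integral>\<^sup>+x. indicator {t. \<bar>t\<bar> < 1 / 2} (s (\<xi> n x)) \<partial>\<Lambda>)"
        by (rule level) measurable
      also have "\<dots> = (\<integral>\<^sup>+x. ennreal (indicator {t. \<bar>t\<bar> < 1 / 2} (s (\<xi> n x))) \<partial>\<Lambda>)"
        by (simp add: ennreal_indicator)
      also have "\<dots> \<le> ennreal (0 * m + (2 / \<beta>) powr p * (k * \<epsilon> n))"
      proof (rule affine)
        fix x
        show "indicator {t. \<bar>t\<bar> < 1 / 2} (s (\<xi> n x)) \<le> 0 + (2 / \<beta>) powr p * d (\<xi> n x) powr p"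
        proof (cases "\<bar>s (\<xi> n x)\<bar> < 1 / 2")
          case True
          then have "1 / 2 \<le> \<bar>\<bar>s (\<xi> n x)\<bar> - 1\<bar>" by linarith
          also note ds
          finally have "1 \<le> 2 / \<beta> * d (\<xi> n x)" by (simp add: mult.commute)
          then have "1 powr p \<le> (2 / \<beta> * d (\<xi> n x)) powr p" using p by (intro powr_mono2) auto
          also have "\<dots> = (2 / \<beta>) powr p * d (\<xi> n x) powr p" using \<beta> d0 by (intro powr_mult) 
          finally show ?thesis using True by simp
        qed simp
      qed auto
      also have "\<dots> \<le> ennreal (C * \<epsilon> n)"
        using C(4) ep[of n] by (intro ennreal_leI) (simp add: mult_right_mono flip: mult.assoc)
      finally show ?thesis .
    qed
    show "(\<integral>\<^sup>+x. indicator \<Omega> x * ennreal \<bar>\<bar>y n x\<bar> - 1\<bar> \<partial>lborel) \<le> ennreal (\<delta> n)" for n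
    proof -
      define \<eta> where "\<eta> = \<epsilon> n powr (1 / p)"
      have \<eta>: "0 < \<eta>" using ep[of n] by (simp add: \<eta>_def)
      \<comment> \<open>As \<open>\<eta> powr p\<close> is \<open>\<epsilon> n\<close>, both halves
        of the splitting contribute at order \<open>\<eta>\<close>.\<close>
      have \<eta>e: "\<eta> powr (1 - p) * \<epsilon> n = \<eta>"
      proof -
        have "\<eta> powr (1 - p) * \<epsilon> n = \<epsilon> n powr (1 / p * (1 - p)) * \<epsilon> n powr 1"
          using ep[of n] by (simp add: \<eta>_def powr_powr)
        also have "\<dots> = \<epsilon> n powr (1 / p)"
          unfolding powr_add[symmetric] using p by (simp add: diff_divide_distrib)
        finally show ?thesis by (simp add: \<eta>_def)
      qed
      have "(\<integral>\<^sup>+x. indicator \<Omega> x * ennreal \<bar>\<bar>y n x\<bar> - 1\<bar> \<partial>lborel) = (\<integral>\<^sup>+x. ennreal \<bar>\<bar>s (\<xi> n x)\<bar> - 1\<bar> \<partial>\<Lambda>)"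
        using nn_integral_borel_version[OF y \<Omega>(1), of "\<lambda>t. ennreal \<bar>\<bar>t\<bar> - 1\<bar>" n] by (simp add: \<Lambda>_def)
      also have "\<dots> \<le> ennreal (\<eta> / \<beta> * m + \<eta> powr (1 - p) / \<beta> * (k * \<epsilon> n))"
      proof (rule affine)
        fix x
        have "d (\<xi> n x) \<le> \<eta> + \<eta> powr (1 - p) * d (\<xi> n x) powr p"
        proof (cases "d (\<xi> n x) \<le> \<eta>")
          case True
          then show ?thesis by (simp add: add_increasing2)
        next
          case False
          then have "d (\<xi> n x) = d (\<xi> n x) powr (1 - p) * d (\<xi> n x) powr p"
            using \<eta> by (simp flip: powr_add)
          also have "\<dots> \<le> \<eta> powr (1 - p) * d (\<xi> n x) powr p"
            using False \<eta> p by (intro mult_right_mono powr_mono2') auto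
          finally show ?thesis using \<eta> by simp
        qed
        then have "d (\<xi> n x) / \<beta> \<le> (\<eta> + \<eta> powr (1 - p) * d (\<xi> n x) powr p) / \<beta>"
          using \<beta> by (intro divide_right_mono) auto
        then show "\<bar>\<bar>s (\<xi> n x)\<bar> - 1\<bar> \<le> \<eta> / \<beta> + \<eta> powr (1 - p) / \<beta> * d (\<xi> n x) powr p"
          using ds[of "\<xi> n x"] by (simp add: add_divide_distrib)
      qed (use \<eta> \<beta> in auto)
      also have "\<eta> / \<beta> * m + \<eta> powr (1 - p) / \<beta> * (k * \<epsilon> n) = \<eta> / \<beta> * m + k / \<beta> * (\<eta> powr (1 - p) * \<epsilon> n)"
        by simp
      also have "\<dots> = \<delta> n" unfolding \<eta>e by (simp add: \<delta>_def \<eta>_def[symmetric] add_divide_distrib algebra_simps)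
      finally show ?thesis .
    qed
    show "0 \<le> \<delta> n" for n using m(2) k0 \<beta> by (simp add: \<delta>_def)
    have "(\<lambda>n. \<epsilon> n powr (1 / p)) \<longlonglongrightarrow> 0"
      by (rule tendsto_zero_powrI[OF assms(13) tendsto_const]) (use p ep in \<open>auto intro!: always_eventually less_imp_le\<close>)
    from tendsto_mult_right_zero[OF this, of "(m + k) / \<beta>"] show "\<delta> \<longlonglongrightarrow> 0"
      unfolding \<delta>_def[abs_def] .
  qed (use hp ep assms(11,13) in auto)
  then obtain r where r: "strict_mono r"
    and cases: "(\<lambda>n. emeasure lborel {x \<in> \<Omega>. 0 \<le> y (r n) x}) \<longlonglongrightarrow> 0 \<or>
     (\<lambda>n. emeasure lborel {x \<in> \<Omega>. y (r n) x < 0}) \<longlonglongrightarrow> 0" by blast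

  \<comment> \<open>Convergence in \<open>Lp_on\<close> to the selected well\<close>
  have \<xi>Lp: "\<xi> n \<in> Lp_on p \<Omega>" for n
  proof -
    have "(\<integral>\<^sup>+x. ennreal (norm (\<xi> n x) powr p) \<partial>\<Lambda>) \<le> ennreal (2 powr p * norm A powr p * m + 2 powr p * (k * \<epsilon> n))"
    proof (rule affine)
      fix x
      have "norm (\<xi> n x) powr p \<le> (d (\<xi> n x) + norm A) powr p"
        using dA_le(3) p by (intro powr_mono2) auto
      also have "\<dots> \<le> 2 powr p * (d (\<xi> n x) powr p + norm A powr p)"
        using d0 p by (intro powr_add_le) auto
      finally show "norm (\<xi> n x) powr p \<le> 2 powr p * norm A powr p + 2 powr p * d (\<xi> n x) powr p"
        by (simp add: distrib_left)
    qed auto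
    then have "(\<integral>\<^sup>+x. ennreal (norm (norm (\<xi> n x) powr p)) \<partial>\<Lambda>) < \<infinity>"
      by (simp add: le_less_trans)
    then have "integrable \<Lambda> (\<lambda>x. norm (\<xi> n x) powr p)"
      by (intro integrableI_bounded) measurable
    then show ?thesis using \<xi>m by (simp add: Lp_on_def \<Lambda>_def)
  qed
  have constLp: "(\<lambda>_. \<zeta>) \<in> Lp_on p \<Omega>" for \<zeta> :: "real^3^3"
  proof -
    have "finite_measure \<Lambda>" using m by (intro finite_measureI) simp
    then have "integrable \<Lambda> (\<lambda>_. norm \<zeta> powr p)" by (rule finite_measure.integrable_const)
    then show ?thesis by (simp add: Lp_on_def \<Lambda>_def)
  qed
  \<comment> \<open>Treats both outcomes at once: \<open>P\<close> describes the phase that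
    disappears and \<open>\<zeta>\<close> is the other well. Off \<open>P\<close> the distance to
    \<open>\<zeta>\<close> is the distance to the wells; on \<open>P\<close> it exceeds that by at
    most \<open>2 * norm A\<close>, and the constant this produces is multiplied by a vanishing
    measure.\<close>
  have conv: "Lp_converges p \<Omega> (\<lambda>n. \<xi> (r n)) (\<lambda>_. \<zeta>)"
    if lim: "(\<lambda>n. emeasure lborel {x \<in> \<Omega>. P (y (r n) x)}) \<longlonglongrightarrow> 0" and P[measurable]: "Measurable.pred borel P"
      and right: "\<And>\<theta>. \<not> P (s \<theta>) \<Longrightarrow> norm (\<theta> - \<zeta>) = d \<theta>" and wrong: "\<And>\<theta>. norm (\<theta> - \<zeta>) \<le> d \<theta> + 2 * norm A"
    for P \<zeta>
  proof (rule Lp_convergesI)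
    show "0 < p" using p by simp
    show "\<xi> (r n) \<in> Lp_on p \<Omega>" for n by (rule \<xi>Lp)
    show "(\<lambda>_. \<zeta>) \<in> Lp_on p \<Omega>" by (rule constLp)
    define a where "a = 2 powr p * (2 * norm A) powr p"
    have a: "0 \<le> a" by (simp add: a_def)
    have sm[measurable]: "s \<in> borel_measurable borel"
      unfolding s_def[abs_def] column_def using \<beta>
      by (intro borel_measurable_continuous_onI continuous_intros continuous_on_vec_lambda) auto
    have bound: "(\<integral>\<^sup>+x. ennreal (norm (\<xi> n x - \<zeta>) powr p) \<partial>\<Lambda>)
       \<le> ennreal ((1 + 2 powr p) * (k * \<epsilon> n)) + ennreal a * emeasure lborel {x \<in> \<Omega>. P (y n x)}" for n
    proof -
      have "(\<integral>\<^sup>+x. ennreal (norm (\<xi> n x - \<zeta>) powr p) \<partial>\<Lambda>) \<le>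
        (\<integral>\<^sup>+x. ennreal ((1 + 2 powr p) * d (\<xi> n x) powr p) + ennreal a * indicator {t. P t} (s (\<xi> n x)) \<partial>\<Lambda>)"
      proof (rule nn_integral_mono)
        fix x
        show "ennreal (norm (\<xi> n x - \<zeta>) powr p) \<le>
          ennreal ((1 + 2 powr p) * d (\<xi> n x) powr p) + ennreal a * indicator {t. P t} (s (\<xi> n x))"
        proof (cases "P (s (\<xi> n x))")
          case False
          then have "norm (\<xi> n x - \<zeta>) powr p = 1 * d (\<xi> n x) powr p" using right by simp
          also have "\<dots> \<le> (1 + 2 powr p) * d (\<xi> n x) powr p" by (intro mult_right_mono) auto
          finally show ?thesis using False by (simp add: ennreal_leI)
        next
          case True
          have "norm (\<xi> n x - \<zeta>) powr p \<le> (d (\<xi> n x) + 2 * norm A) powr p"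
            using wrong p by (intro powr_mono2) auto
          also have "\<dots> \<le> 2 powr p * (d (\<xi> n x) powr p + (2 * norm A) powr p)"
            using d0 p by (intro powr_add_le) auto
          also have "\<dots> \<le> (1 + 2 powr p) * d (\<xi> n x) powr p + a"
            by (simp add: a_def algebra_simps)
          finally have "ennreal (norm (\<xi> n x - \<zeta>) powr p) \<le> ennreal ((1 + 2 powr p) * d (\<xi> n x) powr p + a)"
            by (rule ennreal_leI)
          also have "\<dots> = ennreal ((1 + 2 powr p) * d (\<xi> n x) powr p) + ennreal a"
            using a by (intro ennreal_plus) auto
          finally show ?thesis using True by simp
        qed
      qed
      also have "\<dots> = (\<integral>\<^sup>+x. ennreal ((1 + 2 powr p) * d (\<xi> n x) powr p) \<partial>\<Lambda>) +
          ennreal a * (\<integral>\<^sup>+x. indicator {t. P t} (s (\<xi> n x)) \<partial>\<Lambda>)"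
        by (subst nn_integral_add) (auto simp: nn_integral_cmult)
      also have "\<dots> \<le> ennreal (0 * m + (1 + 2 powr p) * (k * \<epsilon> n)) + ennreal a * (\<integral>\<^sup>+x. indicator {t. P t} (s (\<xi> n x)) \<partial>\<Lambda>)"
        by (intro add_right_mono affine) auto
      finally show ?thesis using level[OF P, of n] by simp
    qed
    show "(\<lambda>n. \<integral>\<^sup>+x. ennreal (norm (\<xi> (r n) x - \<zeta>) powr p) \<partial>lebesgue_on \<Omega>) \<longlonglongrightarrow> 0"
    proof (rule ennreal_tendsto_0_mono)
      show "(\<integral>\<^sup>+x. ennreal (norm (\<xi> (r n) x - \<zeta>) powr p) \<partial>lebesgue_on \<Omega>)
         \<le> ennreal ((1 + 2 powr p) * (k * \<epsilon> (r n))) + ennreal a * emeasure lborel {x \<in> \<Omega>. P (y (r n) x)}" for n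
        using bound[of "r n"] by (simp add: \<Lambda>_def)
      have "(\<lambda>n. \<epsilon> (r n)) \<longlonglongrightarrow> 0" using LIMSEQ_subseq_LIMSEQ[OF assms(13) r] by (simp add: comp_def)
      then have "(\<lambda>n. ennreal ((1 + 2 powr p) * (k * \<epsilon> (r n)))) \<longlonglongrightarrow> ennreal ((1 + 2 powr p) * (k * 0))"
        by (intro tendsto_ennrealI tendsto_mult tendsto_const)
      moreover have "(\<lambda>n. ennreal a * emeasure lborel {x \<in> \<Omega>. P (y (r n) x)}) \<longlonglongrightarrow> ennreal a * 0"
        by (rule ennreal_tendsto_cmult[OF _ lim]) simp
      ultimately show "(\<lambda>n. ennreal ((1 + 2 powr p) * (k * \<epsilon> (r n))) + ennreal a * emeasure lborel {x \<in> \<Omega>. P (y (r n) x)}) \<longlonglongrightarrow> 0"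
        using tendsto_add by fastforce
    qed
  qed
  from cases show ?thesis
  proof
    assume "(\<lambda>n. emeasure lborel {x \<in> \<Omega>. 0 \<le> y (r n) x}) \<longlonglongrightarrow> 0"
    then have "Lp_converges p \<Omega> (\<lambda>n. \<xi> (r n)) (\<lambda>_. B)"
      by (rule conv) (use dB dA_le(2) A0(1) in auto)
    then show ?thesis using r by (auto simp: \<xi>_def \<Omega>_def)
  next
    assume "(\<lambda>n. emeasure lborel {x \<in> \<Omega>. y (r n) x < 0}) \<longlonglongrightarrow> 0"
    then have "Lp_converges p \<Omega> (\<lambda>n. \<xi> (r n)) (\<lambda>_. A)"
      by (rule conv) (use dA dA_le(1) in auto)
    then show ?thesis using r by (auto simp: \<xi>_def \<Omega>_def)
  qed
qed

end
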